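(* Let $(X_n)_{n\in\mathbb{N}}$ be a stationary and absolutely regular process of real random variables and let $h:\mathbb{R}^2\to\mathbb{R}$ be a symmetric measurable kernel such that for some $\delta>0$ and $M>0$: $$\iint |h(x_1,x_2)|^{6+\delta}\,dF(x_1)\,dF(x_2)\le M,$$ $$\forall k\in\mathbb{N}_0:\quad \int |h(x_1,x_{1+k})|^{4+\frac{2}{3}\delta}\,dP(x_1,x_{1+k})\le M,$$ and such that for some $\delta'\in(0,\delta)$: $\beta(n)=O\big(n^{-\frac{3(6+\delta')}{\delta'}}\big)$. Then the circular block bootstrap variance estimator converges with the following rate: $$\min_{l:\; l^{-1}+l^{2}n^{-1}\to0}\operatorname{MSE}\Big(\operatorname{Var}^{\star}\big[\sqrt{bl}\,U_n^{\star}(h)\big]\Big)=O\big(n^{-\frac23}\big),$$ where the minimum is over block length sequences $l=l_n$ with $l_n^{-1}+l_n^2n^{-1}\to0$ as $n\to\infty$.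
   Context: Stationary means strictly stationary. $F$ is the distribution of $X_1$, and $dP(x_1,x_{1+k})$ denotes integration with respect to the joint distribution of $(X_1,X_{1+k})$. U-statistic: $U_n(h)=\frac{2}{n(n-1)}\sum_{1\le i<j\le n}h(X_i,X_j)$. Circular block bootstrap: given the sample $X_1,\ldots,X_n$ and block length $l=l_n$ ($1\le l\le n$), put $b=\lfloor n/l\rfloor$ and extend the sample periodically by $X_{i+n}=X_i$. The bootstrap sample $X_1^{\star},\ldots,X_{bl}^{\star}$ consists of $b$ blocks of length $l$ which are, conditionally on $(X_n)_{n\in\mathbb{N}}$, independent, with $P^{\star}[X^{\star}_{kl+1}=X_j,\ldots,X^{\star}_{(k+1)l}=X_{j+l-1}]=\frac1n$ for $j=1,\ldots,n$ and $k=0,\ldots,b-1$ (each block starts at a uniformly chosen index $j$). $P^{\star},E^{\star},\operatorname{Var}^{\star}$ are the probability, expectation and variance conditionally on $(X_n)_{n\in\mathbb{N}}$. The bootstrapped U-statistic is $U_n^{\star}(h)=\frac{2}{bl(bl-1)}\sum_{1\le i<j\le bl}h(X_i^{\star},X_j^{\star})$. $\operatorname{MSE}$ denotes the mean squared error of $\operatorname{Var}^{\star}[\sqrt{bl}\,U_n^{\star}(h)]$ as an estimator of $\operatorname{Var}[\sqrt{n}\,U_n(h)]$, i.e. $E\big[(\operatorname{Var}^{\star}[\sqrt{bl}\,U_n^{\star}(h)]-\operatorname{Var}[\sqrt{n}\,U_n(h)])^2\big]$. The displayed rate means that there is a sequence of block lengths $l_n$ with $l_n^{-1}+l_n^2n^{-1}\to0$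 for which the MSE is $O(n^{-2/3})$. Absolute regularity: $\beta(m)=\sup_{k\in\mathbb{N}}\beta\big((X_1,\ldots,X_k),(X_j)_{j\ge k+m}\big)$ with $\beta(Y,Z)=E\big[\sup_{A\in\sigma(Y)}|P[A|Z]-P[A]|\big]$ (essential supremum); the process is absolutely regular if $\beta(m)\to0$ as $m\to\infty$. *)

theory Defs
  imports "HOL-Probability.Probability" "HOL-Library.Landau_Symbols"
begin

text \<open>
  Processes \<open>(X\<^sub>n)\<close> with \<open>n \<in> \<nat> = {1, 2, \<dots>}\<close> are functions \<open>X :: nat \<Rightarrow> 'a \<Rightarrow> real\<close> whose
  value at index \<open>0\<close> is never used; samples \<open>x :: nat \<Rightarrow> real\<close> are likewise indexed from \<open>1\<close>.
\<close>

definition strictly_stationary :: "'a measure \<Rightarrow> (nat \<Rightarrow> 'a \<Rightarrow> real) \<Rightarrow> bool" where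
  "strictly_stationary M X \<longleftrightarrow>
     (\<forall>I t. finite I \<and> I \<subseteq> {1..} \<longrightarrow>
        distr M (\<Pi>\<^sub>M i\<in>I. borel) (\<lambda>\<omega>. \<lambda>i\<in>I. X (i + t) \<omega>) =
        distr M (\<Pi>\<^sub>M i\<in>I. borel) (\<lambda>\<omega>. \<lambda>i\<in>I. X i \<omega>))"


section \<open>Absolute regularity\<close>

definition sigma_gen :: "'a measure \<Rightarrow> (nat \<Rightarrow> 'a \<Rightarrow> real) \<Rightarrow> nat set \<Rightarrow> 'a measure" where
  "sigma_gen M X I =
     vimage_algebra (space M) (\<lambda>\<omega>. \<lambda>i\<in>I. X i \<omega>) (\<Pi>\<^sub>M i\<in>I. (borel :: real measure))"

text \<open>
  Essential supremum of a family \<open>G\<close> of random variables: the almost surely least measurable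
  function that almost surely dominates each member. (\<^const>\<open>esssup\<close> is the essential supremum
  of one function and yields a number.)
\<close>

definition is_ess_Sup :: "'a measure \<Rightarrow> ('a \<Rightarrow> real) set \<Rightarrow> ('a \<Rightarrow> real) \<Rightarrow> bool" where
  "is_ess_Sup M G g \<longleftrightarrow>
     g \<in> borel_measurable M \<and>
     (\<forall>f\<in>G. AE \<omega> in M. f \<omega> \<le> g \<omega>) \<and>
     (\<forall>g'\<in>borel_measurable M. (\<forall>f\<in>G. AE \<omega> in M. f \<omega> \<le> g' \<omega>) \<longrightarrow> (AE \<omega> in M. g \<omega> \<le> g' \<omega>))"

definition ess_Sup :: "'a measure \<Rightarrow> ('a \<Rightarrow> real) set \<Rightarrow> ('a \<Rightarrow> real)" where
  "ess_Sup M G = (SOME g. is_ess_Sup M G g)"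

text \<open>
  The family below takes values almost surely in \<open>[0, 1]\<close>, so on a probability space its essential
  supremum exists, is almost surely unique and integrable, and the coefficients lie in \<open>[0, 1]\<close>.
\<close>

definition beta_dep :: "'a measure \<Rightarrow> 'a measure \<Rightarrow> 'a measure \<Rightarrow> real" where
  "beta_dep M \<A> \<B> =
     prob_space.expectation M
       (ess_Sup M ((\<lambda>A \<omega>. \<bar>real_cond_exp M \<B> (indicator A) \<omega> - measure M A\<bar>) ` sets \<A>))"

definition beta_mix :: "'a measure \<Rightarrow> (nat \<Rightarrow> 'a \<Rightarrow> real) \<Rightarrow> nat \<Rightarrow> real" where
  "beta_mix M X m = (SUP k\<in>{1..}. beta_dep M (sigma_gen M X {1..k}) (sigma_gen M X {k + m..}))"

definition absolutely_regular :: "'a measure \<Rightarrow> (nat \<Rightarrow> 'a \<Rightarrow> real) \<Rightarrow> bool" where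
  "absolutely_regular M X \<longleftrightarrow> beta_mix M X \<longlonglongrightarrow> 0"


section \<open>U-statistics and the circular block bootstrap\<close>

definition U_stat :: "(real \<Rightarrow> real \<Rightarrow> real) \<Rightarrow> nat \<Rightarrow> (nat \<Rightarrow> real) \<Rightarrow> real" where
  "U_stat h n x =
     2 / (real n * (real n - 1)) * (\<Sum>(i, j)\<in>{(i, j). 1 \<le> i \<and> i < j \<and> j \<le> n}. h (x i) (x j))"

definition periodic_ext :: "nat \<Rightarrow> (nat \<Rightarrow> real) \<Rightarrow> nat \<Rightarrow> real" where
  "periodic_ext n x i = x ((i - 1) mod n + 1)"

definition num_blocks :: "nat \<Rightarrow> nat \<Rightarrow> nat" where
  "num_blocks n l = n div l"

text \<open>
  The conditional law \<open>P\<^sup>\<star>\<close> of \<open>X\<^sup>\<star>\<^sub>1, \<dots>, X\<^sup>\<star>\<^sub>b\<^sub>l\<close> given the sample \<open>x\<close>. The start indices \<open>J 0, \<dots>, J (b - 1)\<close>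
  are independent and uniform on \<open>{1..n}\<close>, and \<open>X\<^sup>\<star>\<close> at \<open>k * l + r\<close> with \<open>1 \<le> r \<le> l\<close> is the
  periodically extended sample at \<open>J k + r - 1\<close>. Only the indices \<open>1, \<dots>, b * l\<close> are meaningful.
\<close>

definition cbb_sample :: "nat \<Rightarrow> nat \<Rightarrow> (nat \<Rightarrow> real) \<Rightarrow> (nat \<Rightarrow> real) pmf" where
  "cbb_sample n l x =
     map_pmf (\<lambda>J i. periodic_ext n x (J ((i - 1) div l) + (i - 1) mod l))
       (Pi_pmf {..<num_blocks n l} 0 (\<lambda>_. pmf_of_set {1..n}))"

definition cbb_variance :: "(real \<Rightarrow> real \<Rightarrow> real) \<Rightarrow> nat \<Rightarrow> nat \<Rightarrow> (nat \<Rightarrow> real) \<Rightarrow> real" where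
  "cbb_variance h n l x =
     measure_pmf.variance (cbb_sample n l x)
       (\<lambda>x'. sqrt (real (num_blocks n l * l)) * U_stat h (num_blocks n l * l) x')"

definition U_variance :: "'a measure \<Rightarrow> (nat \<Rightarrow> 'a \<Rightarrow> real) \<Rightarrow> (real \<Rightarrow> real \<Rightarrow> real) \<Rightarrow> nat \<Rightarrow> real" where
  "U_variance M X h n =
     prob_space.variance M (\<lambda>\<omega>. sqrt (real n) * U_stat h n (\<lambda>i. X i \<omega>))"

text \<open>
  Valued in \<^typ>\<open>ennreal\<close>, so that an infinite mean squared error is not identified with \<open>0\<close>, as it
  would be by the Bochner integral.
\<close>

definition cbb_MSE ::
    "'a measure \<Rightarrow> (nat \<Rightarrow> 'a \<Rightarrow> real) \<Rightarrow> (real \<Rightarrow> real \<Rightarrow> real) \<Rightarrow> nat \<Rightarrow> nat \<Rightarrow> ennreal" where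
  "cbb_MSE M X h n l =
     (\<integral>\<^sup>+\<omega>. ennreal ((cbb_variance h n l (\<lambda>i. X i \<omega>) - U_variance M X h n)\<^sup>2) \<partial>M)"

end

theory Submission
  imports Defs
begin

text \<open>
  Write \<open>h x y = \<theta> + h\<^sub>1 x + h\<^sub>1 y + h\<^sub>2 x y\<close> (Hoeffding). For block length \<open>l \<sim> n\<^sup>1\<^sup>/\<^sup>3\<close> the linear part contributes
  a bias of order \<open>1/l\<close> and a variance of order \<open>l/n\<close> to the bootstrap variance estimator. The degenerate
  part is of smaller order: splitting the conditional variance along the independent blocks reduces it to
  fourth moments of the block sums \<open>\<Sum> h\<^sub>2 (X\<^sub>r) (X\<^sub>s)\<close>.

  All moment bounds rest on one estimate. If an index of a product of four kernels is at distance \<open>m\<close> from the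
  others, absolute regularity allows it to be replaced by an independent copy at cost \<open>O(m\<^sup>-\<^sup>3)\<close>, after which
  degeneracy makes the expectation vanish. Since
  \<open>m\<^sup>-\<^sup>3\<^sup>/\<^sup>2\<close> is summable, two of four summation indices can be summed out against it.
\<close>

section \<open>Absolute regularity as a bound on total variation\<close>

text \<open>Mixing controls bounded functions, while products of kernels are merely integrable to
  some power. Since 4 + 2/3 \<delta> = 4 (1 + \<delta>/6), a product of four kernels has a moment of
  order 1 + \<delta>/6. Truncation at level c then costs O(c^(-\<delta>/6)) and decoupling of the
  truncated product costs O(c \<beta>(m)). With c = m^(18/\<delta>) and \<beta>(m) = O(m^-(3 +
  18/\<delta>)) both are O(m^-3); the assumed rate, with \<delta>' < \<delta>, implies this one.

  The conditional covariance of the linear and the degenerate part is never computed. Absorbing it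
  with \<eta> = 1/l costs about l times the degenerate variance plus 1/l times the linear one. The
  degenerate variance has root mean square O(l/n), so the cost is O(l^2/n + 1/l), and l^3 <= 8 n
  turns l^2/n into O(1/l). This is the order of the bias, so the squared error is O(1/l^2) =
  O(n^(-2/3)).

  Moments of circular blocks need no separate treatment at the seam, because the moment bounds hold
  for arbitrary finite index sets; only covariances of distant blocks distinguish the blocks that
  wrap around.\<close>

lemma (in prob_space) is_ess_Sup_ess_Sup:
  assumes ne: "G \<noteq> {}"
    and meas: "\<And>f. f \<in> G \<Longrightarrow> f \<in> borel_measurable M"
    and unit: "\<And>f. f \<in> G \<Longrightarrow> AE \<omega> in M. 0 \<le> f \<omega> \<and> f \<omega> \<le> 1"
  shows "is_ess_Sup M G (ess_Sup M G)"
proof -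
  \<comment> \<open>The members lie in [0, 1] only almost surely; clipping makes every countable
    supremum finite at every point.\<close>
  define c where "c f \<omega> = max 0 (min 1 (f \<omega>))" for f :: "'a \<Rightarrow> real" and \<omega>
  define S where "S F \<omega> = (SUP n. c (F n) \<omega>)" for F :: "nat \<Rightarrow> 'a \<Rightarrow> real" and \<omega>
  have c01: "0 \<le> c f \<omega>" "c f \<omega> \<le> 1" for f \<omega> by (auto simp: c_def)
  have c_ae: "AE \<omega> in M. c f \<omega> = f \<omega>" if "f \<in> G" for f
    using unit[OF that] by eventually_elim (auto simp: c_def)
  have bdd: "bdd_above (range (\<lambda>n. c (F n) \<omega>))" for F :: "nat \<Rightarrow> 'a \<Rightarrow> real" and \<omega>
    by (rule bdd_aboveI[of _ 1]) (auto simp: c01)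
  have upper: "c (F n) \<omega> \<le> S F \<omega>" for F n \<omega>
    unfolding S_def by (rule cSUP_upper[OF _ bdd]) auto
  have S01: "0 \<le> S F \<omega>" "S F \<omega> \<le> 1" for F \<omega>
  proof -
    show "0 \<le> S F \<omega>" using upper[of F 0 \<omega>] c01(1)[of "F 0" \<omega>] by linarith
    show "S F \<omega> \<le> 1" unfolding S_def by (rule cSUP_least) (auto simp: c01)
  qed
  have Sm: "S F \<in> borel_measurable M" if "range F \<subseteq> G" for F
  proof -
    have [measurable]: "F n \<in> borel_measurable M" for n using that meas by auto
    have "c (F n) \<in> borel_measurable M" for n unfolding c_def by measurable
    then show ?thesis unfolding S_def by (intro borel_measurable_cSUP bdd) auto
  qed
  have Si: "integrable M (S F)" if "range F \<subseteq> G" for F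
    by (rule integrable_const_bound[where B=1]) (use S01 Sm[OF that] in auto)
  \<comment> \<open>A pointwise supremum over an uncountable family may fail to be measurable. A
    countable subfamily whose supremum has the largest possible expectation replaces it: adjoining a
    further member cannot raise that expectation, so it changes the supremum on a null set
    only.\<close>
  define \<Phi> where "\<Phi> F = expectation (S F)" for F
  define s where "s = (SUP F\<in>{F. range F \<subseteq> G}. \<Phi> F)"
  have \<Phi>1: "\<Phi> F \<le> 1" if "range F \<subseteq> G" for F
    unfolding \<Phi>_def using integral_mono[OF Si[OF that], of "\<lambda>_. 1"] S01 by (simp add: prob_space)
  have bs: "bdd_above (\<Phi> ` {F. range F \<subseteq> G})"
    by (rule bdd_aboveI[of _ 1]) (auto intro: \<Phi>1)
  obtain f0 where f0: "f0 \<in> G" using ne by auto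
  have "\<exists>F. range F \<subseteq> G \<and> s - 1 / real (Suc k) < \<Phi> F" for k
  proof -
    have "\<exists>F\<in>{F. range F \<subseteq> G}. s - 1 / real (Suc k) < \<Phi> F"
      unfolding s_def
      by (rule less_cSUP_iff[THEN iffD1, OF _ bs]) (use f0 in \<open>auto intro!: exI[of _ "\<lambda>_. f0"]\<close>)
    then show ?thesis by auto
  qed
  then obtain F where F: "\<And>k. range (F k) \<subseteq> G" "\<And>k. s - 1 / real (Suc k) < \<Phi> (F k)"
    by metis
  \<comment> \<open>Pairing merges all near-optimal sequences into one, so \<open>S H\<close>
    dominates every \<open>S (F k)\<close> and its expectation reaches \<open>s\<close>.\<close>
  define H where "H n = (case prod_decode n of (k, i) \<Rightarrow> F k i)" for n
  have HG: "range H \<subseteq> G" using F(1) by (force simp: H_def split: prod.splits)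
  have "S (F k) \<omega> \<le> S H \<omega>" for k \<omega>
  proof -
    have "c (F k i) \<omega> \<le> S H \<omega>" for i
      using upper[of H "prod_encode (k, i)" \<omega>] by (simp add: H_def)
    then show ?thesis unfolding S_def[of "F k"] by (intro cSUP_least) auto
  qed
  then have "\<Phi> (F k) \<le> \<Phi> H" for k
    unfolding \<Phi>_def by (intro integral_mono Si F HG)
  then have "s \<le> \<Phi> H + 1 / real (Suc k)" for k
    using F(2)[of k] by (smt (verit))
  then have s\<Phi>: "s \<le> \<Phi> H"
    using LIMSEQ_le_const[OF tendsto_add[OF tendsto_const LIMSEQ_inverse_real_of_nat], of s "\<Phi> H"]
    by (auto simp: inverse_eq_divide)
  have dom: "AE \<omega> in M. f \<omega> \<le> S H \<omega>" if "f \<in> G" for f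
  proof -
    \<comment> \<open>The member f is adjoined at index 0; by maximality of \<open>s\<close> the
      enlarged supremum has the same expectation.\<close>
    define H' where "H' n = (case n of 0 \<Rightarrow> f | Suc m \<Rightarrow> H m)" for n
    have H'G: "range H' \<subseteq> G" using HG that by (force simp: H'_def split: nat.splits)
    have le: "S H \<omega> \<le> S H' \<omega>" for \<omega>
    proof -
      have "c (H i) \<omega> \<le> S H' \<omega>" for i
        using upper[of H' "Suc i" \<omega>] by (simp add: H'_def)
      then show ?thesis unfolding S_def[of "H"] by (intro cSUP_least) auto
    qed
    have "\<Phi> H' \<le> s" unfolding s_def by (rule cSUP_upper[OF _ bs]) (use H'G in auto)
    then have "expectation (\<lambda>\<omega>. S H' \<omega> - S H \<omega>) \<le> 0"
      using s\<Phi> by (subst Bochner_Integration.integral_diff) (auto simp: \<Phi>_def Si HG H'G)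
    moreover have "0 \<le> expectation (\<lambda>\<omega>. S H' \<omega> - S H \<omega>)"
      by (rule integral_nonneg_AE) (auto simp: le)
    ultimately have "expectation (\<lambda>\<omega>. S H' \<omega> - S H \<omega>) = 0" by simp
    then have "AE \<omega> in M. S H' \<omega> - S H \<omega> = 0"
      by (subst integral_nonneg_eq_0_iff_AE[symmetric]) (auto simp: le Si HG H'G)
    with c_ae[OF that] show ?thesis
    proof eventually_elim
      case (elim \<omega>)
      then show ?case using upper[of H' 0 \<omega>] by (simp add: H'_def)
    qed
  qed
  have least: "AE \<omega> in M. S H \<omega> \<le> g' \<omega>"
    if "\<forall>f\<in>G. AE \<omega> in M. f \<omega> \<le> g' \<omega>" for g'
  proof -
    have "AE \<omega> in M. \<forall>n. H n \<omega> \<le> g' \<omega>" using that HG by (subst AE_all_countable) auto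
    moreover have "AE \<omega> in M. \<forall>n. c (H n) \<omega> = H n \<omega>"
      using c_ae HG by (subst AE_all_countable) auto
    ultimately show ?thesis
      by eventually_elim (auto simp: S_def intro!: cSUP_least)
  qed
  have "is_ess_Sup M G (S H)"
    using Sm[OF HG] dom least by (auto simp: is_ess_Sup_def)
  then show ?thesis unfolding ess_Sup_def by (rule someI[of "is_ess_Sup M G"])
qed

lemma is_ess_Sup_least:
  "is_ess_Sup M G g \<Longrightarrow> g' \<in> borel_measurable M \<Longrightarrow> (\<And>f. f \<in> G \<Longrightarrow> AE \<omega> in M. f \<omega> \<le> g' \<omega>) \<Longrightarrow>
    AE \<omega> in M. g \<omega> \<le> g' \<omega>"
  unfolding is_ess_Sup_def by blast

section \<open>Joint law against product law of two sigma-algebras\<close>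

locale two_subalgebras = prob_space M for M :: "'a measure" +
  fixes A B :: "'a measure"
  assumes subA: "subalgebra M A" and subB: "subalgebra M B"
begin

sublocale B: finite_measure_subalgebra M B
  using subB by (simp add: finite_measure_subalgebra_def finite_measure_axioms
      finite_measure_subalgebra_axioms_def)

abbreviation dev :: "'a set \<Rightarrow> 'a \<Rightarrow> real" where
  "dev E \<omega> \<equiv> \<bar>real_cond_exp M B (indicator E) \<omega> - prob E\<bar>"

abbreviation dev_sup :: "'a \<Rightarrow> real" where
  "dev_sup \<equiv> ess_Sup M (dev ` sets A)"

lemma setsA: "E \<in> sets A \<Longrightarrow> E \<in> sets M" and setsB: "E \<in> sets B \<Longrightarrow> E \<in> sets M"
  and space_A: "space A = space M" and space_B: "space B = space M"
  using subA subB by (auto simp: subalgebra_def)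

lemma indicator_integrable: "E \<in> sets M \<Longrightarrow> integrable M (indicator E :: 'a \<Rightarrow> real)"
  by (rule integrable_const_bound[where B=1]) (auto simp: indicator_def)

lemma dev_unit:
  assumes "E \<in> sets A"
  shows "AE \<omega> in M. 0 \<le> dev E \<omega> \<and> dev E \<omega> \<le> 1"
proof -
  note [measurable] = setsA[OF assms]
  have "AE \<omega> in M. real_cond_exp M B (indicator E) \<omega> \<ge> 0"
    by (rule B.real_cond_exp_pos) auto
  moreover have "AE \<omega> in M. real_cond_exp M B (indicator E) \<omega> \<le> 1"
    by (rule B.real_cond_exp_le_c)
       (auto intro!: indicator_integrable simp: indicator_def)
  ultimately show ?thesis
  proof eventually_elim
    case (elim \<omega>)
    then show ?case using measure_nonneg[of M E] prob_le_1[of E] by linarith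
  qed
qed

lemma dev_sup_is_ess_Sup: "is_ess_Sup M (dev ` sets A) dev_sup"
proof (rule is_ess_Sup_ess_Sup)
  fix f assume "f \<in> dev ` sets A"
  then show "f \<in> borel_measurable M" by auto
next
  fix f assume "f \<in> dev ` sets A"
  then show "AE \<omega> in M. 0 \<le> f \<omega> \<and> f \<omega> \<le> 1" using dev_unit by auto
qed auto

lemma dev_le_dev_sup: "E \<in> sets A \<Longrightarrow> AE \<omega> in M. dev E \<omega> \<le> dev_sup \<omega>"
  using dev_sup_is_ess_Sup by (auto simp: is_ess_Sup_def)

lemma dev_sup_measurable [measurable]: "dev_sup \<in> borel_measurable M"
  using dev_sup_is_ess_Sup by (auto simp: is_ess_Sup_def)

lemma dev_sup_unit: "AE \<omega> in M. 0 \<le> dev_sup \<omega> \<and> dev_sup \<omega> \<le> 1"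
proof -
  have "\<forall>f\<in>dev ` sets A. AE \<omega> in M. f \<omega> \<le> 1" using dev_unit by auto
  then have "AE \<omega> in M. dev_sup \<omega> \<le> 1"
    by (intro is_ess_Sup_least[OF dev_sup_is_ess_Sup, of "\<lambda>_. 1"]) auto
  moreover have "AE \<omega> in M. dev {} \<omega> \<le> dev_sup \<omega>"
    by (rule dev_le_dev_sup) simp
  ultimately show ?thesis by eventually_elim auto
qed

lemma dev_sup_integrable: "integrable M dev_sup"
  by (rule integrable_const_bound[where B=1]) (use dev_sup_unit in auto)

lemma beta_dep_eq: "beta_dep M A B = expectation dev_sup"
  by (simp add: beta_dep_def)

lemma beta_dep_unit: "0 \<le> beta_dep M A B" "beta_dep M A B \<le> 1"
proof -
  show "0 \<le> beta_dep M A B"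
    unfolding beta_dep_eq by (rule integral_nonneg_AE) (use dev_sup_unit in auto)
  have "expectation dev_sup \<le> expectation (\<lambda>_. 1)"
    by (rule integral_mono_AE[OF dev_sup_integrable]) (use dev_sup_unit in auto)
  then show "beta_dep M A B \<le> 1" by (simp add: beta_dep_eq prob_space)
qed

text \<open>The factor \<open>indicator H\<close> is kept on the right because in a finite disjoint
  union of rectangles with disjoint second sides these factors add up to 1, so the whole union costs
  a single \<beta>.\<close>

lemma rect_dev:
  assumes E: "E \<in> sets A" and H: "H \<in> sets B"
  shows "\<bar>prob (E \<inter> H) - prob E * prob H\<bar> \<le> expectation (\<lambda>\<omega>. indicator H \<omega> * dev_sup \<omega>)"
proof -
  note [measurable] = setsA[OF E] setsB[OF H]
  let ?c = "real_cond_exp M B (indicator E)"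
  have ic: "integrable M ?c"
    by (intro B.real_cond_exp_int indicator_integrable) auto
  have i1: "integrable M (\<lambda>\<omega>. indicator H \<omega> * ?c \<omega>)"
    using ic integrable_mult_indicator[OF setsB[OF H] ic] by simp
  have "(\<integral>x\<in>H. indicator E x \<partial>M) = (\<integral>x\<in>H. ?c x \<partial>M)"
    by (rule B.real_cond_exp_intA) (use H in \<open>auto intro: indicator_integrable\<close>)
  moreover have "(\<integral>x\<in>H. indicator E x \<partial>M) = prob (E \<inter> H)"
    unfolding set_lebesgue_integral_def
    by (simp add: indicator_inter_arith[symmetric] mult.commute Int_commute)
  ultimately have "prob (E \<inter> H) - prob E * prob H = expectation (\<lambda>\<omega>. indicator H \<omega> * ?c \<omega> - indicator H \<omega> * prob E)"
    by (subst Bochner_Integration.integral_diff)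
       (auto simp: i1 set_lebesgue_integral_def intro!: integrable_mult_left indicator_integrable)
  also have "\<bar>\<dots>\<bar> \<le> expectation (\<lambda>\<omega>. \<bar>indicator H \<omega> * ?c \<omega> - indicator H \<omega> * prob E\<bar>)"
    by (rule integral_abs_bound)
  also have "\<dots> \<le> expectation (\<lambda>\<omega>. indicator H \<omega> * dev_sup \<omega>)"
  proof (rule integral_mono_AE)
    show "integrable M (\<lambda>\<omega>. \<bar>indicator H \<omega> * ?c \<omega> - indicator H \<omega> * prob E\<bar>)"
      by (intro integrable_abs Bochner_Integration.integrable_diff i1 integrable_mult_left indicator_integrable) auto
    show "integrable M (\<lambda>\<omega>. indicator H \<omega> * dev_sup \<omega>)"
      using integrable_mult_indicator[OF setsB[OF H] dev_sup_integrable] by simp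
    show "AE \<omega> in M. \<bar>indicator H \<omega> * ?c \<omega> - indicator H \<omega> * prob E\<bar> \<le> indicator H \<omega> * dev_sup \<omega>"
      using dev_le_dev_sup[OF E] by eventually_elim (auto simp: indicator_def)
  qed
  finally show ?thesis .
qed

text \<open>The algebra of finite unions of rectangles, coded by the simple function sending \<open>y\<close> to its section.\<close>

definition sect :: "('a \<Rightarrow> 'a set) \<Rightarrow> ('a \<times> 'a) set" where
  "sect S = {(x, y). x \<in> space M \<and> y \<in> space M \<and> x \<in> S y}"

definition step_sect :: "('a \<Rightarrow> 'a set) \<Rightarrow> bool" where
  "step_sect S \<longleftrightarrow> simple_function B S \<and> S ` space M \<subseteq> sets A"

lemma pair_sets_M: "sets (A \<Otimes>\<^sub>M B) \<subseteq> sets (M \<Otimes>\<^sub>M M)"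
proof -
  have "{a \<times> b |a b. a \<in> sets A \<and> b \<in> sets B} \<subseteq> {a \<times> b |a b. a \<in> sets M \<and> b \<in> sets M}"
    using setsA setsB by blast
  then show ?thesis unfolding sets_pair_measure space_A space_B by (rule sigma_sets_mono')
qed

lemma sect_UN:
  assumes "step_sect S"
  shows "sect S = (\<Union>E\<in>S ` space M. E \<times> (S -` {E} \<inter> space M))"
proof -
  have "S y \<subseteq> space M" if "y \<in> space M" for y
    using assms sets.sets_into_space[of "S y" A] that by (auto simp: step_sect_def space_A)
  then show ?thesis by (auto simp: sect_def)
qed

lemma sect_props:
  assumes "step_sect S"
  shows "finite (S ` space M)" "\<And>E. E \<in> S ` space M \<Longrightarrow> E \<in> sets A"
    "\<And>E. E \<in> S ` space M \<Longrightarrow> S -` {E} \<inter> space M \<in> sets B"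
  using assms by (auto simp: step_sect_def simple_function_def space_B)

lemma sect_sets: "step_sect S \<Longrightarrow> sect S \<in> sets (A \<Otimes>\<^sub>M B)"
  unfolding sect_UN by (intro sets.finite_UN sect_props(1) pair_measureI sect_props(2,3)) assumption+

lemma step_sect_compl:
  assumes "step_sect S"
  shows "step_sect (\<lambda>y. space M - S y)" "sect (\<lambda>y. space M - S y) = (space M \<times> space M) - sect S"
proof -
  have "simple_function B (\<lambda>y. space M - S y)"
    using assms simple_function_compose1[of B S "\<lambda>E. space M - E"] by (simp add: step_sect_def)
  moreover have "space M - S y \<in> sets A" if "y \<in> space M" for y
    using assms that unfolding step_sect_def space_A[symmetric] by (intro sets.compl_sets) blast
  ultimately show "step_sect (\<lambda>y. space M - S y)"
    unfolding step_sect_def by blast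
  show "sect (\<lambda>y. space M - S y) = (space M \<times> space M) - sect S"
    unfolding sect_def by blast
qed

lemma step_sect_Un:
  assumes "step_sect S" "step_sect T"
  shows "step_sect (\<lambda>y. S y \<union> T y)" "sect (\<lambda>y. S y \<union> T y) = sect S \<union> sect T"
proof -
  have "simple_function B (\<lambda>y. S y \<union> T y)"
    using assms simple_function_compose2[of B S T "(\<union>)"] by (simp add: step_sect_def)
  moreover have "S y \<union> T y \<in> sets A" if "y \<in> space M" for y
    using assms that unfolding step_sect_def by blast
  ultimately show "step_sect (\<lambda>y. S y \<union> T y)"
    unfolding step_sect_def by blast
  show "sect (\<lambda>y. S y \<union> T y) = sect S \<union> sect T"
    unfolding sect_def by blast
qed

lemma step_sect_rect:
  assumes "E \<in> sets A" "H \<in> sets B"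
  shows "step_sect (\<lambda>y. if y \<in> H then E else {})" "sect (\<lambda>y. if y \<in> H then E else {}) = E \<times> H"
proof -
  have "{x \<in> space B. x \<in> H} \<in> sets B"
    using assms(2) sets.sets_into_space[OF assms(2)] by (simp add: Collect_conj_eq Int_absorb1)
  then have "simple_function B (\<lambda>y. if y \<in> H then E else {})"
    by (intro simple_function_If) auto
  then show "step_sect (\<lambda>y. if y \<in> H then E else {})"
    using assms unfolding step_sect_def by auto
  have "E \<subseteq> space M" "H \<subseteq> space M"
    using sets.sets_into_space[OF assms(1)] sets.sets_into_space[OF assms(2)] by (simp_all add: space_A space_B)
  then show "sect (\<lambda>y. if y \<in> H then E else {}) = E \<times> H"
    unfolding sect_def by (auto split: if_splits)
qed

text \<open>Law of the diagonal embedding. On \<open>A \<Otimes>\<^sub>M B\<close> it is the joint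
  law of the two sigma-algebras, while \<open>M \<Otimes>\<^sub>M M\<close> is the law that makes
  them independent; decoupling means comparing the two.\<close>

definition diagm :: "('a \<times> 'a) measure" where
  "diagm = distr M (M \<Otimes>\<^sub>M M) (\<lambda>\<omega>. (\<omega>, \<omega>))"

sublocale pair: pair_prob_space M M ..

lemma diagm_prob: "prob_space diagm"
  unfolding diagm_def by (rule prob_space_distr) simp

lemma diagm_rect: "E \<in> sets M \<Longrightarrow> H \<in> sets M \<Longrightarrow> measure diagm (E \<times> H) = prob (E \<inter> H)"
  unfolding diagm_def by (subst measure_distr) (auto intro!: arg_cong[where f=prob] dest: sets.sets_into_space)

lemma pair_rect:
  "E \<in> sets M \<Longrightarrow> H \<in> sets M \<Longrightarrow> measure (M \<Otimes>\<^sub>M M) (E \<times> H) = prob E * prob H"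
  by (simp add: measure_def emeasure_pair_measure_Times enn2real_mult)

text \<open>The sets on which the section is constant partition the space, so the deviations of the
  single rectangles sum to the expectation of \<open>dev_sup\<close>, however many rectangles there
  are.\<close>

lemma step_sect_dev:
  assumes S: "step_sect S"
  shows "\<bar>measure diagm (sect S) - measure (M \<Otimes>\<^sub>M M) (sect S)\<bar> \<le> beta_dep M A B"
proof -
  interpret dg: prob_space diagm by (rule diagm_prob)
  note p = sect_props[OF S]
  let ?I = "S ` space M" and ?R = "\<lambda>E. E \<times> (S -` {E} \<inter> space M)"
  let ?H = "\<lambda>E. S -` {E} \<inter> space M"
  have R: "?R ` ?I \<subseteq> sets (M \<Otimes>\<^sub>M M)" using p setsA setsB by auto
  have disj: "disjoint_family_on ?R ?I" by (auto simp: disjoint_family_on_def)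
  have Hdisj: "disjoint_family_on ?H ?I" by (auto simp: disjoint_family_on_def)
  have "measure diagm (sect S) = (\<Sum>E\<in>?I. measure diagm (?R E))"
    unfolding sect_UN[OF S]
    by (rule dg.finite_measure_finite_Union) (use p R disj in \<open>auto simp: diagm_def\<close>)
  moreover have "measure (M \<Otimes>\<^sub>M M) (sect S) = (\<Sum>E\<in>?I. measure (M \<Otimes>\<^sub>M M) (?R E))"
    unfolding sect_UN[OF S]
    by (rule pair.P.finite_measure_finite_Union) (use p R disj in \<open>auto\<close>)
  ultimately have "\<bar>measure diagm (sect S) - measure (M \<Otimes>\<^sub>M M) (sect S)\<bar>
      = \<bar>\<Sum>E\<in>?I. prob (E \<inter> ?H E) - prob E * prob (?H E)\<bar>"
    using p setsA setsB by (simp add: sum_subtractf diagm_rect pair_rect)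
  also have "\<dots> \<le> (\<Sum>E\<in>?I. expectation (\<lambda>\<omega>. indicator (?H E) \<omega> * dev_sup \<omega>))"
    by (rule order_trans[OF sum_abs]) (intro sum_mono rect_dev p)
  also have "\<dots> = expectation (\<lambda>\<omega>. \<Sum>E\<in>?I. indicator (?H E) \<omega> * dev_sup \<omega>)"
  proof (rule Bochner_Integration.integral_sum[symmetric])
    fix E assume "E \<in> ?I"
    then show "integrable M (\<lambda>\<omega>. indicator (?H E) \<omega> * dev_sup \<omega>)"
      using integrable_mult_indicator[OF setsB[OF p(3)] dev_sup_integrable] by simp
  qed
  also have "\<dots> = expectation dev_sup"
  proof (rule Bochner_Integration.integral_cong[OF refl])
    fix \<omega> assume w: "\<omega> \<in> space M"
    have "(\<Sum>E\<in>?I. indicator (?H E) \<omega> * dev_sup \<omega>) = (\<Sum>E\<in>{S \<omega>}. indicator (?H E) \<omega> * dev_sup \<omega>)"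
      by (rule sum.mono_neutral_right) (use p(1) w in \<open>auto simp: indicator_def\<close>)
    then show "(\<Sum>E\<in>?I. indicator (?H E) \<omega> * dev_sup \<omega>) = dev_sup \<omega>" using w by simp
  qed
  finally show ?thesis by (simp add: beta_dep_eq)
qed

end

text \<open>The sets that can be approximated form a sigma-algebra. The distance is taken in the sum
  of the two measures, so that one and the same set of the algebra approximates under both.\<close>

lemma approx_by_algebra:
  fixes M N :: "'b measure"
  assumes fin: "finite_measure M" "finite_measure N" and sets_N: "sets N = sets M"
    and G: "G \<subseteq> sets M" and sG: "D \<in> sigma_sets (space M) G"
    and alg: "\<And>E. E \<in> G \<Longrightarrow> P E" "\<And>E. P E \<Longrightarrow> P (space M - E)"
      "\<And>E F. P E \<Longrightarrow> P F \<Longrightarrow> P (E \<union> F)" "P {}"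
    and Psets: "\<And>E. P E \<Longrightarrow> E \<in> sets M"
  shows "\<forall>e>0. \<exists>E. P E \<and> measure M ((D - E) \<union> (E - D)) + measure N ((D - E) \<union> (E - D)) < e"
proof -
  interpret M: finite_measure M by (rule fin)
  interpret N: finite_measure N by (rule fin)
  define m where "m X = measure M X + measure N X" for X
  have m_mono: "m X \<le> m Y" if "X \<subseteq> Y" "Y \<in> sets M" for X Y
    unfolding m_def using that sets_N by (intro add_mono M.finite_measure_mono N.finite_measure_mono) auto
  have m_Un: "m (X \<union> Y) \<le> m X + m Y" if "X \<in> sets M" "Y \<in> sets M" for X Y
    unfolding m_def using measure_Un_le[of X M Y] measure_Un_le[of X N Y] that sets_N by auto
  have "\<forall>e>0. \<exists>E. P E \<and> m ((D - E) \<union> (E - D)) < e"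
    using sG
  proof induction
    case (Basic a)
    then show ?case using alg(1) by (auto intro!: exI[of _ a] simp: m_def)
  next
    case Empty
    then show ?case using alg(4) by (auto intro!: exI[of _ "{}"] simp: m_def)
  next
    case (Compl a)
    have a: "a \<in> sets M" using Compl(1) G sets.sigma_sets_subset by blast
    show ?case
    proof (intro allI impI)
      fix e :: real assume "e > 0"
      then obtain E where E: "P E" "m ((a - E) \<union> (E - a)) < e" using Compl by blast
      have "(space M - a - (space M - E)) \<union> (space M - E - (space M - a)) = (a - E) \<union> (E - a)"
        using sets.sets_into_space[OF a] sets.sets_into_space[OF Psets[OF E(1)]] by auto
      then have "m ((space M - a - (space M - E)) \<union> (space M - E - (space M - a))) < e"
        using E(2) by simp
      then show "\<exists>E. P E \<and> m ((space M - a - E) \<union> (E - (space M - a))) < e"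
        using alg(2)[OF E(1)] by blast
    qed
  next
    case (Union a)
    have a: "a i \<in> sets M" for i using Union(1) G sets.sigma_sets_subset by blast
    show ?case
    proof (intro allI impI)
      fix e :: real assume e: "e > 0"
      let ?U = "\<lambda>n. \<Union>i<n. a i"
      have Um: "?U n \<in> sets M" for n using a by auto
      have "(\<lambda>n. m (?U n)) \<longlonglongrightarrow> m (\<Union>n. ?U n)"
        unfolding m_def
        by (intro tendsto_add M.finite_Lim_measure_incseq N.finite_Lim_measure_incseq)
           (use a sets_N in \<open>auto simp: incseq_def intro: less_le_trans\<close>)
      then have "eventually (\<lambda>n. m (\<Union>n. ?U n) - e / 2 < m (?U n)) sequentially"
        by (rule order_tendstoD(1)) (use e in simp)
      then have "eventually (\<lambda>n. m (\<Union>n. ?U n) - m (?U n) < e / 2) sequentially"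
        by eventually_elim linarith
      then obtain n where "m (\<Union>n. ?U n) - m (?U n) < e / 2"
        by (auto simp: eventually_sequentially)
      moreover have "(\<Union>n. ?U n) = (\<Union>i. a i)" by (auto)
      moreover have "m ((\<Union>i. a i) - ?U n) = m (\<Union>i. a i) - m (?U n)"
        unfolding m_def using a sets_N
        by (subst M.finite_measure_Diff, force, force, force,
            subst N.finite_measure_Diff, force, force, force) simp
      ultimately have n: "m ((\<Union>i. a i) - ?U n) < e / 2" by simp
      \<comment> \<open>Half of e is spent on cutting the countable union at n. Each of the n
        remaining sets gets the share e / 2 / (n + 1), which together stay within the other
        half.\<close>
      have "\<exists>E. P E \<and> m ((?U k - E) \<union> (E - ?U k)) \<le> (\<Sum>i<k. e / 2 / real (Suc n))" for k
      proof (induction k)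
        case 0
        then show ?case using alg(4) by (auto intro!: exI[of _ "{}"] simp: m_def)
      next
        case (Suc k)
        then obtain E where E: "P E" "m ((?U k - E) \<union> (E - ?U k)) \<le> (\<Sum>i<k. e / 2 / real (Suc n))"
          by blast
        have "e / 2 / real (Suc n) > 0" using e by simp
        then obtain F where F: "P F" "m ((a k - F) \<union> (F - a k)) < e / 2 / real (Suc n)"
          using Union(2)[of k] by blast
        note [measurable] = Psets[OF E(1)] Psets[OF F(1)] a
        have "m ((?U (Suc k) - (E \<union> F)) \<union> ((E \<union> F) - ?U (Suc k)))
          \<le> m (((?U k - E) \<union> (E - ?U k)) \<union> ((a k - F) \<union> (F - a k)))"
          by (rule m_mono) (auto simp: lessThan_Suc)
        also have "\<dots> \<le> m ((?U k - E) \<union> (E - ?U k)) + m ((a k - F) \<union> (F - a k))"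
          by (rule m_Un) auto
        also have "\<dots> \<le> (\<Sum>i<Suc k. e / 2 / real (Suc n))"
          using E(2) F(2) by (simp only: sum.lessThan_Suc)
        finally show ?case using alg(3)[OF E(1) F(1)] by blast
      qed
      then obtain E where E: "P E" "m ((?U n - E) \<union> (E - ?U n)) \<le> (\<Sum>i<n. e / 2 / real (Suc n))"
        by blast
      have le: "(\<Sum>i<n. e / 2 / real (Suc n)) \<le> e / 2" using e by (simp add: field_simps)
      note [measurable] = Psets[OF E(1)] a
      have "m (((\<Union>i. a i) - E) \<union> (E - (\<Union>i. a i)))
        \<le> m (((?U n - E) \<union> (E - ?U n)) \<union> ((\<Union>i. a i) - ?U n))"
        by (rule m_mono) auto
      also have "\<dots> \<le> m ((?U n - E) \<union> (E - ?U n)) + m ((\<Union>i. a i) - ?U n)"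
        by (rule m_Un) auto
      also have "\<dots> < e" using n E(2) le by linarith
      finally show "\<exists>E. P E \<and> m (((\<Union>i. a i) - E) \<union> (E - (\<Union>i. a i))) < e" using E(1) by blast
    qed
  qed
  then show ?thesis by (simp add: m_def)
qed

section \<open>From rectangles to measurable sets and bounded functions\<close>

context two_subalgebras
begin

lemma decouple_sets:
  assumes D: "D \<in> sets (A \<Otimes>\<^sub>M B)"
  shows "\<bar>measure diagm D - measure (M \<Otimes>\<^sub>M M) D\<bar> \<le> beta_dep M A B"
proof (rule field_le_epsilon)
  fix e :: real assume e: "0 < e"
  interpret dg: prob_space diagm by (rule diagm_prob)
  have sd: "sets diagm = sets (M \<Otimes>\<^sub>M M)" by (simp add: diagm_def)
  let ?G = "{E \<times> H |E H. E \<in> sets A \<and> H \<in> sets B}"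
  have "\<forall>e>0. \<exists>E. (\<exists>S. step_sect S \<and> E = sect S) \<and>
      measure (M \<Otimes>\<^sub>M M) ((D - E) \<union> (E - D)) + measure diagm ((D - E) \<union> (E - D)) < e"
  proof (rule approx_by_algebra[where G="?G"])
    show "?G \<subseteq> sets (M \<Otimes>\<^sub>M M)" using setsA setsB by auto
    show "D \<in> sigma_sets (space (M \<Otimes>\<^sub>M M)) ?G"
      using D by (simp add: sets_pair_measure space_A space_B space_pair_measure)
    show "\<exists>S. step_sect S \<and> E = sect S" if "E \<in> ?G" for E
      using that step_sect_rect by blast
    show "\<exists>S. step_sect S \<and> {} = sect S" 
      using step_sect_rect[of "{}" "{}"] by (metis Sigma_empty1 sets.empty_sets)
    show "\<exists>S. step_sect S \<and> space (M \<Otimes>\<^sub>M M) - E = sect S" if "\<exists>S. step_sect S \<and> E = sect S" for E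
      using that step_sect_compl by (metis space_pair_measure)
    show "\<exists>S. step_sect S \<and> E \<union> F = sect S"
      if "\<exists>S. step_sect S \<and> E = sect S" "\<exists>S. step_sect S \<and> F = sect S" for E F
      using that step_sect_Un by metis
    show "E \<in> sets (M \<Otimes>\<^sub>M M)" if "\<exists>S. step_sect S \<and> E = sect S" for E
      using that sect_sets pair_sets_M by blast
  qed (auto simp: sd dg.finite_measure_axioms pair.P.finite_measure_axioms)
  then obtain S where S: "step_sect S" and
    close: "measure (M \<Otimes>\<^sub>M M) ((D - sect S) \<union> (sect S - D)) + measure diagm ((D - sect S) \<union> (sect S - D)) < e"
    using e by blast
  have DS: "D \<in> sets (M \<Otimes>\<^sub>M M)" "sect S \<in> sets (M \<Otimes>\<^sub>M M)"
    using D sect_sets[OF S] pair_sets_M by auto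
  have tri: "\<bar>measure N D - measure N (sect S)\<bar> \<le> measure N ((D - sect S) \<union> (sect S - D))"
    if "prob_space N" "sets N = sets (M \<Otimes>\<^sub>M M)" for N
  proof -
    interpret N: prob_space N by (rule that)
    have "measure N D \<le> measure N (sect S \<union> ((D - sect S) \<union> (sect S - D)))"
      by (rule N.finite_measure_mono) (use DS that in auto)
    also have "\<dots> \<le> measure N (sect S) + measure N ((D - sect S) \<union> (sect S - D))"
      by (rule measure_Un_le) (use DS that in auto)
    finally have 1: "measure N D \<le> \<dots>" .
    have "measure N (sect S) \<le> measure N (D \<union> ((D - sect S) \<union> (sect S - D)))"
      by (rule N.finite_measure_mono) (use DS that in auto)
    also have "\<dots> \<le> measure N D + measure N ((D - sect S) \<union> (sect S - D))"
      by (rule measure_Un_le) (use DS that in auto)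
    finally show ?thesis using 1 by linarith
  qed
  show "\<bar>measure diagm D - measure (M \<Otimes>\<^sub>M M) D\<bar> \<le> beta_dep M A B + e"
    using tri[OF diagm_prob sd] tri[OF pair.P.prob_space_axioms refl] step_sect_dev[OF S] close
    by linarith
qed

text \<open>Layer-cake argument: f is within c/N of a sum of N indicators of its level sets, each
  with weight c/N. Every level set costs \<beta>, so the sum costs c \<beta>, and the two
  discretisation errors vanish as N grows.\<close>

lemma decouple_nonneg:
  assumes f: "f \<in> borel_measurable (A \<Otimes>\<^sub>M B)" and c: "\<And>z. 0 \<le> f z" "\<And>z. f z \<le> c" "0 < c"
  shows "\<bar>integral\<^sup>L diagm f - integral\<^sup>L (M \<Otimes>\<^sub>M M) f\<bar> \<le> c * beta_dep M A B"
proof (rule field_le_epsilon)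
  fix e :: real assume e: "0 < e"
  interpret dg: prob_space diagm by (rule diagm_prob)
  have sd: "sets diagm = sets (M \<Otimes>\<^sub>M M)" by (simp add: diagm_def)
  have sp: "space (A \<Otimes>\<^sub>M B) = space (M \<Otimes>\<^sub>M M)" by (simp add: space_pair_measure space_A space_B)
  obtain N :: nat where N: "2 * c / e < real N" using reals_Archimedean2 by blast
  have N0: "0 < N" using N c e by (cases N) (auto simp: field_simps)
  let ?D = "\<lambda>i. {z \<in> space (M \<Otimes>\<^sub>M M). real i * c / real N \<le> f z}"
  have DA: "?D i \<in> sets (A \<Otimes>\<^sub>M B)" for i unfolding sp[symmetric] using f by measurable
  have D: "?D i \<in> sets (M \<Otimes>\<^sub>M M)" for i using DA pair_sets_M by auto
  define g where "g z = (\<Sum>i=1..N. c / real N * indicator (?D i) z)" for z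
  have g: "g z \<le> f z" "f z \<le> g z + c / real N" if z: "z \<in> space (M \<Otimes>\<^sub>M M)" for z
  proof -
    define k where "k = nat \<lfloor>f z * real N / c\<rfloor>"
    have "f z * real N / c \<ge> 0" using c N0 by simp
    then have k: "real k \<le> f z * real N / c" "f z * real N / c < real k + 1"
      by (auto simp: k_def)
    have "f z * real N / c \<le> real N" using c N0 by (simp add: field_simps)
    then have kN: "k \<le> N" using k by linarith
    have "z \<in> ?D i \<longleftrightarrow> i \<le> k" for i
    proof -
      have "real i * c / real N \<le> f z \<longleftrightarrow> real i \<le> f z * real N / c"
        using c N0 by (simp add: field_simps)
      also have "\<dots> \<longleftrightarrow> i \<le> k" using k by linarith
      finally show ?thesis using z by simp
    qed
    then have "g z = (\<Sum>i=1..N. if i \<le> k then c / real N else 0)"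
      unfolding g_def by (intro sum.cong) (auto simp: indicator_def)
    also have "\<dots> = (\<Sum>i=1..k. c / real N)"
      using kN by (intro sum.mono_neutral_cong_right) auto
    finally have "g z = real k * (c / real N)" by simp
    then have gz: "g z = real k * c / real N" by simp
    show "g z \<le> f z"
      unfolding gz using k(1) c(3) N0 by (simp add: pos_divide_le_eq pos_le_divide_eq)
    show "f z \<le> g z + c / real N"
      using gz k(2) c(3) N0 by (simp add: field_simps)
  qed
  have fm: "f \<in> borel_measurable (M \<Otimes>\<^sub>M M)"
    using f pair_sets_M sp unfolding measurable_def by auto
  have gm: "g \<in> borel_measurable (M \<Otimes>\<^sub>M M)" unfolding g_def using D by measurable
  have near: "integrable N' g \<and> \<bar>integral\<^sup>L N' f - integral\<^sup>L N' g\<bar> \<le> c / real N \<and>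
      integral\<^sup>L N' g = (\<Sum>i=1..N. c / real N * measure N' (?D i))"
    if N': "prob_space N'" "sets N' = sets (M \<Otimes>\<^sub>M M)" for N'
  proof -
    interpret N': prob_space N' by (rule N')
    have sp': "space N' = space (M \<Otimes>\<^sub>M M)" using N'(2) by (rule sets_eq_imp_space_eq)
    have fm': "f \<in> borel_measurable N'" "g \<in> borel_measurable N'"
      using fm gm measurable_cong_sets[OF N'(2) refl] by auto
    have fi: "integrable N' f" by (rule N'.integrable_const_bound[where B=c]) (use c fm' in auto)
    have ii: "integrable N' (indicator (?D i) :: _ \<Rightarrow> real)" for i
      using D[of i] N'(2) by (intro N'.integrable_const_bound[where B=1]) (auto simp: indicator_def)
    have gi: "integrable N' g" unfolding g_def by (intro Bochner_Integration.integrable_sum integrable_mult_right ii)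
    have "integral\<^sup>L N' g = (\<Sum>i=1..N. integral\<^sup>L N' (\<lambda>z. c / real N * indicator (?D i) z))"
      unfolding g_def by (intro Bochner_Integration.integral_sum integrable_mult_right ii)
    also have "\<dots> = (\<Sum>i=1..N. c / real N * measure N' (?D i))"
      using D N'(2) sp' by (intro sum.cong refl) (auto simp: Int_absorb2)
    finally have gs: "integral\<^sup>L N' g = (\<Sum>i=1..N. c / real N * measure N' (?D i))" .
    have "integral\<^sup>L N' g \<le> integral\<^sup>L N' f"
      by (rule integral_mono[OF gi fi]) (use g sp' in auto)
    moreover have "integral\<^sup>L N' f \<le> integral\<^sup>L N' (\<lambda>z. g z + c / real N)"
      by (rule integral_mono[OF fi]) (use g sp' gi in auto)
    moreover have "integral\<^sup>L N' (\<lambda>z. g z + c / real N) = integral\<^sup>L N' g + c / real N"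
      using gi by (subst Bochner_Integration.integral_add) (auto simp: N'.prob_space)
    ultimately show ?thesis using gs gi by linarith
  qed
  note n1 = near[OF diagm_prob sd] and n2 = near[OF pair.P.prob_space_axioms refl]
  have "\<bar>integral\<^sup>L diagm g - integral\<^sup>L (M \<Otimes>\<^sub>M M) g\<bar>
    = \<bar>\<Sum>i=1..N. c / real N * (measure diagm (?D i) - measure (M \<Otimes>\<^sub>M M) (?D i))\<bar>"
    using n1 n2 by (simp only: sum_subtractf right_diff_distrib)
  also have "\<dots> \<le> (\<Sum>i=1..N. \<bar>c / real N * (measure diagm (?D i) - measure (M \<Otimes>\<^sub>M M) (?D i))\<bar>)"
    by (rule sum_abs)
  also have "\<dots> \<le> (\<Sum>i=1..N. c / real N * beta_dep M A B)"
    unfolding abs_mult using decouple_sets[OF DA] c N0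
    by (intro sum_mono mult_mono) auto
  also have "\<dots> = c * beta_dep M A B" using N0 by simp
  finally have "\<bar>integral\<^sup>L diagm f - integral\<^sup>L (M \<Otimes>\<^sub>M M) f\<bar> \<le> c * beta_dep M A B + 2 * (c / real N)"
    using n1 n2 by linarith
  moreover have "2 * (c / real N) \<le> e" using N N0 e by (simp add: field_simps)
  ultimately show "\<bar>integral\<^sup>L diagm f - integral\<^sup>L (M \<Otimes>\<^sub>M M) f\<bar> \<le> c * beta_dep M A B + e" by linarith
qed

text \<open>Adding c moves the range into [0, 2 c], which is the origin of the factor 2 c.\<close>

theorem decouple_bounded:
  assumes f: "f \<in> borel_measurable (A \<Otimes>\<^sub>M B)" and c: "\<And>z. \<bar>f z\<bar> \<le> c" "0 < c"
  shows "\<bar>(\<integral>\<omega>. f (\<omega>, \<omega>) \<partial>M) - integral\<^sup>L (M \<Otimes>\<^sub>M M) f\<bar> \<le> 2 * c * beta_dep M A B"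
proof -
  interpret dg: prob_space diagm by (rule diagm_prob)
  have sp: "space (A \<Otimes>\<^sub>M B) = space (M \<Otimes>\<^sub>M M)" by (simp add: space_pair_measure space_A space_B)
  have fm: "f \<in> borel_measurable (M \<Otimes>\<^sub>M M)"
    using f pair_sets_M sp unfolding measurable_def by auto
  have fm': "f \<in> borel_measurable diagm" using fm by (simp add: diagm_def)
  have i: "integrable (M \<Otimes>\<^sub>M M) f" "integrable diagm f"
    by (rule pair.P.integrable_const_bound[where B=c] dg.integrable_const_bound[where B=c], use c fm fm' in auto)+
  have "\<bar>integral\<^sup>L diagm (\<lambda>z. f z + c) - integral\<^sup>L (M \<Otimes>\<^sub>M M) (\<lambda>z. f z + c)\<bar> \<le> (2 * c) * beta_dep M A B"
  proof (rule decouple_nonneg)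
    show "0 \<le> f z + c" "f z + c \<le> 2 * c" for z using c(1)[of z] by linarith+
  qed (use f c in auto)
  moreover have "integral\<^sup>L diagm (\<lambda>z. f z + c) = integral\<^sup>L diagm f + c"
    "integral\<^sup>L (M \<Otimes>\<^sub>M M) (\<lambda>z. f z + c) = integral\<^sup>L (M \<Otimes>\<^sub>M M) f + c"
    using i by (simp_all add: dg.prob_space pair.P.prob_space)
  moreover have "integral\<^sup>L diagm f = (\<integral>\<omega>. f (\<omega>, \<omega>) \<partial>M)"
    unfolding diagm_def by (rule integral_distr) (use fm in auto)
  ultimately show ?thesis by simp
qed

end

section \<open>Decoupling an isolated time\<close>

text \<open>Where |f| > c one has 1 <= (|f|/c)^(q-1), hence |f| <= |f|^q c^(1-q), and the q-th
  moment bounds what is cut off.\<close>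

lemma (in prob_space) truncation_error:
  fixes f :: "'a \<Rightarrow> real"
  assumes [measurable]: "f \<in> borel_measurable M" and i: "integrable M (\<lambda>\<omega>. \<bar>f \<omega>\<bar> powr q)"
    and K: "expectation (\<lambda>\<omega>. \<bar>f \<omega>\<bar> powr q) \<le> K" and q: "1 < q" and c: "0 < c"
  shows "integrable M f"
    and "\<bar>expectation f - expectation (\<lambda>\<omega>. if \<bar>f \<omega>\<bar> \<le> c then f \<omega> else 0)\<bar> \<le> K * c powr (1 - q)"
proof -
  have le: "\<bar>f \<omega>\<bar> \<le> 1 + \<bar>f \<omega>\<bar> powr q" for \<omega>
  proof (cases "\<bar>f \<omega>\<bar> \<le> 1")
    case False
    then have "\<bar>f \<omega>\<bar> powr 1 \<le> \<bar>f \<omega>\<bar> powr q" using q by (intro powr_mono) auto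
    then show ?thesis using False by simp
  qed (use powr_ge_zero[of "\<bar>f \<omega>\<bar>" q] in linarith)
  show fi: "integrable M f"
    by (rule Bochner_Integration.integrable_bound[of M "\<lambda>\<omega>. 1 + \<bar>f \<omega>\<bar> powr q"])
       (use i le in \<open>auto intro!: AE_I2 order_trans[OF le]\<close>)
  let ?g = "\<lambda>\<omega>. if \<bar>f \<omega>\<bar> \<le> c then f \<omega> else 0"
  have gi: "integrable M ?g"
    by (rule Bochner_Integration.integrable_bound[OF fi]) auto
  have pt: "\<bar>f \<omega> - ?g \<omega>\<bar> \<le> \<bar>f \<omega>\<bar> powr q * c powr (1 - q)" for \<omega>
  proof (cases "\<bar>f \<omega>\<bar> \<le> c")
    case False
    then have "1 \<le> (\<bar>f \<omega>\<bar> / c) powr (q - 1)" using c q by (intro ge_one_powr_ge_zero) auto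
    then have "\<bar>f \<omega>\<bar> * 1 \<le> \<bar>f \<omega>\<bar> * (\<bar>f \<omega>\<bar> powr (q - 1) * c powr (1 - q))"
      using c by (intro mult_left_mono) (auto simp: powr_divide powr_diff field_simps powr_minus)
    also have "\<dots> = \<bar>f \<omega>\<bar> powr q * c powr (1 - q)"
      using False c by (simp add: powr_diff)
    finally show ?thesis using False by simp
  qed simp
  have "\<bar>expectation f - expectation ?g\<bar> = \<bar>expectation (\<lambda>\<omega>. f \<omega> - ?g \<omega>)\<bar>"
    using fi gi by simp
  also have "\<dots> \<le> expectation (\<lambda>\<omega>. \<bar>f \<omega> - ?g \<omega>\<bar>)" by (rule integral_abs_bound)
  also have "\<dots> \<le> expectation (\<lambda>\<omega>. \<bar>f \<omega>\<bar> powr q * c powr (1 - q))"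
    by (rule integral_mono) (use fi gi i pt in auto)
  also have "\<dots> \<le> K * c powr (1 - q)" using K by (simp add: mult_right_mono)
  finally show "\<bar>expectation f - expectation ?g\<bar> \<le> K * c powr (1 - q)" .
qed

text \<open>The exponent 3 + 18/\<delta> in \<open>rate\<close> is split in
  \<open>rate_choice\<close>: 18/\<delta> pays for the truncation level and 3 is what remains as
  decay.\<close>

locale mixing_process = prob_space M for M :: "'a measure" +
  fixes X :: "nat \<Rightarrow> 'a \<Rightarrow> real" and \<delta> B :: real
  assumes X_meas: "\<And>i. i \<ge> 1 \<Longrightarrow> X i \<in> borel_measurable M"
    and stationary: "strictly_stationary M X"
    and \<delta>: "0 < \<delta>" and B: "0 < B"
    and rate: "\<And>m. m \<ge> 1 \<Longrightarrow> beta_mix M X m \<le> B * real m powr (- (3 + 18 / \<delta>))"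
begin

sublocale MM: pair_prob_space M M ..

abbreviation \<S> :: "nat set \<Rightarrow> 'a measure" where "\<S> I \<equiv> sigma_gen M X I"

lemma subalgebra_sigma_gen: "I \<subseteq> {1..} \<Longrightarrow> subalgebra M (\<S> I)"
  unfolding subalgebra_def sigma_gen_def
  by (intro conjI sets_image_in_sets measurable_restrict X_meas) auto

lemma measurable_sigma_gen: "i \<in> I \<Longrightarrow> X i \<in> borel_measurable (\<S> I)"
proof -
  assume i: "i \<in> I"
  have "(\<lambda>\<omega>. \<lambda>i\<in>I. X i \<omega>) \<in> measurable (\<S> I) (\<Pi>\<^sub>M i\<in>I. borel)"
    unfolding sigma_gen_def by (rule measurable_vimage_algebra1) (auto simp: space_PiM)
  from measurable_compose[OF this measurable_component_singleton[OF i]] show ?thesis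
    using i by simp
qed

lemma two_subalgebras_sigma_gen:
  "I \<subseteq> {1..} \<Longrightarrow> J \<subseteq> {1..} \<Longrightarrow> two_subalgebras M (\<S> I) (\<S> J)"
  by (simp add: two_subalgebras_def two_subalgebras_axioms_def subalgebra_sigma_gen prob_space_axioms)

lemma beta_dep_le: "k \<ge> 1 \<Longrightarrow> beta_dep M (\<S> {1..k}) (\<S> {k + m..}) \<le> beta_mix M X m"
  unfolding beta_mix_def
proof (rule cSUP_upper)
  show "bdd_above ((\<lambda>k. beta_dep M (\<S> {1..k}) (\<S> {k + m..})) ` {1..})"
    using two_subalgebras.beta_dep_unit(2)[OF two_subalgebras_sigma_gen] by (intro bdd_aboveI[of _ 1]) auto
qed simp

lemma beta_mix_nonneg: "0 \<le> beta_mix M X m"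
  using order_trans[OF two_subalgebras.beta_dep_unit(1)[OF two_subalgebras_sigma_gen] beta_dep_le[of 1 m]] by auto

lemma decouple_past_future:
  assumes f: "f \<in> borel_measurable (\<S> {1..k} \<Otimes>\<^sub>M \<S> {k + m..})"
    and k: "k \<ge> 1" and c: "\<And>z. \<bar>f z\<bar> \<le> c" "0 < c"
  shows "\<bar>(\<integral>\<omega>. f (\<omega>, \<omega>) \<partial>M) - integral\<^sup>L (M \<Otimes>\<^sub>M M) f\<bar> \<le> 2 * c * beta_mix M X m"
proof -
  have "\<bar>(\<integral>\<omega>. f (\<omega>, \<omega>) \<partial>M) - integral\<^sup>L (M \<Otimes>\<^sub>M M) f\<bar> \<le> 2 * c * beta_dep M (\<S> {1..k}) (\<S> {k + m..})"
    by (rule two_subalgebras.decouple_bounded[OF two_subalgebras_sigma_gen f c]) (use k in auto)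
  also have "\<dots> \<le> 2 * c * beta_mix M X m"
    using beta_dep_le[OF k] c by (intro mult_left_mono) auto
  finally show ?thesis .
qed

definition far :: "nat \<Rightarrow> nat \<Rightarrow> nat set" where
  "far t m = {i. 1 \<le> i \<and> (i + m \<le> t \<or> t + m \<le> i)}"

text \<open>Mixing separates a past from a future, whereas the isolated time t lies between the two
  and the rest has to keep its own joint law. Three separations achieve this: the past is split from
  t and the future, t is split from the future, and past and future are joined again by a split read
  backwards. Each costs 2 c \<beta>(m), hence the 6.\<close>

lemma decouple_isolated:
  assumes \<Phi>: "\<Phi> \<in> borel_measurable (borel \<Otimes>\<^sub>M (\<Pi>\<^sub>M i\<in>far t m. borel))"
    and t: "t \<ge> 1" and m: "m \<ge> 1" and c: "\<And>z. \<bar>\<Phi> z\<bar> \<le> c" "0 < c"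
  shows "\<bar>(\<integral>\<omega>. \<Phi> (X t \<omega>, \<lambda>i\<in>far t m. X i \<omega>) \<partial>M)
    - (\<integral>(\<omega>', \<omega>). \<Phi> (X t \<omega>', \<lambda>i\<in>far t m. X i \<omega>) \<partial>(M \<Otimes>\<^sub>M M))\<bar> \<le> 6 * c * beta_mix M X m"
proof -
  let ?T = "far t m"
  \<comment> \<open>The times before t are read from \<omega>1 and those after t from \<omega>3, so
    \<open>Z \<omega> \<omega>\<close> is the original vector.\<close>
  define Z where "Z \<omega>1 \<omega>3 = (\<lambda>i\<in>?T. if i < t then X i \<omega>1 else X i \<omega>3)" for \<omega>1 \<omega>3
  have Zd: "Z \<omega> \<omega> = (\<lambda>i\<in>?T. X i \<omega>)" for \<omega> by (auto simp: Z_def)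
  have bnd: "0 \<le> c * beta_mix M X m" using c(2) beta_mix_nonneg by simp
  have XtM: "X t \<in> borel_measurable M" by (rule X_meas[OF t])
  have Zm: "(\<lambda>z. Z (f z) (g z)) \<in> measurable N (\<Pi>\<^sub>M i\<in>?T. borel)"
    if "\<And>i. i \<in> ?T \<Longrightarrow> i < t \<Longrightarrow> (\<lambda>z. X i (f z)) \<in> borel_measurable N"
      "\<And>i. i \<in> ?T \<Longrightarrow> \<not> i < t \<Longrightarrow> (\<lambda>z. X i (g z)) \<in> borel_measurable N" for f g and N :: "'c measure"
    unfolding Z_def
  proof (rule measurable_restrict)
    fix i assume "i \<in> ?T"
    then show "(\<lambda>z. if i < t then X i (f z) else X i (g z)) \<in> borel_measurable N"
      using that by (cases "i < t") auto
  qed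
  have \<Phi>m: "(\<lambda>z. \<Phi> (X t (e z), Z (f z) (g z))) \<in> borel_measurable N"
    if "\<And>i. i \<in> ?T \<Longrightarrow> i < t \<Longrightarrow> (\<lambda>z. X i (f z)) \<in> borel_measurable N"
      "\<And>i. i \<in> ?T \<Longrightarrow> \<not> i < t \<Longrightarrow> (\<lambda>z. X i (g z)) \<in> borel_measurable N"
      "(\<lambda>z. X t (e z)) \<in> borel_measurable N" for e f g and N :: "'c measure"
    by (rule measurable_compose[OF measurable_Pair[OF that(3) Zm[OF that(1,2)]] \<Phi>])
  have T1: "1 \<le> i" if "i \<in> ?T" for i using that by (auto simp: far_def)
  note XM = X_meas[OF T1]
  note fst_m = measurable_compose[OF measurable_fst measurable_sigma_gen]
  note snd_m = measurable_compose[OF measurable_snd measurable_sigma_gen]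
  \<comment> \<open>With the past frozen at \<omega>1, the time t is split from the future, which
    begins at t + m.\<close>
  have step2: "\<bar>(\<integral>\<omega>. \<Phi> (X t \<omega>, Z \<omega>1 \<omega>) \<partial>M) - (\<integral>(\<omega>2, \<omega>3). \<Phi> (X t \<omega>2, Z \<omega>1 \<omega>3) \<partial>(M \<Otimes>\<^sub>M M))\<bar>
      \<le> 2 * c * beta_mix M X m" for \<omega>1
  proof -
    have "(\<lambda>z. \<Phi> (X t (fst z), Z \<omega>1 (snd z))) \<in> borel_measurable (\<S> {1..t} \<Otimes>\<^sub>M \<S> {t + m..})"
      by (rule \<Phi>m) (use t in \<open>auto intro!: fst_m snd_m simp: far_def\<close>)
    from decouple_past_future[OF this t _ c(2)] c(1) show ?thesis by (simp add: case_prod_beta')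
  qed
  show ?thesis
  \<comment> \<open>If t <= m, no index precedes t by m, so the second separation alone
    suffices.\<close>
  proof (cases "t \<le> m")
    case True
    then have "Z \<omega>1 \<omega>3 = (\<lambda>i\<in>?T. X i \<omega>3)" for \<omega>1 \<omega>3
      using m by (auto simp: Z_def far_def fun_eq_iff)
    with step2[of undefined] bnd show ?thesis by simp
  next
    case False
    \<comment> \<open>The past lies in {1..k}, while t = k + m and the future lie in {k +
      m..}.\<close>
    define k where "k = t - m"
    have k: "k \<ge> 1" "k + m = t" using False by (auto simp: k_def)
    have i_lt: "i \<in> {1..k}" if "i \<in> ?T" "i < t" for i using that k m by (auto simp: far_def)
    have i_ge: "i \<in> {k + m..}" if "i \<in> ?T" "\<not> i < t" for i using that k m by (auto simp: far_def)
    have "(\<lambda>z. \<Phi> (X t (snd z), Z (fst z) (snd z))) \<in> borel_measurable (\<S> {1..k} \<Otimes>\<^sub>M \<S> {k + m..})"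
      by (rule \<Phi>m) (use i_lt i_ge k in \<open>auto intro!: fst_m snd_m\<close>)
    from decouple_past_future[OF this k(1) _ c(2)] c(1)
    have step1: "\<bar>(\<integral>\<omega>. \<Phi> (X t \<omega>, Z \<omega> \<omega>) \<partial>M) - (\<integral>(\<omega>1, \<omega>2). \<Phi> (X t \<omega>2, Z \<omega>1 \<omega>2) \<partial>(M \<Otimes>\<^sub>M M))\<bar>
      \<le> 2 * c * beta_mix M X m" by (simp add: case_prod_beta')
    \<comment> \<open>With the value at t frozen, this compares the joint law of past and future
      with the product law. It is used backwards, to restore their dependence.\<close>
    have step3: "\<bar>(\<integral>\<omega>. \<Phi> (X t \<omega>2, Z \<omega> \<omega>) \<partial>M) - (\<integral>(\<omega>1, \<omega>3). \<Phi> (X t \<omega>2, Z \<omega>1 \<omega>3) \<partial>(M \<Otimes>\<^sub>M M))\<bar>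
      \<le> 2 * c * beta_mix M X m" for \<omega>2
    proof -
      have "(\<lambda>z. \<Phi> (X t \<omega>2, Z (fst z) (snd z))) \<in> borel_measurable (\<S> {1..k} \<Otimes>\<^sub>M \<S> {k + m..})"
        by (rule \<Phi>m) (use i_lt i_ge k in \<open>auto intro!: fst_m snd_m\<close>)
      from decouple_past_future[OF this k(1) _ c(2)] c(1) show ?thesis by (simp add: case_prod_beta')
    qed
    have Hm: "(\<lambda>(\<omega>, \<omega>3). \<Phi> (X t (snd \<omega>), Z (fst \<omega>) \<omega>3)) \<in> borel_measurable ((M \<Otimes>\<^sub>M M) \<Otimes>\<^sub>M M)"
      unfolding case_prod_beta'
      by (rule \<Phi>m) (use XM XtM in \<open>auto intro: measurable_compose[rotated]\<close>)
    \<comment> \<open>The fully decoupled integrand, with the future already integrated out; both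
      \<open>s2\<close> and \<open>s3\<close> compare with its integral.\<close>
    define G where "G = (\<lambda>(\<omega>1, \<omega>2). \<integral>\<omega>3. \<Phi> (X t \<omega>2, Z \<omega>1 \<omega>3) \<partial>M)"
    have Gm: "G \<in> borel_measurable (M \<Otimes>\<^sub>M M)"
      unfolding G_def using borel_measurable_lebesgue_integral[OF Hm] by (simp add: case_prod_beta')
    have Gb: "\<bar>G z\<bar> \<le> c" for z
    proof -
      have "\<bar>\<integral>\<omega>3. \<Phi> (X t (snd z), Z (fst z) \<omega>3) \<partial>M\<bar> \<le> (\<integral>\<omega>3. \<bar>\<Phi> (X t (snd z), Z (fst z) \<omega>3)\<bar> \<partial>M)"
        by (rule integral_abs_bound)
      also have "\<dots> \<le> (\<integral>\<omega>3. c \<partial>M)"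
        by (rule integral_mono') (use c in auto)
      finally show ?thesis by (simp add: G_def case_prod_beta' prob_space)
    qed
    have bi: "integrable (M \<Otimes>\<^sub>M M) f" if "f \<in> borel_measurable (M \<Otimes>\<^sub>M M)" "\<And>z. \<bar>f z\<bar> \<le> c" for f
      by (rule MM.P.integrable_const_bound[where B=c]) (use that in auto)
    have b1: "integrable M f" if "f \<in> borel_measurable M" "\<And>z. \<bar>f z\<bar> \<le> c" for f
      by (rule integrable_const_bound[where B=c]) (use that in auto)
    note Gi = bi[OF Gm Gb]
    have m12: "(\<lambda>(\<omega>1, \<omega>2). \<Phi> (X t \<omega>2, Z \<omega>1 \<omega>2)) \<in> borel_measurable (M \<Otimes>\<^sub>M M)"
      unfolding case_prod_beta' by (rule \<Phi>m) (use XM XtM in \<open>auto intro: measurable_compose[rotated]\<close>)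
    have m23: "(\<lambda>(\<omega>2, \<omega>3). \<Phi> (X t \<omega>2, Z \<omega>1 \<omega>3)) \<in> borel_measurable (M \<Otimes>\<^sub>M M)" if "\<omega>1 \<in> space M" for \<omega>1
      unfolding case_prod_beta'
      by (rule \<Phi>m) (use XM XtM in \<open>auto intro: measurable_compose[rotated]\<close>)
    have m13: "(\<lambda>(\<omega>1, \<omega>3). \<Phi> (X t \<omega>2, Z \<omega>1 \<omega>3)) \<in> borel_measurable (M \<Otimes>\<^sub>M M)" if "\<omega>2 \<in> space M" for \<omega>2
      unfolding case_prod_beta'
      by (rule \<Phi>m) (use XM XtM in \<open>auto intro: measurable_compose[rotated]\<close>)
    have m0: "(\<lambda>(\<omega>', \<omega>). \<Phi> (X t \<omega>', Z \<omega> \<omega>)) \<in> borel_measurable (M \<Otimes>\<^sub>M M)"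
      unfolding case_prod_beta' by (rule \<Phi>m) (use XM XtM in \<open>auto intro: measurable_compose[rotated]\<close>)
    have i12: "(\<integral>(\<omega>1, \<omega>2). \<Phi> (X t \<omega>2, Z \<omega>1 \<omega>2) \<partial>(M \<Otimes>\<^sub>M M)) = (\<integral>\<omega>1. (\<integral>\<omega>2. \<Phi> (X t \<omega>2, Z \<omega>1 \<omega>2) \<partial>M) \<partial>M)"
      by (rule MM.integral_fst[symmetric]) (rule bi[OF m12], use c in auto)
    have i23: "(\<integral>(\<omega>2, \<omega>3). \<Phi> (X t \<omega>2, Z \<omega>1 \<omega>3) \<partial>(M \<Otimes>\<^sub>M M)) = (\<integral>\<omega>2. G (\<omega>1, \<omega>2) \<partial>M)" if "\<omega>1 \<in> space M" for \<omega>1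
      unfolding G_def prod.case by (rule MM.integral_fst[symmetric]) (rule bi[OF m23[OF that]], use c in auto)
    have i13: "(\<integral>(\<omega>1, \<omega>3). \<Phi> (X t \<omega>2, Z \<omega>1 \<omega>3) \<partial>(M \<Otimes>\<^sub>M M)) = (\<integral>\<omega>1. G (\<omega>1, \<omega>2) \<partial>M)" if "\<omega>2 \<in> space M" for \<omega>2
      unfolding G_def prod.case by (rule MM.integral_fst[symmetric]) (rule bi[OF m13[OF that]], use c in auto)
    have i0: "(\<integral>(\<omega>', \<omega>). \<Phi> (X t \<omega>', Z \<omega> \<omega>) \<partial>(M \<Otimes>\<^sub>M M)) = (\<integral>\<omega>2. (\<integral>\<omega>. \<Phi> (X t \<omega>2, Z \<omega> \<omega>) \<partial>M) \<partial>M)"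
      by (rule MM.integral_fst[symmetric]) (rule bi[OF m0], use c in auto)
    have fub: "(\<integral>\<omega>2. (\<integral>\<omega>1. G (\<omega>1, \<omega>2) \<partial>M) \<partial>M) = (\<integral>\<omega>1. (\<integral>\<omega>2. G (\<omega>1, \<omega>2) \<partial>M) \<partial>M)"
      by (rule MM.Fubini_integral) (use Gi in \<open>simp add: case_prod_eta\<close>)
    have diff_le: "\<bar>(\<integral>\<omega>. u \<omega> \<partial>M) - (\<integral>\<omega>. v \<omega> \<partial>M)\<bar> \<le> b"
      if "integrable M u" "integrable M v" "\<And>\<omega>. \<omega> \<in> space M \<Longrightarrow> \<bar>u \<omega> - v \<omega>\<bar> \<le> b" for u v :: "'a \<Rightarrow> real" and b
    proof -
      have "\<bar>(\<integral>\<omega>. u \<omega> \<partial>M) - (\<integral>\<omega>. v \<omega> \<partial>M)\<bar> = \<bar>\<integral>\<omega>. u \<omega> - v \<omega> \<partial>M\<bar>" using that by simp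
      also have "\<dots> \<le> (\<integral>\<omega>. \<bar>u \<omega> - v \<omega>\<bar> \<partial>M)" by (rule integral_abs_bound)
      also have "\<dots> \<le> (\<integral>\<omega>. b \<partial>M)" by (rule integral_mono) (use that in auto)
      finally show ?thesis by (simp add: prob_space)
    qed
    have s2: "\<bar>(\<integral>(\<omega>1, \<omega>2). \<Phi> (X t \<omega>2, Z \<omega>1 \<omega>2) \<partial>(M \<Otimes>\<^sub>M M)) - (\<integral>\<omega>1. (\<integral>\<omega>2. G (\<omega>1, \<omega>2) \<partial>M) \<partial>M)\<bar>
      \<le> 2 * c * beta_mix M X m"
      unfolding i12
    proof (rule diff_le)
      show "integrable M (\<lambda>\<omega>1. \<integral>\<omega>2. \<Phi> (X t \<omega>2, Z \<omega>1 \<omega>2) \<partial>M)"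
        by (rule MM.integrable_fst) (rule bi[OF m12], use c in auto)
      show "integrable M (\<lambda>\<omega>1. \<integral>\<omega>2. G (\<omega>1, \<omega>2) \<partial>M)"
        by (rule MM.integrable_fst) (use Gi in \<open>simp add: case_prod_eta\<close>)
      show "\<bar>(\<integral>\<omega>2. \<Phi> (X t \<omega>2, Z \<omega>1 \<omega>2) \<partial>M) - (\<integral>\<omega>2. G (\<omega>1, \<omega>2) \<partial>M)\<bar> \<le> 2 * c * beta_mix M X m"
        if "\<omega>1 \<in> space M" for \<omega>1
        using step2[of \<omega>1] unfolding i23[OF that] .
    qed
    have s3: "\<bar>(\<integral>(\<omega>', \<omega>). \<Phi> (X t \<omega>', Z \<omega> \<omega>) \<partial>(M \<Otimes>\<^sub>M M)) - (\<integral>\<omega>2. (\<integral>\<omega>1. G (\<omega>1, \<omega>2) \<partial>M) \<partial>M)\<bar>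
      \<le> 2 * c * beta_mix M X m"
      unfolding i0
    proof (rule diff_le)
      show "integrable M (\<lambda>\<omega>2. \<integral>\<omega>. \<Phi> (X t \<omega>2, Z \<omega> \<omega>) \<partial>M)"
        by (rule MM.integrable_fst) (rule bi[OF m0], use c in auto)
      show "integrable M (\<lambda>\<omega>2. \<integral>\<omega>1. G (\<omega>1, \<omega>2) \<partial>M)"
        by (rule MM.integrable_snd) (use Gi in \<open>simp add: case_prod_eta\<close>)
      show "\<bar>(\<integral>\<omega>. \<Phi> (X t \<omega>2, Z \<omega> \<omega>) \<partial>M) - (\<integral>\<omega>1. G (\<omega>1, \<omega>2) \<partial>M)\<bar> \<le> 2 * c * beta_mix M X m"
        if "\<omega>2 \<in> space M" for \<omega>2
        using step3[of \<omega>2] unfolding i13[OF that] .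
    qed
    show ?thesis using step1 s2 s3 fub unfolding Zd by linarith
  qed
qed

end

section \<open>Products of four factors and the decay kernel\<close>

lemma prod4_powr_le:
  fixes a b c d :: real
  assumes "0 \<le> q"
  shows "\<bar>a * b * c * d\<bar> powr q \<le> \<bar>a\<bar> powr (4 * q) + \<bar>b\<bar> powr (4 * q) + \<bar>c\<bar> powr (4 * q) + \<bar>d\<bar> powr (4 * q)"
proof -
  define m where "m = Max {\<bar>a\<bar>, \<bar>b\<bar>, \<bar>c\<bar>, \<bar>d\<bar>}"
  have le: "\<bar>a\<bar> \<le> m" "\<bar>b\<bar> \<le> m" "\<bar>c\<bar> \<le> m" "\<bar>d\<bar> \<le> m" by (unfold m_def; rule Max_ge; simp)+
  have m0: "0 \<le> m" using le(1) by linarith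
  have "m \<in> {\<bar>a\<bar>, \<bar>b\<bar>, \<bar>c\<bar>, \<bar>d\<bar>}" unfolding m_def by (rule Max_in) auto
  then have mp: "m powr (4 * q) \<le> \<bar>a\<bar> powr (4 * q) + \<bar>b\<bar> powr (4 * q) + \<bar>c\<bar> powr (4 * q) + \<bar>d\<bar> powr (4 * q)"
    by (elim insertE) auto
  have "\<bar>a * b * c * d\<bar> \<le> m * m * m * m"
    unfolding abs_mult using le m0 by (intro mult_mono) auto
  also have "\<dots> = m ^ 4" by (simp add: power4_eq_xxxx)
  finally have "\<bar>a * b * c * d\<bar> powr q \<le> (m ^ 4) powr q"
    using assms by (intro powr_mono2) auto
  also have "\<dots> = m powr (4 * q)"
  proof (cases "m = 0")
    case False
    then have "m ^ 4 = m powr 4" using m0 by (simp add: powr_numeral)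
    then show ?thesis by (simp add: powr_powr)
  qed simp
  finally show ?thesis using mp by linarith
qed

text \<open>The square of this kernel is the mixing rate \<open>m\<^sup>-\<^sup>3\<close>, while the kernel itself is still summable.\<close>

definition kern :: "nat \<Rightarrow> nat \<Rightarrow> real" where
  "kern s t = (max 1 \<bar>real s - real t\<bar>) powr (- 3 / 2)"

lemma kern_pos: "0 < kern s t" and kern_sym: "kern s t = kern t s"
  by (auto simp: kern_def abs_minus_commute max_def)

lemma kern_refl [simp]: "kern s s = 1" by (simp add: kern_def)

lemma kern_square:
  assumes "d \<ge> 1" "\<bar>real s - real t\<bar> = real d"
  shows "(kern s t)\<^sup>2 = 1 / real d ^ 3"
proof -
  have "(kern s t)\<^sup>2 = (real d powr (- 3 / 2)) powr 2"
    using assms by (simp add: kern_def powr_numeral)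
  also have "\<dots> = real d powr (- 3)" by (simp add: powr_powr)
  also have "\<dots> = 1 / real d ^ 3"
    using assms by (simp add: powr_minus powr_numeral inverse_eq_divide)
  finally show ?thesis .
qed

text \<open>The element of A nearest to t is at some distance d. For d > 0 the hypothesis with m = d
  gives C / d^3, which is C times the squared kernel; for d = 0 the kernel is 1 and the trivial
  bound applies. The sum over all of A stands in for the nearest element, which varies with the
  indices.\<close>

lemma le_kern_sum:
  assumes A: "finite A" "A \<noteq> {}" and C: "\<bar>e\<bar> \<le> C"
    and far: "\<And>m. m \<ge> 1 \<Longrightarrow> (\<And>i. i \<in> A \<Longrightarrow> i + m \<le> t \<or> t + m \<le> i) \<Longrightarrow> \<bar>e\<bar> \<le> C / real m ^ 3"
  shows "\<bar>e\<bar> \<le> C * (\<Sum>s\<in>A. kern t s)\<^sup>2"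
proof -
  have C0: "0 \<le> C" using C by linarith
  define D where "D i = (if i \<le> t then t - i else i - t)" for i :: nat
  have "Min (D ` A) \<in> D ` A" using A by (intro Min_in) auto
  then obtain s where s: "s \<in> A" "D s = Min (D ` A)" by auto
  have Dmin: "D s \<le> D i" if "i \<in> A" for i using that A s by simp
  have "\<bar>e\<bar> \<le> C * (kern t s)\<^sup>2"
  proof (cases "D s = 0")
    case True
    then have "s = t" by (auto simp: D_def split: if_splits)
    then show ?thesis using C by simp
  next
    case False
    have "i + D s \<le> t \<or> t + D s \<le> i" if "i \<in> A" for i
      using Dmin[OF that] by (auto simp: D_def split: if_splits)
    then have "\<bar>e\<bar> \<le> C / real (D s) ^ 3" using False by (intro far) auto
    moreover have "(kern t s)\<^sup>2 = 1 / real (D s) ^ 3"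
      using False by (intro kern_square) (auto simp: D_def)
    ultimately show ?thesis by simp
  qed
  also have "\<dots> \<le> C * (\<Sum>s\<in>A. kern t s)\<^sup>2"
    using C0 A s(1) less_imp_le[OF kern_pos]
    by (intro mult_left_mono power_mono member_le_sum) auto
  finally show ?thesis .
qed

section \<open>Decoupling unbounded products with error of order m^-3\<close>

context mixing_process
begin

text \<open>The level c = m^(18/\<delta>) equalises the two errors: c \<beta>(m) loses exactly the
  factor m^(18/\<delta>) of the rate, and c^(-\<delta>/6) = m^-3.\<close>

lemma rate_choice:
  assumes m: "m \<ge> 1" and K: "0 \<le> K"
  defines "c \<equiv> real m powr (18 / \<delta>)"
  shows "0 < c" "c * beta_mix M X m \<le> B / real m ^ 3" "K * c powr (1 - (1 + \<delta> / 6)) = K / real m ^ 3"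
proof -
  have m0: "real m > 0" using m by simp
  show c: "0 < c" using m by (simp add: c_def)
  have "c * beta_mix M X m \<le> c * (B * real m powr (- (3 + 18 / \<delta>)))"
    using rate[OF m] c by (intro mult_left_mono) auto
  also have "\<dots> = B * real m powr (- 3)"
    unfolding c_def using m by (simp add: powr_add[symmetric] mult.left_commute)
  also have m3: "real m powr (- 3) = 1 / real m ^ 3"
    using m0 by (simp add: powr_minus powr_numeral inverse_eq_divide)
  finally show "c * beta_mix M X m \<le> B / real m ^ 3" by simp
  have "c powr (1 - (1 + \<delta> / 6)) = real m powr (- 3)"
    unfolding c_def powr_powr using \<delta> by (simp add: field_simps)
  then show "K * c powr (1 - (1 + \<delta> / 6)) = K / real m ^ 3" using m3 by simp
qed

lemma q_gt_1: "1 < 1 + \<delta> / 6" using \<delta> by simp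

text \<open>Only the truncated function is decoupled, at cost 6 B / m^3. Truncation is paid twice,
  under the original and under the decoupled law, which gives 2 K.\<close>

lemma isolated_rate:
  assumes \<Phi>: "\<Phi> \<in> borel_measurable (borel \<Otimes>\<^sub>M (\<Pi>\<^sub>M i\<in>far t m. borel))"
    and t: "t \<ge> 1" and m: "m \<ge> 1"
  defines "f \<equiv> \<lambda>\<omega>. \<Phi> (X t \<omega>, \<lambda>i\<in>far t m. X i \<omega>)"
    and "f' \<equiv> \<lambda>(\<omega>', \<omega>). \<Phi> (X t \<omega>', \<lambda>i\<in>far t m. X i \<omega>)"
  assumes i: "integrable M (\<lambda>\<omega>. \<bar>f \<omega>\<bar> powr (1 + \<delta> / 6))" "expectation (\<lambda>\<omega>. \<bar>f \<omega>\<bar> powr (1 + \<delta> / 6)) \<le> K"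
    and i': "integrable (M \<Otimes>\<^sub>M M) (\<lambda>z. \<bar>f' z\<bar> powr (1 + \<delta> / 6))"
      "(\<integral>z. \<bar>f' z\<bar> powr (1 + \<delta> / 6) \<partial>(M \<Otimes>\<^sub>M M)) \<le> K"
  shows "\<bar>expectation f - integral\<^sup>L (M \<Otimes>\<^sub>M M) f'\<bar> \<le> (6 * B + 2 * K) / real m ^ 3"
    and "integrable M f" "integrable (M \<Otimes>\<^sub>M M) f'"
proof -
  define c where "c = real m powr (18 / \<delta>)"
  have K: "0 \<le> K" using i(2) by (rule order_trans[rotated]) (rule integral_nonneg_AE, simp)
  note c = rate_choice[OF m K, folded c_def]
  have zm: "(\<lambda>\<omega>. \<lambda>i\<in>far t m. X i \<omega>) \<in> measurable M (\<Pi>\<^sub>M i\<in>far t m. borel)"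
    by (intro measurable_restrict X_meas) (auto simp: far_def)
  note [measurable] = \<Phi> X_meas[OF t] zm
  have fm: "f \<in> borel_measurable M" unfolding f_def by measurable
  have fm': "f' \<in> borel_measurable (M \<Otimes>\<^sub>M M)" unfolding f'_def by measurable
  define \<Psi> where "\<Psi> z = (if \<bar>\<Phi> z\<bar> \<le> c then \<Phi> z else 0)" for z
  have \<Psi>: "\<Psi> \<in> borel_measurable (borel \<Otimes>\<^sub>M (\<Pi>\<^sub>M i\<in>far t m. borel))" unfolding \<Psi>_def by measurable
  have "\<bar>(\<integral>\<omega>. \<Psi> (X t \<omega>, \<lambda>i\<in>far t m. X i \<omega>) \<partial>M)
    - (\<integral>(\<omega>', \<omega>). \<Psi> (X t \<omega>', \<lambda>i\<in>far t m. X i \<omega>) \<partial>(M \<Otimes>\<^sub>M M))\<bar> \<le> 6 * c * beta_mix M X m"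
    by (rule decouple_isolated[OF \<Psi> t m]) (use c(1) in \<open>auto simp: \<Psi>_def\<close>)
  moreover have "(\<integral>\<omega>. \<Psi> (X t \<omega>, \<lambda>i\<in>far t m. X i \<omega>) \<partial>M) = expectation (\<lambda>\<omega>. if \<bar>f \<omega>\<bar> \<le> c then f \<omega> else 0)"
    unfolding \<Psi>_def f_def ..
  moreover have "(\<integral>(\<omega>', \<omega>). \<Psi> (X t \<omega>', \<lambda>i\<in>far t m. X i \<omega>) \<partial>(M \<Otimes>\<^sub>M M)) =
     (\<integral>z. (if \<bar>f' z\<bar> \<le> c then f' z else 0) \<partial>(M \<Otimes>\<^sub>M M))"
    unfolding \<Psi>_def f'_def case_prod_beta' ..
  moreover note t1 = truncation_error[OF fm i q_gt_1 c(1)]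
  moreover note t2 = MM.P.truncation_error[OF fm' i' q_gt_1 c(1)]
  ultimately have "\<bar>expectation f - integral\<^sup>L (M \<Otimes>\<^sub>M M) f'\<bar> \<le> 6 * (c * beta_mix M X m) + 2 * (K * c powr (1 - (1 + \<delta> / 6)))"
    by linarith
  also have "\<dots> \<le> 6 * (B / real m ^ 3) + 2 * (K / real m ^ 3)"
    using c(2,3) by linarith
  also have "\<dots> = (6 * B + 2 * K) / real m ^ 3" by (simp add: add_divide_distrib)
  finally show "\<bar>expectation f - integral\<^sup>L (M \<Otimes>\<^sub>M M) f'\<bar> \<le> (6 * B + 2 * K) / real m ^ 3" .
  show "integrable M f" "integrable (M \<Otimes>\<^sub>M M) f'" using t1 t2 by auto
qed

lemma past_future_rate:
  assumes f: "f \<in> borel_measurable (\<S> {1..k} \<Otimes>\<^sub>M \<S> {k + m..})" and k: "k \<ge> 1" and m: "m \<ge> 1"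
  assumes i: "integrable M (\<lambda>\<omega>. \<bar>f (\<omega>, \<omega>)\<bar> powr (1 + \<delta> / 6))" "expectation (\<lambda>\<omega>. \<bar>f (\<omega>, \<omega>)\<bar> powr (1 + \<delta> / 6)) \<le> K"
    and i': "integrable (M \<Otimes>\<^sub>M M) (\<lambda>z. \<bar>f z\<bar> powr (1 + \<delta> / 6))"
      "(\<integral>z. \<bar>f z\<bar> powr (1 + \<delta> / 6) \<partial>(M \<Otimes>\<^sub>M M)) \<le> K"
  shows "\<bar>expectation (\<lambda>\<omega>. f (\<omega>, \<omega>)) - integral\<^sup>L (M \<Otimes>\<^sub>M M) f\<bar> \<le> (2 * B + 2 * K) / real m ^ 3"
proof -
  define c where "c = real m powr (18 / \<delta>)"
  have K: "0 \<le> K" using i(2) by (rule order_trans[rotated]) (rule integral_nonneg_AE, simp)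
  note c = rate_choice[OF m K, folded c_def]
  have 2: "two_subalgebras M (\<S> {1..k}) (\<S> {k + m..})" by (rule two_subalgebras_sigma_gen) (use k in auto)
  have sp: "space (\<S> I) = space M" for I by (simp add: sigma_gen_def)
  have fm': "f \<in> borel_measurable (M \<Otimes>\<^sub>M M)"
    using f two_subalgebras.pair_sets_M[OF 2] unfolding measurable_def by (auto simp: space_pair_measure sp)
  have fm: "(\<lambda>\<omega>. f (\<omega>, \<omega>)) \<in> borel_measurable M" using fm' by measurable
  have "\<bar>(\<integral>\<omega>. (if \<bar>f (\<omega>, \<omega>)\<bar> \<le> c then f (\<omega>, \<omega>) else 0) \<partial>M)
    - (\<integral>z. (if \<bar>f z\<bar> \<le> c then f z else 0) \<partial>(M \<Otimes>\<^sub>M M))\<bar> \<le> 2 * c * beta_mix M X m"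
    by (rule decouple_past_future[OF _ k, of "\<lambda>z. if \<bar>f z\<bar> \<le> c then f z else 0"]) (use c(1) f in auto)
  moreover note t1 = truncation_error[OF fm i q_gt_1 c(1)]
  moreover note t2 = MM.P.truncation_error[OF fm' i' q_gt_1 c(1)]
  ultimately have "\<bar>expectation (\<lambda>\<omega>. f (\<omega>, \<omega>)) - integral\<^sup>L (M \<Otimes>\<^sub>M M) f\<bar> \<le> 2 * (c * beta_mix M X m) + 2 * (K * c powr (1 - (1 + \<delta> / 6)))"
    by linarith
  also have "\<dots> \<le> 2 * (B / real m ^ 3) + 2 * (K / real m ^ 3)"
    using c(2,3) by linarith
  also have "\<dots> = (2 * B + 2 * K) / real m ^ 3" by (simp add: add_divide_distrib)
  finally show ?thesis .
qed

text \<open>Besides the moments of dependent pairs, those of independent pairs are demanded: after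
  decoupling, one argument of a kernel is an independent copy. The order equals 4 (1 + \<delta>/6),
  so that a product of four such kernels has a moment of order 1 + \<delta>/6.\<close>

definition bounded_moments :: "real \<Rightarrow> (real \<Rightarrow> real \<Rightarrow> real) \<Rightarrow> bool" where
  "bounded_moments K g \<longleftrightarrow> case_prod g \<in> borel_measurable (borel \<Otimes>\<^sub>M borel) \<and>
    (\<forall>i\<ge>1. \<forall>j\<ge>1. integrable M (\<lambda>\<omega>. \<bar>g (X i \<omega>) (X j \<omega>)\<bar> powr (4 + 2 / 3 * \<delta>)) \<and>
       expectation (\<lambda>\<omega>. \<bar>g (X i \<omega>) (X j \<omega>)\<bar> powr (4 + 2 / 3 * \<delta>)) \<le> K \<and>
       integrable (M \<Otimes>\<^sub>M M) (\<lambda>(\<omega>', \<omega>). \<bar>g (X i \<omega>') (X j \<omega>)\<bar> powr (4 + 2 / 3 * \<delta>)) \<and>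
       (\<integral>(\<omega>', \<omega>). \<bar>g (X i \<omega>') (X j \<omega>)\<bar> powr (4 + 2 / 3 * \<delta>) \<partial>(M \<Otimes>\<^sub>M M)) \<le> K)"

text \<open>Only the first argument is integrated out. A centred function of one variable, given a
  dummy second argument, is therefore degenerate as well, and the linear part passes through the
  same estimates as \<open>h2\<close>. The condition is almost sure because sections of a kernel are
  integrable only for almost every value.\<close>

definition degenerate :: "(real \<Rightarrow> real \<Rightarrow> real) \<Rightarrow> bool" where
  "degenerate g \<longleftrightarrow> (\<forall>i\<ge>1. \<forall>j\<ge>1. AE \<omega> in M. (\<integral>\<omega>'. g (X i \<omega>') (X j \<omega>) \<partial>M) = 0)"

lemma bounded_momentsD:
  assumes "bounded_moments K g"
  shows "(\<lambda>(x, y). g x y) \<in> borel_measurable (borel \<Otimes>\<^sub>M borel)"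
    and "i \<ge> 1 \<Longrightarrow> j \<ge> 1 \<Longrightarrow> integrable M (\<lambda>\<omega>. \<bar>g (X i \<omega>) (X j \<omega>)\<bar> powr (4 * (1 + \<delta> / 6)))"
    and "i \<ge> 1 \<Longrightarrow> j \<ge> 1 \<Longrightarrow> expectation (\<lambda>\<omega>. \<bar>g (X i \<omega>) (X j \<omega>)\<bar> powr (4 * (1 + \<delta> / 6))) \<le> K"
    and "i \<ge> 1 \<Longrightarrow> j \<ge> 1 \<Longrightarrow> integrable (M \<Otimes>\<^sub>M M) (\<lambda>z. \<bar>g (X i (fst z)) (X j (snd z))\<bar> powr (4 * (1 + \<delta> / 6)))"
    and "i \<ge> 1 \<Longrightarrow> j \<ge> 1 \<Longrightarrow> (\<integral>z. \<bar>g (X i (fst z)) (X j (snd z))\<bar> powr (4 * (1 + \<delta> / 6)) \<partial>(M \<Otimes>\<^sub>M M)) \<le> K"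
proof -
  have e: "4 * (1 + \<delta> / 6) = 4 + 2 / 3 * \<delta>" by simp
  show "(\<lambda>(x, y). g x y) \<in> borel_measurable (borel \<Otimes>\<^sub>M borel)"
    using assms by (simp add: bounded_moments_def)
qed (use assms in \<open>simp_all add: bounded_moments_def case_prod_beta' distrib_left\<close>)

lemma bounded_moments_comp:
  assumes "bounded_moments K g" "u \<in> borel_measurable N" "v \<in> borel_measurable N"
  shows "(\<lambda>z. g (u z) (v z)) \<in> borel_measurable N"
  using measurable_compose[OF measurable_Pair[OF assms(2,3)] bounded_momentsD(1)[OF assms(1)]] by simp

lemma MM_snd:
  assumes "integrable M f"
  shows "integrable (M \<Otimes>\<^sub>M M) (\<lambda>z. f (snd z))" "(\<integral>z. f (snd z) \<partial>(M \<Otimes>\<^sub>M M)) = (\<integral>\<omega>. f \<omega> \<partial>M :: real)"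
proof -
  have d: "distr (M \<Otimes>\<^sub>M M) M snd = M"
  proof (rule measure_eqI)
    fix A assume "A \<in> sets (distr (M \<Otimes>\<^sub>M M) M snd)"
    then have A: "A \<in> sets M" by simp
    then have "snd -` A \<inter> space (M \<Otimes>\<^sub>M M) = space M \<times> A"
      by (auto simp: space_pair_measure dest: sets.sets_into_space)
    then show "emeasure (distr (M \<Otimes>\<^sub>M M) M snd) A = emeasure M A"
      using A by (simp add: emeasure_distr emeasure_pair_measure_Times emeasure_space_1)
  qed simp
  show "integrable (M \<Otimes>\<^sub>M M) (\<lambda>z. f (snd z))"
    by (rule integrable_distr[OF measurable_snd]) (simp add: d assms)
  show "(\<integral>z. f (snd z) \<partial>(M \<Otimes>\<^sub>M M)) = (\<integral>\<omega>. f \<omega> \<partial>M)"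
    using integral_distr[of snd "M \<Otimes>\<^sub>M M" M f] assms by (simp add: d)
qed

lemma MM_fst:
  assumes "integrable M f"
  shows "integrable (M \<Otimes>\<^sub>M M) (\<lambda>z. f (fst z))" "(\<integral>z. f (fst z) \<partial>(M \<Otimes>\<^sub>M M)) = (\<integral>\<omega>. f \<omega> \<partial>M :: real)"
proof -
  have d: "distr (M \<Otimes>\<^sub>M M) M fst = M" by (rule distr_pair_fst)
  show "integrable (M \<Otimes>\<^sub>M M) (\<lambda>z. f (fst z))"
    by (rule integrable_distr[OF measurable_fst]) (simp add: d assms)
  show "(\<integral>z. f (fst z) \<partial>(M \<Otimes>\<^sub>M M)) = (\<integral>\<omega>. f \<omega> \<partial>M)"
    using integral_distr[of fst "M \<Otimes>\<^sub>M M" M f] assms by (simp add: d)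
qed

end

lemma prod4_moment:
  fixes a b c d :: "'a \<Rightarrow> real"
  assumes m: "a \<in> borel_measurable N" "b \<in> borel_measurable N" "c \<in> borel_measurable N" "d \<in> borel_measurable N"
    and q: "0 \<le> q"
    and i: "integrable N (\<lambda>z. \<bar>a z\<bar> powr (4 * q))" "integrable N (\<lambda>z. \<bar>b z\<bar> powr (4 * q))"
      "integrable N (\<lambda>z. \<bar>c z\<bar> powr (4 * q))" "integrable N (\<lambda>z. \<bar>d z\<bar> powr (4 * q))"
    and K: "(\<integral>z. \<bar>a z\<bar> powr (4 * q) \<partial>N) \<le> K" "(\<integral>z. \<bar>b z\<bar> powr (4 * q) \<partial>N) \<le> K"
      "(\<integral>z. \<bar>c z\<bar> powr (4 * q) \<partial>N) \<le> K" "(\<integral>z. \<bar>d z\<bar> powr (4 * q) \<partial>N) \<le> K"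
  shows "integrable N (\<lambda>z. \<bar>a z * b z * c z * d z\<bar> powr q)"
    and "(\<integral>z. \<bar>a z * b z * c z * d z\<bar> powr q \<partial>N) \<le> 4 * K"
proof -
  let ?s = "\<lambda>z. \<bar>a z\<bar> powr (4 * q) + \<bar>b z\<bar> powr (4 * q) + \<bar>c z\<bar> powr (4 * q) + \<bar>d z\<bar> powr (4 * q)"
  note [measurable] = m
  have si: "integrable N ?s" using i by simp
  show 1: "integrable N (\<lambda>z. \<bar>a z * b z * c z * d z\<bar> powr q)"
    by (rule Bochner_Integration.integrable_bound[OF si])
       (auto intro!: AE_I2 order_trans[OF prod4_powr_le[OF q]])
  have "(\<integral>z. \<bar>a z * b z * c z * d z\<bar> powr q \<partial>N) \<le> (\<integral>z. ?s z \<partial>N)"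
    by (rule integral_mono[OF 1 si]) (rule prod4_powr_le[OF q])
  also have "\<dots> \<le> 4 * K" using i K by simp
  finally show "(\<integral>z. \<bar>a z * b z * c z * d z\<bar> powr q \<partial>N) \<le> 4 * K" .
qed

lemma (in prob_space) prod4_integrable:
  fixes a b c d :: "'a \<Rightarrow> real"
  assumes m: "a \<in> borel_measurable M" "b \<in> borel_measurable M" "c \<in> borel_measurable M" "d \<in> borel_measurable M"
    and q: "1 < q"
    and i: "integrable M (\<lambda>z. \<bar>a z\<bar> powr (4 * q))" "integrable M (\<lambda>z. \<bar>b z\<bar> powr (4 * q))"
      "integrable M (\<lambda>z. \<bar>c z\<bar> powr (4 * q))" "integrable M (\<lambda>z. \<bar>d z\<bar> powr (4 * q))"
    and K: "expectation (\<lambda>z. \<bar>a z\<bar> powr (4 * q)) \<le> K" "expectation (\<lambda>z. \<bar>b z\<bar> powr (4 * q)) \<le> K"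
      "expectation (\<lambda>z. \<bar>c z\<bar> powr (4 * q)) \<le> K" "expectation (\<lambda>z. \<bar>d z\<bar> powr (4 * q)) \<le> K"
  shows "integrable M (\<lambda>z. a z * b z * c z * d z)"
    and "\<bar>expectation (\<lambda>z. a z * b z * c z * d z)\<bar> \<le> 1 + 4 * K"
proof -
  have q0: "0 \<le> q" using q by simp
  note p = prod4_moment[OF m q0 i K]
  note [measurable] = m
  show 1: "integrable M (\<lambda>z. a z * b z * c z * d z)"
    by (rule truncation_error(1)[OF _ p q, of 1]) auto
  \<comment> \<open>Truncation at level 1: the truncated product contributes at most 1 and the
    cut-off part at most 4 K.\<close>
  have "\<bar>expectation (\<lambda>z. a z * b z * c z * d z)
      - expectation (\<lambda>\<omega>. if \<bar>a \<omega> * b \<omega> * c \<omega> * d \<omega>\<bar> \<le> 1 then a \<omega> * b \<omega> * c \<omega> * d \<omega> else 0)\<bar> \<le> 4 * K * 1 powr (1 - q)"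
    by (rule truncation_error(2)[OF _ p q]) auto
  moreover have "\<bar>expectation (\<lambda>\<omega>. if \<bar>a \<omega> * b \<omega> * c \<omega> * d \<omega>\<bar> \<le> 1 then a \<omega> * b \<omega> * c \<omega> * d \<omega> else 0)\<bar> \<le> 1"
  proof -
    have "\<bar>expectation (\<lambda>\<omega>. if \<bar>a \<omega> * b \<omega> * c \<omega> * d \<omega>\<bar> \<le> 1 then a \<omega> * b \<omega> * c \<omega> * d \<omega> else 0)\<bar>
      \<le> expectation (\<lambda>\<omega>. \<bar>if \<bar>a \<omega> * b \<omega> * c \<omega> * d \<omega>\<bar> \<le> 1 then a \<omega> * b \<omega> * c \<omega> * d \<omega> else 0\<bar>)"
      by (rule integral_abs_bound)
    also have "\<dots> \<le> expectation (\<lambda>_. 1)" by (rule integral_mono') auto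
    finally show ?thesis by (simp add: prob_space)
  qed
  ultimately show "\<bar>expectation (\<lambda>z. a z * b z * c z * d z)\<bar> \<le> 1 + 4 * K" by simp
qed

section \<open>Expectations of products of four kernels\<close>

context mixing_process
begin

lemma product_integrable:
  assumes g: "bounded_moments K g0" "bounded_moments K g1" "bounded_moments K g2" "bounded_moments K g3"
    and ge: "a0 \<ge> 1" "b0 \<ge> 1" "a1 \<ge> 1" "b1 \<ge> 1" "a2 \<ge> 1" "b2 \<ge> 1" "a3 \<ge> 1" "b3 \<ge> 1"
  defines "f \<equiv> \<lambda>\<omega>. g0 (X a0 \<omega>) (X b0 \<omega>) * g1 (X a1 \<omega>) (X b1 \<omega>) * g2 (X a2 \<omega>) (X b2 \<omega>) * g3 (X a3 \<omega>) (X b3 \<omega>)"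
  shows "integrable M f" "\<bar>expectation f\<bar> \<le> 1 + 4 * K"
  unfolding f_def
  by (rule prod4_integrable[OF _ _ _ _ q_gt_1];
      (rule bounded_moments_comp g X_meas ge bounded_momentsD(2,3))+)+

text \<open>Time t enters through the first argument of \<open>g0\<close> alone. Once it is an
  independent copy, the other factors are constants for the inner integral, and degeneracy of
  \<open>g0\<close> makes that integral vanish; the decoupling error is all that is left. The
  product has moment bound 4 K, whence 8 K.\<close>

lemma isolated_product:
  assumes g: "bounded_moments K g0" "bounded_moments K g1" "bounded_moments K g2" "bounded_moments K g3"
    and dg: "degenerate g0" and t: "t \<ge> 1" and m: "m \<ge> 1"
    and fr: "b0 \<in> far t m" "a1 \<in> far t m" "b1 \<in> far t m" "a2 \<in> far t m" "b2 \<in> far t m" "a3 \<in> far t m" "b3 \<in> far t m"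
  defines "f \<equiv> \<lambda>\<omega>. g0 (X t \<omega>) (X b0 \<omega>) * g1 (X a1 \<omega>) (X b1 \<omega>) * g2 (X a2 \<omega>) (X b2 \<omega>) * g3 (X a3 \<omega>) (X b3 \<omega>)"
  shows "\<bar>expectation f\<bar> \<le> (6 * B + 8 * K) / real m ^ 3"
proof -
  have ge: "i \<ge> 1" if "i \<in> far t m" for i using that by (simp add: far_def)
  note ges = fr[THEN ge]
  define \<Phi> where "\<Phi> = (\<lambda>(x, z). g0 x (z b0) * g1 (z a1) (z b1) * g2 (z a2) (z b2) * g3 (z a3) (z b3))"
  let ?N = "borel \<Otimes>\<^sub>M (\<Pi>\<^sub>M i\<in>far t m. (borel :: real measure))"
  have zc: "(\<lambda>p. snd p i) \<in> borel_measurable ?N" if "i \<in> far t m" for i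
    by (rule measurable_compose[OF measurable_snd measurable_component_singleton[OF that]])
  have \<Phi>m: "\<Phi> \<in> borel_measurable ?N"
    unfolding \<Phi>_def case_prod_beta'
    by (intro borel_measurable_times bounded_moments_comp[OF g(1)] bounded_moments_comp[OF g(2)]
        bounded_moments_comp[OF g(3)] bounded_moments_comp[OF g(4)] zc fr measurable_fst)
  have f: "f = (\<lambda>\<omega>. \<Phi> (X t \<omega>, \<lambda>i\<in>far t m. X i \<omega>))"
    using fr by (auto simp: f_def \<Phi>_def)
  let ?f' = "\<lambda>z. g0 (X t (fst z)) (X b0 (snd z)) * g1 (X a1 (snd z)) (X b1 (snd z)) * g2 (X a2 (snd z)) (X b2 (snd z)) * g3 (X a3 (snd z)) (X b3 (snd z))"
  have f': "?f' = (\<lambda>(\<omega>', \<omega>). \<Phi> (X t \<omega>', \<lambda>i\<in>far t m. X i \<omega>))"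
    using fr by (auto simp: \<Phi>_def fun_eq_iff)
  have q0: "0 \<le> 1 + \<delta> / 6" using \<delta> by simp
  have Xm2: "(\<lambda>z. X i (snd z)) \<in> borel_measurable (M \<Otimes>\<^sub>M M)" "(\<lambda>z. X i (fst z)) \<in> borel_measurable (M \<Otimes>\<^sub>M M)"
    if "i \<ge> 1" for i
    by (rule measurable_compose[OF measurable_snd X_meas[OF that]] measurable_compose[OF measurable_fst X_meas[OF that]])+
  have A: "integrable M (\<lambda>\<omega>. \<bar>f \<omega>\<bar> powr (1 + \<delta> / 6))" "expectation (\<lambda>\<omega>. \<bar>f \<omega>\<bar> powr (1 + \<delta> / 6)) \<le> 4 * K"
    unfolding f_def
    by (rule prod4_moment[OF _ _ _ _ q0];
        (rule bounded_moments_comp g X_meas t ges bounded_momentsD(2,3))+)+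
  have A': "integrable (M \<Otimes>\<^sub>M M) (\<lambda>z. \<bar>?f' z\<bar> powr (1 + \<delta> / 6))"
      "(\<integral>z. \<bar>?f' z\<bar> powr (1 + \<delta> / 6) \<partial>(M \<Otimes>\<^sub>M M)) \<le> 4 * K"
  proof -
    note i0 = bounded_momentsD(4,5)[OF g(1) t ges(1)]
    note i1 = MM_snd[OF bounded_momentsD(2)[OF g(2) ges(2,3)]]
    note i2 = MM_snd[OF bounded_momentsD(2)[OF g(3) ges(4,5)]]
    note i3 = MM_snd[OF bounded_momentsD(2)[OF g(4) ges(6,7)]]
    note k1 = bounded_momentsD(3)[OF g(2) ges(2,3)]
    note k2 = bounded_momentsD(3)[OF g(3) ges(4,5)]
    note k3 = bounded_momentsD(3)[OF g(4) ges(6,7)]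
    note p4 = prod4_moment[where N="M \<Otimes>\<^sub>M M",
      OF bounded_moments_comp[OF g(1) Xm2(2)[OF t] Xm2(1)[OF ges(1)]]
        bounded_moments_comp[OF g(2) Xm2(1)[OF ges(2)] Xm2(1)[OF ges(3)]]
        bounded_moments_comp[OF g(3) Xm2(1)[OF ges(4)] Xm2(1)[OF ges(5)]]
        bounded_moments_comp[OF g(4) Xm2(1)[OF ges(6)] Xm2(1)[OF ges(7)]] q0 i0(1) i1(1) i2(1) i3(1) i0(2)]
    show "integrable (M \<Otimes>\<^sub>M M) (\<lambda>z. \<bar>?f' z\<bar> powr (1 + \<delta> / 6))"
      by (rule p4(1); unfold i1(2) i2(2) i3(2); rule k1 k2 k3)
    show "(\<integral>z. \<bar>?f' z\<bar> powr (1 + \<delta> / 6) \<partial>(M \<Otimes>\<^sub>M M)) \<le> 4 * K"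
      by (rule p4(2); unfold i1(2) i2(2) i3(2); rule k1 k2 k3)
  qed
  note r = isolated_rate[OF \<Phi>m t m, folded f f', OF A[unfolded f] A']
  \<comment> \<open>The independent copy is integrated innermost.\<close>
  have "integral\<^sup>L (M \<Otimes>\<^sub>M M) ?f' = (\<integral>\<omega>. (\<integral>\<omega>'. ?f' (\<omega>', \<omega>) \<partial>M) \<partial>M)"
    using MM.integral_snd[of "\<lambda>x y. ?f' (x, y)"] r(3) by (simp add: case_prod_beta')
  also have "\<dots> = (\<integral>\<omega>. 0 \<partial>M)"
  proof (rule integral_cong_AE)
    show "(\<lambda>\<omega>. \<integral>\<omega>'. ?f' (\<omega>', \<omega>) \<partial>M) \<in> borel_measurable M"
      using MM.integrable_snd[of "\<lambda>x y. ?f' (x, y)"] r(3) by (intro borel_measurable_integrable) (simp add: case_prod_beta')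
    have "AE \<omega> in M. (\<integral>\<omega>'. g0 (X t \<omega>') (X b0 \<omega>) \<partial>M) = 0"
      using dg t ges(1) by (simp add: degenerate_def)
    then show "AE \<omega> in M. (\<integral>\<omega>'. ?f' (\<omega>', \<omega>) \<partial>M) = 0"
      by eventually_elim simp
  qed simp
  finally have "integral\<^sup>L (M \<Otimes>\<^sub>M M) ?f' = 0" by simp
  then show ?thesis using r(1) by simp
qed

text \<open>The constant dominates both the trivial bound 1 + 4 K, used when t lies in A, and the
  constant 6 B + 8 K of the isolated case.\<close>

lemma product_le_kern:
  assumes g: "bounded_moments K g0" "bounded_moments K g1" "bounded_moments K g2" "bounded_moments K g3"
    and dg: "degenerate g0" and t: "t \<ge> 1"
    and A: "{b0, a1, b1, a2, b2, a3, b3} \<subseteq> A" "finite A" "A \<subseteq> {1..}"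
  defines "f \<equiv> \<lambda>\<omega>. g0 (X t \<omega>) (X b0 \<omega>) * g1 (X a1 \<omega>) (X b1 \<omega>) * g2 (X a2 \<omega>) (X b2 \<omega>) * g3 (X a3 \<omega>) (X b3 \<omega>)"
  shows "\<bar>expectation f\<bar> \<le> (1 + 6 * B + 8 * K) * (\<Sum>s\<in>A. kern t s)\<^sup>2"
proof (rule le_kern_sum)
  have ge: "i \<ge> 1" if "i \<in> A" for i using that A by auto
  have K: "0 \<le> K" using bounded_momentsD(3)[OF g(1) t t]
    by (rule order_trans[rotated]) (rule integral_nonneg_AE, simp)
  have "\<bar>expectation f\<bar> \<le> 1 + 4 * K"
    unfolding f_def by (rule product_integrable(2)[OF g t]) (use A in auto)
  then show "\<bar>expectation f\<bar> \<le> 1 + 6 * B + 8 * K" using B K by linarith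
  fix m :: nat assume m: "m \<ge> 1" and "\<And>i. i \<in> A \<Longrightarrow> i + m \<le> t \<or> t + m \<le> i"
  then have "A \<subseteq> far t m" using ge by (auto simp: far_def)
  then have "\<bar>expectation f\<bar> \<le> (6 * B + 8 * K) / real m ^ 3"
    unfolding f_def by (intro isolated_product[OF g dg t m]) (use A in auto)
  also have "\<dots> \<le> (1 + 6 * B + 8 * K) / real m ^ 3" by (intro divide_right_mono) auto
  finally show "\<bar>expectation f\<bar> \<le> (1 + 6 * B + 8 * K) / real m ^ 3" .
qed (use A in auto)

text \<open>Here nothing is degenerate: two pairs separated by a gap m are split once, so the
  product law yields the product of the two expectations. It controls covariances of squared block
  sums.\<close>

lemma product_covariance:
  assumes y: "bounded_moments K (\<lambda>x _. y x)" and k: "k \<ge> 1" and m: "m \<ge> 1"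
    and a: "a \<in> {1..k}" "b \<in> {1..k}" and c: "k + m \<le> c" "k + m \<le> d"
  shows "\<bar>expectation (\<lambda>\<omega>. y (X a \<omega>) * y (X b \<omega>) * y (X c \<omega>) * y (X d \<omega>))
      - expectation (\<lambda>\<omega>. y (X a \<omega>) * y (X b \<omega>)) * expectation (\<lambda>\<omega>. y (X c \<omega>) * y (X d \<omega>))\<bar>
    \<le> (2 * B + 8 * K) / real m ^ 3"
proof -
  have ge: "a \<ge> 1" "b \<ge> 1" "c \<ge> 1" "d \<ge> 1" using a c k by auto
  have ym: "y \<in> borel_measurable borel"
    using bounded_moments_comp[OF y, of "\<lambda>x. x" borel "\<lambda>x. x"] by simp
  have q0: "0 \<le> 1 + \<delta> / 6" using \<delta> by simp
  let ?f = "\<lambda>z. y (X a (fst z)) * y (X b (fst z)) * y (X c (snd z)) * y (X d (snd z))"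
  have fstm: "(\<lambda>z. y (X i (fst z))) \<in> borel_measurable (\<S> {1..k} \<Otimes>\<^sub>M N)" if "i \<in> {1..k}" for i and N :: "'a measure"
    by (rule measurable_compose[OF _ ym]) (rule measurable_compose[OF measurable_fst measurable_sigma_gen[OF that]])
  have sndm: "(\<lambda>z. y (X i (snd z))) \<in> borel_measurable (N \<Otimes>\<^sub>M \<S> {k + m..})" if "k + m \<le> i" for i and N :: "'a measure"
    by (rule measurable_compose[OF _ ym]) (rule measurable_compose[OF measurable_snd measurable_sigma_gen], use that in auto)
  have fm: "?f \<in> borel_measurable (\<S> {1..k} \<Otimes>\<^sub>M \<S> {k + m..})"
    by (intro borel_measurable_times fstm sndm a c)
  have yX: "(\<lambda>\<omega>. y (X i \<omega>)) \<in> borel_measurable M" if "i \<ge> 1" for i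
    by (rule measurable_compose[OF X_meas[OF that] ym])
  have M1: "integrable M (\<lambda>\<omega>. \<bar>y (X i \<omega>)\<bar> powr (4 * (1 + \<delta> / 6)))"
     "expectation (\<lambda>\<omega>. \<bar>y (X i \<omega>)\<bar> powr (4 * (1 + \<delta> / 6))) \<le> K" if "i \<ge> 1" for i
    using bounded_momentsD(2,3)[OF y that that] by auto
  have A: "integrable M (\<lambda>\<omega>. \<bar>?f (\<omega>, \<omega>)\<bar> powr (1 + \<delta> / 6))"
     "expectation (\<lambda>\<omega>. \<bar>?f (\<omega>, \<omega>)\<bar> powr (1 + \<delta> / 6)) \<le> 4 * K"
    unfolding fst_conv snd_conv
    by (rule prod4_moment[OF _ _ _ _ q0]; (rule yX ge M1)+)+
  have ms: "(\<lambda>z. y (X i (fst z))) \<in> borel_measurable (M \<Otimes>\<^sub>M M)" "(\<lambda>z. y (X i (snd z))) \<in> borel_measurable (M \<Otimes>\<^sub>M M)"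
    if "i \<ge> 1" for i
    using measurable_compose[OF measurable_fst yX[OF that]] measurable_compose[OF measurable_snd yX[OF that]] by auto
  have M2: "integrable (M \<Otimes>\<^sub>M M) (\<lambda>z. \<bar>y (X i (fst z))\<bar> powr (4 * (1 + \<delta> / 6)))"
     "(\<integral>z. \<bar>y (X i (fst z))\<bar> powr (4 * (1 + \<delta> / 6)) \<partial>(M \<Otimes>\<^sub>M M)) \<le> K"
     "integrable (M \<Otimes>\<^sub>M M) (\<lambda>z. \<bar>y (X i (snd z))\<bar> powr (4 * (1 + \<delta> / 6)))"
     "(\<integral>z. \<bar>y (X i (snd z))\<bar> powr (4 * (1 + \<delta> / 6)) \<partial>(M \<Otimes>\<^sub>M M)) \<le> K" if "i \<ge> 1" for i
    using MM_fst[OF M1(1)[OF that]] MM_snd[OF M1(1)[OF that]] M1(2)[OF that] by simp_all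
  have A': "integrable (M \<Otimes>\<^sub>M M) (\<lambda>z. \<bar>?f z\<bar> powr (1 + \<delta> / 6))"
      "(\<integral>z. \<bar>?f z\<bar> powr (1 + \<delta> / 6) \<partial>(M \<Otimes>\<^sub>M M)) \<le> 4 * K"
    by (rule prod4_moment[OF _ _ _ _ q0]; (rule ms ge M2)+)+
  have fi: "integrable (M \<Otimes>\<^sub>M M) ?f"
    by (rule MM.P.truncation_error(1)[OF _ A' q_gt_1, of 1]) (intro borel_measurable_times ms ge, simp)
  have "integral\<^sup>L (M \<Otimes>\<^sub>M M) ?f = (\<integral>\<omega>. (\<integral>\<omega>'. ?f (\<omega>, \<omega>') \<partial>M) \<partial>M)"
    using MM.integral_fst[of "\<lambda>x y. ?f (x, y)"] fi by (simp add: case_prod_beta')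
  also have "\<dots> = expectation (\<lambda>\<omega>. y (X a \<omega>) * y (X b \<omega>)) * expectation (\<lambda>\<omega>. y (X c \<omega>) * y (X d \<omega>))"
  proof -
    have "(\<integral>\<omega>'. ?f (\<omega>, \<omega>') \<partial>M) = (y (X a \<omega>) * y (X b \<omega>)) * expectation (\<lambda>\<omega>. y (X c \<omega>) * y (X d \<omega>))" for \<omega>
      by (simp add: mult.assoc)
    then show ?thesis by simp
  qed
  finally show ?thesis
    using past_future_rate[OF fm k m A A'] by simp
qed

end

section \<open>Moments of sums with degenerate kernels\<close>

text \<open>Bounds the kernel mass that any point receives from any finite set; the factor 2
  accounts for the two sides of the point.\<close>

definition kern_mass :: real where
  "kern_mass = 2 * (\<Sum>k. (max 1 (real k)) powr (- 3 / 2))"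

lemma summable_kern: "summable (\<lambda>k. (max 1 (real k)) powr (- 3 / 2))"
proof -
  have "summable (\<lambda>k. real (Suc k) powr (- 3 / 2))"
    using summable_Suc_iff[of "\<lambda>k. real k powr (- 3 / 2)"] summable_real_powr_iff[of "- 3 / 2"] by simp
  then have "summable (\<lambda>k. (max 1 (real (Suc k))) powr (- 3 / 2))" by (simp add: max_def)
  then show ?thesis by (subst (asm) summable_Suc_iff)
qed

lemma sum_kern_le: "finite S \<Longrightarrow> (\<Sum>s\<in>S. kern s t) \<le> kern_mass"
proof -
  assume S: "finite S"
  let ?f = "\<lambda>k. (max 1 (real k)) powr (- 3 / 2)"
  have "(\<Sum>s\<in>{s\<in>S. t \<le> s}. kern s t) = (\<Sum>k\<in>(\<lambda>s. s - t) ` {s\<in>S. t \<le> s}. ?f k)"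
    by (subst sum.reindex) (auto simp: inj_on_def kern_def of_nat_diff intro!: sum.cong)
  also have "\<dots> \<le> suminf ?f"
    by (rule sum_le_suminf[OF summable_kern]) (use S in auto)
  finally have 1: "(\<Sum>s\<in>{s\<in>S. t \<le> s}. kern s t) \<le> suminf ?f" .
  have "(\<Sum>s\<in>{s\<in>S. \<not> t \<le> s}. kern s t) = (\<Sum>k\<in>(\<lambda>s. t - s) ` {s\<in>S. \<not> t \<le> s}. ?f k)"
    by (subst sum.reindex) (auto simp: inj_on_def kern_def of_nat_diff intro!: sum.cong)
  also have "\<dots> \<le> suminf ?f"
    by (rule sum_le_suminf[OF summable_kern]) (use S in auto)
  finally have 2: "(\<Sum>s\<in>{s\<in>S. \<not> t \<le> s}. kern s t) \<le> suminf ?f" .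
  have "(\<Sum>s\<in>S. kern s t) = (\<Sum>s\<in>{s\<in>S. t \<le> s}. kern s t) + (\<Sum>s\<in>{s\<in>S. \<not> t \<le> s}. kern s t)"
    by (subst sum.union_disjoint[symmetric]) (use S in \<open>auto intro!: sum.cong\<close>)
  with 1 2 show ?thesis by (simp add: kern_mass_def)
qed

lemma kern_mass_pos: "0 < kern_mass"
  using sum_kern_le[of "{0}" 0] by simp

lemma sum_insert_le:
  fixes f :: "'b \<Rightarrow> real"
  assumes "finite R" "\<And>x. 0 \<le> f x"
  shows "sum f (insert a R) \<le> f a + sum f R"
  using assms by (cases "a \<in> R") (auto simp: insert_absorb)

text \<open>Either position 4 or position 3 can be summed out before position 2, each against its nearest
  neighbour; the other two positions remain free.\<close>

lemma sum4_le:
  fixes e :: "nat \<Rightarrow> nat \<Rightarrow> nat \<Rightarrow> nat \<Rightarrow> real"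
  assumes S: "finite S" and R: "finite R" "card R \<le> 1" and C: "0 \<le> C"
    and b2: "\<And>a b c d. a \<in> S \<Longrightarrow> b \<in> S \<Longrightarrow> c \<in> S \<Longrightarrow> d \<in> S \<Longrightarrow>
       \<bar>e a b c d\<bar> \<le> C * (\<Sum>s\<in>{a, c, d} \<union> R. kern b s)\<^sup>2"
    and b3: "\<And>a b c d. a \<in> S \<Longrightarrow> b \<in> S \<Longrightarrow> c \<in> S \<Longrightarrow> d \<in> S \<Longrightarrow>
       \<bar>e a b c d\<bar> \<le> C * (\<Sum>s\<in>{a, b, d} \<union> R. kern c s)\<^sup>2"
    and b4: "\<And>a b c d. a \<in> S \<Longrightarrow> b \<in> S \<Longrightarrow> c \<in> S \<Longrightarrow> d \<in> S \<Longrightarrow>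
       \<bar>e a b c d\<bar> \<le> C * (\<Sum>s\<in>{a, b, c} \<union> R. kern d s)\<^sup>2"
  shows "(\<Sum>a\<in>S. \<Sum>b\<in>S. \<Sum>c\<in>S. \<Sum>d\<in>S. \<bar>e a b c d\<bar>) \<le> 32 * kern_mass\<^sup>2 * C * (real (card S))\<^sup>2"
proof -
  \<comment> \<open>\<open>R\<close> holds at most one fixed index outside the summation: the common
    second argument in \<open>fourth_moment_sum\<close>, nothing in
    \<open>second_moment_pair_sum\<close>.\<close>
  define r where "r x = (\<Sum>s\<in>R. kern x s)" for x
  note k0 = less_imp_le[OF kern_pos]
  have r0: "0 \<le> r x" for x unfolding r_def by (intro sum_nonneg k0)
  \<comment> \<open>The term \<open>kern b d\<close> is left out, so that this weight does not
    depend on d and survives the summation over d.\<close>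
  define V2 where "V2 a b c = kern b a + kern b c + r b" for a b c
  define V3 where "V3 a b c d = kern c a + kern c b + kern c d + r c" for a b c d
  define V4 where "V4 a b c d = kern d a + kern d b + kern d c + r d" for a b c d
  have set3: "(\<Sum>s\<in>{x, y, z} \<union> R. kern t s) \<le> kern t x + kern t y + kern t z + r t" for t x y z
  proof -
    have "(\<Sum>s\<in>{x, y, z} \<union> R. kern t s) \<le> kern t x + (kern t y + (kern t z + r t))"
      unfolding r_def insert_is_Un[symmetric] Un_insert_left Un_empty_left
      by (intro order_trans[OF sum_insert_le] add_left_mono) (auto simp: R k0)
    then show ?thesis by simp
  qed
  have s0: "0 \<le> (\<Sum>s\<in>A. kern t s)" for t A by (intro sum_nonneg k0)
  \<comment> \<open>A quantity below both C u^2 and C v^2 is below C u v. Two positions are thus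
    summed out with one kernel factor each, although each bound alone carries a square.\<close>
  have geo: "x \<le> C * u * v" if "x \<le> C * u\<^sup>2" "x \<le> C * v\<^sup>2" "0 \<le> u" "0 \<le> v" for x u v
  proof (cases "u \<le> v")
    case True
    then have "C * u\<^sup>2 \<le> C * (u * v)" using that C by (intro mult_left_mono) (auto simp: power2_eq_square intro: mult_left_mono)
    then show ?thesis using that by (simp add: mult.assoc)
  next
    case False
    then have "C * v\<^sup>2 \<le> C * (u * v)" using that C by (intro mult_left_mono) (auto simp: power2_eq_square intro: mult_right_mono)
    then show ?thesis using that by (simp add: mult.assoc)
  qed
  have V0: "0 \<le> V2 a b c" "0 \<le> V3 a b c d" "0 \<le> V4 a b c d" for a b c d
    by (auto simp: V2_def V3_def V4_def intro!: add_nonneg_nonneg k0 r0)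
  have pt: "\<bar>e a b c d\<bar> \<le> 2 * C * (V2 a b c * V4 a b c d + kern b d * V3 a b c d)"
    if "a \<in> S" "b \<in> S" "c \<in> S" "d \<in> S" for a b c d
  proof -
    let ?s2 = "\<Sum>s\<in>{a, c, d} \<union> R. kern b s" and ?s3 = "\<Sum>s\<in>{a, b, d} \<union> R. kern c s"
      and ?s4 = "\<Sum>s\<in>{a, b, c} \<union> R. kern d s"
    have s2: "?s2 \<le> V2 a b c + kern b d" using set3[of b a c d] by (simp add: V2_def)
    have s3: "?s3 \<le> V3 a b c d" using set3[of c a b d] by (simp add: V3_def)
    have s4: "?s4 \<le> V4 a b c d" using set3[of d a b c] by (simp add: V4_def)
    show ?thesis
    \<comment> \<open>If b is held mainly by a, c or \<open>R\<close>, then d is summed against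
      \<open>V4\<close> and afterwards b against \<open>V2\<close>, leaving a and c free. Otherwise
      b is held by d: c is summed against \<open>V3\<close> and b against d, leaving a and d free.
      The factor 2 comes from bounding \<open>V2 + kern b d\<close> by twice the larger.\<close>
    proof (cases "kern b d \<le> V2 a b c")
      case True
      have "\<bar>e a b c d\<bar> \<le> C * ?s2 * ?s4" by (rule geo[OF b2[OF that] b4[OF that] s0 s0])
      also have "\<dots> \<le> C * (2 * V2 a b c) * V4 a b c d"
        using s2 s4 True C V0 s0 by (intro mult_mono mult_left_mono) auto
      also have "\<dots> = 2 * C * (V2 a b c * V4 a b c d)" by simp
      also have "\<dots> \<le> 2 * C * (V2 a b c * V4 a b c d + kern b d * V3 a b c d)"
        using C V0 k0 by (intro mult_left_mono) auto
      finally show ?thesis .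
    next
      case False
      have "\<bar>e a b c d\<bar> \<le> C * ?s2 * ?s3" by (rule geo[OF b2[OF that] b3[OF that] s0 s0])
      also have "\<dots> \<le> C * (2 * kern b d) * V3 a b c d"
        using s2 s3 False C V0 s0 k0 by (intro mult_mono mult_left_mono) auto
      also have "\<dots> = 2 * C * (kern b d * V3 a b c d)" by simp
      also have "\<dots> \<le> 2 * C * (V2 a b c * V4 a b c d + kern b d * V3 a b c d)"
        using C V0 k0 by (intro mult_left_mono) auto
      finally show ?thesis .
    qed
  qed
  let ?n = "real (card S)" and ?k = kern_mass
  note sk = sum_kern_le[OF S]
  have kp: "0 \<le> ?k" using kern_mass_pos by simp
  have rs: "(\<Sum>x\<in>S. r x) \<le> ?k"
  proof -
    have "(\<Sum>x\<in>S. r x) = (\<Sum>s\<in>R. \<Sum>x\<in>S. kern x s)" unfolding r_def by (rule sum.swap)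
    also have "\<dots> \<le> (\<Sum>s\<in>R. ?k)" by (intro sum_mono sk)
    also have "\<dots> \<le> 1 * ?k" unfolding sum_constant using R kp by (intro mult_right_mono) auto
    finally show ?thesis by simp
  qed
  have s4: "(\<Sum>d\<in>S. V4 a b c d) \<le> 4 * ?k" for a b c
    unfolding V4_def sum.distrib using sk[of a] sk[of b] sk[of c] rs by linarith
  have s3: "(\<Sum>c\<in>S. V3 a b c d) \<le> 4 * ?k" for a b d
    unfolding V3_def sum.distrib using sk[of a] sk[of b] sk[of d] rs by linarith
  have s2: "(\<Sum>b\<in>S. V2 a b c) \<le> 3 * ?k" for a c
    unfolding V2_def sum.distrib using sk[of a] sk[of c] rs by linarith
  have "(\<Sum>a\<in>S. \<Sum>b\<in>S. \<Sum>c\<in>S. \<Sum>d\<in>S. V2 a b c * V4 a b c d) = (\<Sum>a\<in>S. \<Sum>b\<in>S. \<Sum>c\<in>S. V2 a b c * (\<Sum>d\<in>S. V4 a b c d))"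
    by (simp add: sum_distrib_left)
  also have "\<dots> \<le> (\<Sum>a\<in>S. \<Sum>b\<in>S. \<Sum>c\<in>S. V2 a b c * (4 * ?k))"
    by (intro sum_mono mult_left_mono s4 V0)
  also have "\<dots> = (\<Sum>a\<in>S. \<Sum>c\<in>S. (\<Sum>b\<in>S. V2 a b c) * (4 * ?k))"
    by (rule sum.cong[OF refl], subst sum.swap, simp add: sum_distrib_right)
  also have "\<dots> \<le> (\<Sum>a\<in>S. \<Sum>c\<in>S. (3 * ?k) * (4 * ?k))"
    using kp by (intro sum_mono mult_right_mono s2) auto
  also have "\<dots> = 12 * ?k\<^sup>2 * ?n\<^sup>2" by (simp add: power2_eq_square)
  finally have I: "(\<Sum>a\<in>S. \<Sum>b\<in>S. \<Sum>c\<in>S. \<Sum>d\<in>S. V2 a b c * V4 a b c d) \<le> 12 * ?k\<^sup>2 * ?n\<^sup>2" .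
  have "(\<Sum>a\<in>S. \<Sum>b\<in>S. \<Sum>c\<in>S. \<Sum>d\<in>S. kern b d * V3 a b c d) = (\<Sum>a\<in>S. \<Sum>b\<in>S. \<Sum>d\<in>S. kern b d * (\<Sum>c\<in>S. V3 a b c d))"
    by (rule sum.cong[OF refl], rule sum.cong[OF refl], subst sum.swap, simp add: sum_distrib_left)
  also have "\<dots> \<le> (\<Sum>a\<in>S. \<Sum>b\<in>S. \<Sum>d\<in>S. kern b d * (4 * ?k))"
    by (intro sum_mono mult_left_mono s3 k0)
  also have "\<dots> = (\<Sum>a\<in>S. \<Sum>d\<in>S. (\<Sum>b\<in>S. kern b d) * (4 * ?k))"
    by (rule sum.cong[OF refl], subst sum.swap, simp add: sum_distrib_right)
  also have "\<dots> \<le> (\<Sum>a\<in>S. \<Sum>d\<in>S. ?k * (4 * ?k))"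
    using kp by (intro sum_mono mult_right_mono sk) auto
  also have "\<dots> = 4 * ?k\<^sup>2 * ?n\<^sup>2" by (simp add: power2_eq_square)
  finally have II: "(\<Sum>a\<in>S. \<Sum>b\<in>S. \<Sum>c\<in>S. \<Sum>d\<in>S. kern b d * V3 a b c d) \<le> 4 * ?k\<^sup>2 * ?n\<^sup>2" .
  have "(\<Sum>a\<in>S. \<Sum>b\<in>S. \<Sum>c\<in>S. \<Sum>d\<in>S. \<bar>e a b c d\<bar>)
     \<le> (\<Sum>a\<in>S. \<Sum>b\<in>S. \<Sum>c\<in>S. \<Sum>d\<in>S. 2 * C * (V2 a b c * V4 a b c d + kern b d * V3 a b c d))"
    by (intro sum_mono pt)
  also have "\<dots> = 2 * C * ((\<Sum>a\<in>S. \<Sum>b\<in>S. \<Sum>c\<in>S. \<Sum>d\<in>S. V2 a b c * V4 a b c d) + (\<Sum>a\<in>S. \<Sum>b\<in>S. \<Sum>c\<in>S. \<Sum>d\<in>S. kern b d * V3 a b c d))"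
    by (simp add: sum_distrib_left[symmetric] sum.distrib)
  also have "\<dots> \<le> 2 * C * (12 * ?k\<^sup>2 * ?n\<^sup>2 + 4 * ?k\<^sup>2 * ?n\<^sup>2)"
    using I II C by (intro mult_left_mono add_mono) auto
  finally show ?thesis by (simp add: algebra_simps)
qed

lemma power4_sum_le:
  fixes f :: "'b \<Rightarrow> real"
  shows "(\<Sum>i\<in>I. f i) ^ 4 \<le> real (card I) ^ 3 * (\<Sum>i\<in>I. f i ^ 4)"
proof -
  let ?n = "real (card I)"
  have "((\<Sum>i\<in>I. f i)\<^sup>2)\<^sup>2 \<le> ((\<Sum>i\<in>I. (f i)\<^sup>2) * ?n)\<^sup>2"
    by (intro power_mono sum_squared_le_sum_of_squares) auto
  also have "\<dots> = (\<Sum>i\<in>I. (f i)\<^sup>2)\<^sup>2 * ?n\<^sup>2" by (simp add: power_mult_distrib)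
  also have "\<dots> \<le> ((\<Sum>i\<in>I. ((f i)\<^sup>2)\<^sup>2) * ?n) * ?n\<^sup>2"
    by (intro mult_right_mono sum_squared_le_sum_of_squares) auto
  finally show ?thesis by (simp add: power2_eq_square power3_eq_cube power4_eq_xxxx algebra_simps)
qed

lemma sum_power4:
  fixes f :: "'b \<Rightarrow> real"
  shows "(\<Sum>i\<in>I. f i) ^ 4 = (\<Sum>a\<in>I. \<Sum>b\<in>I. \<Sum>c\<in>I. \<Sum>d\<in>I. f a * f b * f c * f d)"
proof -
  have "(\<Sum>i\<in>I. f i) ^ 4 = (\<Sum>i\<in>I. f i) * ((\<Sum>i\<in>I. f i) * ((\<Sum>i\<in>I. f i) * (\<Sum>i\<in>I. f i)))"
    by (simp add: power4_eq_xxxx mult.assoc)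
  also have "\<dots> = (\<Sum>a\<in>I. \<Sum>b\<in>I. \<Sum>c\<in>I. \<Sum>d\<in>I. f a * (f b * (f c * f d)))"
    by (simp only: sum_product sum_distrib_left sum_distrib_right)
       (simp only: sum_product[symmetric] sum_distrib_left[symmetric] sum_distrib_right[symmetric])
  finally show ?thesis by (simp add: mult.assoc)
qed

section \<open>Moment bounds for sums over the process\<close>

context mixing_process
begin

lemma bounded_moments_nonneg: "bounded_moments K g \<Longrightarrow> 0 \<le> K"
  using bounded_momentsD(3)[of K g 1 1] by (rule order_trans[rotated]) (auto intro: integral_nonneg_AE)

text \<open>The order is the square of the number of terms, as for independent centred variables.
  The fixed index r enters \<open>sum4_le\<close> as the extra point in R.\<close>

lemma fourth_moment_sum:
  assumes g: "bounded_moments K g" and dg: "degenerate g" and S: "finite S" "S \<subseteq> {1..}" and r: "r \<ge> 1"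
  shows "integrable M (\<lambda>\<omega>. (\<Sum>s\<in>S. g (X s \<omega>) (X r \<omega>)) ^ 4)"
    and "expectation (\<lambda>\<omega>. (\<Sum>s\<in>S. g (X s \<omega>) (X r \<omega>)) ^ 4)
      \<le> 32 * kern_mass\<^sup>2 * (1 + 6 * B + 8 * K) * (real (card S))\<^sup>2"
proof -
  let ?f = "\<lambda>a b c d \<omega>. g (X a \<omega>) (X r \<omega>) * g (X b \<omega>) (X r \<omega>) * g (X c \<omega>) (X r \<omega>) * g (X d \<omega>) (X r \<omega>)"
  have ge: "s \<ge> 1" if "s \<in> S" for s using that S by auto
  have int: "integrable M (?f a b c d)" if "a \<in> S" "b \<in> S" "c \<in> S" "d \<in> S" for a b c d
    by (rule product_integrable(1)[OF g g g g]) (use that ge r in auto)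
  show "integrable M (\<lambda>\<omega>. (\<Sum>s\<in>S. g (X s \<omega>) (X r \<omega>)) ^ 4)"
    unfolding sum_power4 by (intro Bochner_Integration.integrable_sum int)
  have C: "0 \<le> 1 + 6 * B + 8 * K" using B bounded_moments_nonneg[OF g] by simp
  have "expectation (\<lambda>\<omega>. (\<Sum>s\<in>S. g (X s \<omega>) (X r \<omega>)) ^ 4)
      = (\<Sum>a\<in>S. \<Sum>b\<in>S. \<Sum>c\<in>S. \<Sum>d\<in>S. expectation (?f a b c d))"
    unfolding sum_power4
    by (subst Bochner_Integration.integral_sum, intro Bochner_Integration.integrable_sum int, assumption+, rule sum.cong[OF refl])+
       (rule refl)
  also have "\<dots> \<le> (\<Sum>a\<in>S. \<Sum>b\<in>S. \<Sum>c\<in>S. \<Sum>d\<in>S. \<bar>expectation (?f a b c d)\<bar>)"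
    by (intro sum_mono) simp
  also have "\<dots> \<le> 32 * kern_mass\<^sup>2 * (1 + 6 * B + 8 * K) * (real (card S))\<^sup>2"
  proof (rule sum4_le[where R="{r}"])
    fix a b c d assume abcd: "a \<in> S" "b \<in> S" "c \<in> S" "d \<in> S"
    note ges = abcd[THEN ge]
    \<comment> \<open>Permuting the factors brings the index to be isolated into the leading kernel,
      where \<open>product_le_kern\<close> expects it.\<close>
    have 2: "?f a b c d = ?f b a c d" by (auto simp: fun_eq_iff)
    have 3: "?f a b c d = ?f c a b d" by (auto simp: fun_eq_iff)
    have 4: "?f a b c d = ?f d a b c" by (auto simp: fun_eq_iff)
    show "\<bar>expectation (?f a b c d)\<bar> \<le> (1 + 6 * B + 8 * K) * (\<Sum>s\<in>{a, c, d} \<union> {r}. kern b s)\<^sup>2"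
      unfolding 2 by (rule product_le_kern[OF g g g g dg ges(2)]) (use ges r in auto)
    show "\<bar>expectation (?f a b c d)\<bar> \<le> (1 + 6 * B + 8 * K) * (\<Sum>s\<in>{a, b, d} \<union> {r}. kern c s)\<^sup>2"
      unfolding 3 by (rule product_le_kern[OF g g g g dg ges(3)]) (use ges r in auto)
    show "\<bar>expectation (?f a b c d)\<bar> \<le> (1 + 6 * B + 8 * K) * (\<Sum>s\<in>{a, b, c} \<union> {r}. kern d s)\<^sup>2"
      unfolding 4 by (rule product_le_kern[OF g g g g dg ges(4)]) (use ges r in auto)
  qed (use S C in auto)
  finally show "expectation (\<lambda>\<omega>. (\<Sum>s\<in>S. g (X s \<omega>) (X r \<omega>)) ^ 4)
      \<le> 32 * kern_mass\<^sup>2 * (1 + 6 * B + 8 * K) * (real (card S))\<^sup>2" .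
qed

text \<open>Cancellation is used in the sum over S only; the sum over A is bounded by convexity of
  the fourth power, which costs its full fourth power. This loss is affordable because the
  degenerate part carries the smaller normalisation.\<close>

lemma fourth_moment_double_sum:
  assumes g: "bounded_moments K g" and dg: "degenerate g" and S: "finite S" "S \<subseteq> {1..}"
    and A: "finite A" "A \<subseteq> {1..}"
  shows "integrable M (\<lambda>\<omega>. (\<Sum>r\<in>A. \<Sum>s\<in>S. g (X s \<omega>) (X r \<omega>)) ^ 4)"
    and "expectation (\<lambda>\<omega>. (\<Sum>r\<in>A. \<Sum>s\<in>S. g (X s \<omega>) (X r \<omega>)) ^ 4)
      \<le> 32 * kern_mass\<^sup>2 * (1 + 6 * B + 8 * K) * real (card A) ^ 4 * (real (card S))\<^sup>2"
proof -
  let ?T = "\<lambda>r \<omega>. \<Sum>s\<in>S. g (X s \<omega>) (X r \<omega>)" and ?a = "real (card A)"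
  let ?C = "32 * kern_mass\<^sup>2 * (1 + 6 * B + 8 * K) * (real (card S))\<^sup>2"
  have ge: "s \<ge> 1" if "s \<in> S \<union> A" for s using that S A by auto
  have m: "(\<lambda>\<omega>. g (X s \<omega>) (X r \<omega>)) \<in> borel_measurable M" if "s \<in> S" "r \<in> A" for s r
    by (rule bounded_moments_comp[OF g X_meas X_meas]) (use that ge in auto)
  note fm = fourth_moment_sum[OF g dg S]
  have i: "integrable M (\<lambda>\<omega>. ?a ^ 3 * (\<Sum>r\<in>A. ?T r \<omega> ^ 4))"
    using ge by (intro integrable_mult_right Bochner_Integration.integrable_sum fm) auto
  have le: "(\<Sum>r\<in>A. ?T r \<omega>) ^ 4 \<le> ?a ^ 3 * (\<Sum>r\<in>A. ?T r \<omega> ^ 4)" for \<omega>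
    by (rule power4_sum_le)
  show 1: "integrable M (\<lambda>\<omega>. (\<Sum>r\<in>A. ?T r \<omega>) ^ 4)"
  proof (rule Bochner_Integration.integrable_bound[OF i])
    show "(\<lambda>\<omega>. (\<Sum>r\<in>A. ?T r \<omega>) ^ 4) \<in> borel_measurable M"
      by (intro borel_measurable_power borel_measurable_sum m)
    show "AE \<omega> in M. norm ((\<Sum>r\<in>A. ?T r \<omega>) ^ 4) \<le> norm (?a ^ 3 * (\<Sum>r\<in>A. ?T r \<omega> ^ 4))"
    proof (rule AE_I2)
      fix \<omega>
      have "0 \<le> (\<Sum>r\<in>A. ?T r \<omega>) ^ 4" by (simp add: zero_le_even_power)
      then show "norm ((\<Sum>r\<in>A. ?T r \<omega>) ^ 4) \<le> norm (?a ^ 3 * (\<Sum>r\<in>A. ?T r \<omega> ^ 4))"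
        using le[of \<omega>] by simp
    qed
  qed
  have "expectation (\<lambda>\<omega>. (\<Sum>r\<in>A. ?T r \<omega>) ^ 4) \<le> expectation (\<lambda>\<omega>. ?a ^ 3 * (\<Sum>r\<in>A. ?T r \<omega> ^ 4))"
    by (rule integral_mono[OF 1 i le])
  also have "\<dots> = ?a ^ 3 * (\<Sum>r\<in>A. expectation (\<lambda>\<omega>. ?T r \<omega> ^ 4))"
    using ge fm(1) by simp
  also have "\<dots> \<le> ?a ^ 3 * (\<Sum>r\<in>A. ?C)"
    using ge by (intro mult_left_mono sum_mono fm(2)) auto
  also have "\<dots> = 32 * kern_mass\<^sup>2 * (1 + 6 * B + 8 * K) * ?a ^ 4 * (real (card S))\<^sup>2"
    by (simp add: power4_eq_xxxx power3_eq_cube)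
  finally show "expectation (\<lambda>\<omega>. (\<Sum>r\<in>A. ?T r \<omega>) ^ 4) \<le> \<dots>" .
qed

lemma bounded_moments_one: "K \<ge> 1 \<Longrightarrow> bounded_moments K (\<lambda>_ _. 1)"
  by (auto simp: bounded_moments_def prob_space MM.P.prob_space case_prod_beta')

text \<open>Two constant kernels 1 pad the product of two kernels to four, and K >= 1 makes them
  satisfy the moment bound.\<close>

lemma second_moment_pair_sum:
  assumes g: "bounded_moments K g" and dg: "degenerate g" and sym: "\<And>x y. g x y = g y x" and K: "K \<ge> 1"
    and S: "finite S" "S \<subseteq> {1..}" and P: "P \<subseteq> S \<times> S"
  shows "integrable M (\<lambda>\<omega>. (\<Sum>(i, j)\<in>P. g (X i \<omega>) (X j \<omega>))\<^sup>2)"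
    and "expectation (\<lambda>\<omega>. (\<Sum>(i, j)\<in>P. g (X i \<omega>) (X j \<omega>))\<^sup>2)
      \<le> 32 * kern_mass\<^sup>2 * (1 + 6 * B + 8 * K) * (real (card S))\<^sup>2"
proof -
  let ?f = "\<lambda>a b c d \<omega>. g (X a \<omega>) (X b \<omega>) * g (X c \<omega>) (X d \<omega>)"
  have ge: "s \<ge> 1" if "s \<in> S" for s using that S by auto
  note one = bounded_moments_one[OF K]
  have f1: "?f a b c d = (\<lambda>\<omega>. g (X a \<omega>) (X b \<omega>) * g (X c \<omega>) (X d \<omega>) * (\<lambda>_ _. 1) (X a \<omega>) (X a \<omega>) * (\<lambda>_ _. 1) (X a \<omega>) (X a \<omega>))"
    for a b c d by simp
  have int: "integrable M (?f a b c d)" if "a \<in> S" "b \<in> S" "c \<in> S" "d \<in> S" for a b c d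
    unfolding f1 by (rule product_integrable(1)[OF g g one one]) (use that ge in auto)
  have fP: "finite P" using P S finite_subset by blast
  have sq: "(\<Sum>(i, j)\<in>P. g (X i \<omega>) (X j \<omega>))\<^sup>2 = (\<Sum>p\<in>P. \<Sum>q\<in>P. ?f (fst p) (snd p) (fst q) (snd q) \<omega>)" for \<omega>
    by (simp add: power2_eq_square sum_product case_prod_beta')
  have PS: "fst p \<in> S" "snd p \<in> S" if "p \<in> P" for p using that P by auto
  show "integrable M (\<lambda>\<omega>. (\<Sum>(i, j)\<in>P. g (X i \<omega>) (X j \<omega>))\<^sup>2)"
    unfolding sq by (intro Bochner_Integration.integrable_sum int PS)
  have C: "0 \<le> 1 + 6 * B + 8 * K" using B K by simp
  have "expectation (\<lambda>\<omega>. (\<Sum>(i, j)\<in>P. g (X i \<omega>) (X j \<omega>))\<^sup>2)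
      = (\<Sum>p\<in>P. \<Sum>q\<in>P. expectation (?f (fst p) (snd p) (fst q) (snd q)))"
    unfolding sq
    by (subst Bochner_Integration.integral_sum, intro Bochner_Integration.integrable_sum int PS, assumption+, rule sum.cong[OF refl])+
       (rule refl)
  also have "\<dots> \<le> (\<Sum>p\<in>P. \<Sum>q\<in>P. \<bar>expectation (?f (fst p) (snd p) (fst q) (snd q))\<bar>)"
    by (intro sum_mono) simp
  \<comment> \<open>After absolute values have been taken, P can be enlarged to the full
    square.\<close>
  also have "\<dots> \<le> (\<Sum>p\<in>S \<times> S. \<Sum>q\<in>S \<times> S. \<bar>expectation (?f (fst p) (snd p) (fst q) (snd q))\<bar>)"
    by (intro order_trans[OF sum_mono[OF sum_mono2] sum_mono2] sum_nonneg) (use S P in auto)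
  also have "\<dots> = (\<Sum>a\<in>S. \<Sum>b\<in>S. \<Sum>c\<in>S. \<Sum>d\<in>S. \<bar>expectation (?f a b c d)\<bar>)"
  proof -
    have cp: "(\<Sum>p\<in>S \<times> S. F (fst p) (snd p)) = (\<Sum>a\<in>S. \<Sum>b\<in>S. F a b)" for F :: "nat \<Rightarrow> nat \<Rightarrow> real"
      by (simp add: sum.cartesian_product case_prod_beta')
    show ?thesis
      by (subst cp[of "\<lambda>a b. \<Sum>q\<in>S \<times> S. \<bar>expectation (?f a b (fst q) (snd q))\<bar>"])
         (intro sum.cong refl cp[of "\<lambda>c d. \<bar>expectation (?f _ _ c d)\<bar>"])
  qed
  also have "\<dots> \<le> 32 * kern_mass\<^sup>2 * (1 + 6 * B + 8 * K) * (real (card S))\<^sup>2"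
  proof (rule sum4_le[where R="{}"])
    fix a b c d assume abcd: "a \<in> S" "b \<in> S" "c \<in> S" "d \<in> S"
    note ges = abcd[THEN ge]
    \<comment> \<open>The isolated index may be a second argument; symmetry of g moves it to the
      argument that degeneracy integrates out.\<close>
    have 2: "?f a b c d = ?f b a c d" by (auto simp: fun_eq_iff sym[of "X b _"])
    have 3: "?f a b c d = ?f c d a b" by (auto simp: fun_eq_iff)
    have 4: "?f a b c d = ?f d c a b" by (auto simp: fun_eq_iff sym[of "X d _"])
    show "\<bar>expectation (?f a b c d)\<bar> \<le> (1 + 6 * B + 8 * K) * (\<Sum>s\<in>{a, c, d} \<union> {}. kern b s)\<^sup>2"
      unfolding 2 f1[of b a c d]
      using product_le_kern[OF g g one one dg ges(2), of a c d a a a a "{a, c, d}"] ges by simp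
    show "\<bar>expectation (?f a b c d)\<bar> \<le> (1 + 6 * B + 8 * K) * (\<Sum>s\<in>{a, b, d} \<union> {}. kern c s)\<^sup>2"
      unfolding 3 f1[of c d a b]
      using product_le_kern[OF g g one one dg ges(3), of d a b a a a a "{a, b, d}"] ges by simp
    show "\<bar>expectation (?f a b c d)\<bar> \<le> (1 + 6 * B + 8 * K) * (\<Sum>s\<in>{a, b, c} \<union> {}. kern d s)\<^sup>2"
      unfolding 4 f1[of d c a b]
      using product_le_kern[OF g g one one dg ges(4), of c a b a a a a "{a, b, c}"] ges by simp
  qed (use S C in auto)
  finally show "expectation (\<lambda>\<omega>. (\<Sum>(i, j)\<in>P. g (X i \<omega>) (X j \<omega>))\<^sup>2)
      \<le> 32 * kern_mass\<^sup>2 * (1 + 6 * B + 8 * K) * (real (card S))\<^sup>2" .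
qed

end

section \<open>Conditional variance of the bootstrapped statistic\<close>

definition avg :: "nat \<Rightarrow> (nat \<Rightarrow> real) \<Rightarrow> real" where
  "avg n f = (\<Sum>j=1..n. f j) / real n"

lemma avg_add: "avg n (\<lambda>j. f j + g j) = avg n f + avg n g"
  and avg_diff: "avg n (\<lambda>j. f j - g j) = avg n f - avg n g"
  and avg_cmult: "avg n (\<lambda>j. c * f j) = c * avg n f"
  and avg_const: "n \<ge> 1 \<Longrightarrow> avg n (\<lambda>_. c) = c"
  by (auto simp: avg_def sum.distrib sum_subtractf sum_distrib_left add_divide_distrib diff_divide_distrib)

lemma avg_mono: "(\<And>j. f j \<le> g j) \<Longrightarrow> avg n f \<le> avg n g"
  by (auto simp: avg_def intro!: divide_right_mono sum_mono)

lemma avg_nonneg: "(\<And>j. 0 \<le> f j) \<Longrightarrow> 0 \<le> avg n f"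
  by (auto simp: avg_def intro!: divide_nonneg_nonneg sum_nonneg)

lemma avg_square_le: "(avg n f)\<^sup>2 \<le> avg n (\<lambda>j. (f j)\<^sup>2)"
proof (cases "n = 0")
  case False
  have "(avg n f)\<^sup>2 = (\<Sum>j=1..n. f j)\<^sup>2 / (real n)\<^sup>2" by (simp add: avg_def power_divide)
  also have "\<dots> \<le> ((\<Sum>j=1..n. (f j)\<^sup>2) * real n) / (real n)\<^sup>2"
    using sum_squared_le_sum_of_squares[of f "{1..n}"] by (intro divide_right_mono) auto
  also have "\<dots> = avg n (\<lambda>j. (f j)\<^sup>2)" using False by (simp add: avg_def power2_eq_square)
  finally show ?thesis .
qed (simp add: avg_def)

lemma avg_swap: "avg n (\<lambda>j. avg n (\<lambda>k. f j k)) = avg n (\<lambda>k. avg n (\<lambda>j. f j k))"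
  by (simp add: avg_def sum_divide_distrib[symmetric] sum.swap[of f])

abbreviation starts :: "nat \<Rightarrow> nat \<Rightarrow> (nat \<Rightarrow> nat) pmf" where
  "starts n b \<equiv> Pi_pmf {..<b} 0 (\<lambda>_. pmf_of_set {1..n})"

definition JE :: "nat \<Rightarrow> nat \<Rightarrow> ((nat \<Rightarrow> nat) \<Rightarrow> real) \<Rightarrow> real" where
  "JE n b f = measure_pmf.expectation (starts n b) f"

lemma finite_starts: "n \<ge> 1 \<Longrightarrow> finite (set_pmf (starts n b))"
  by (subst set_Pi_pmf) (auto intro!: finite_PiE_dflt)

lemma starts_integrable: "n \<ge> 1 \<Longrightarrow> integrable (measure_pmf (starts n b)) (f :: _ \<Rightarrow> real)"
  by (rule integrable_measure_pmf_finite[OF finite_starts])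

lemma JE_add: "n \<ge> 1 \<Longrightarrow> JE n b (\<lambda>J. f J + g J) = JE n b f + JE n b g"
  unfolding JE_def by (rule Bochner_Integration.integral_add; rule starts_integrable)

lemma JE_sum: "n \<ge> 1 \<Longrightarrow> JE n b (\<lambda>J. \<Sum>i\<in>I. f i J) = (\<Sum>i\<in>I. JE n b (f i))"
  unfolding JE_def by (rule Bochner_Integration.integral_sum; rule starts_integrable)

lemma JE_cmult: "JE n b (\<lambda>J. c * f J) = c * JE n b f"
  unfolding JE_def by simp

lemma JE_const [simp]: "JE n b (\<lambda>_. c) = c"
  unfolding JE_def by simp

lemma JE_mono: "n \<ge> 1 \<Longrightarrow> (\<And>J. f J \<le> g J) \<Longrightarrow> JE n b f \<le> JE n b g"
  unfolding JE_def by (rule integral_mono; (rule starts_integrable)?)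

text \<open>Conditioning on the start of the last block, which drives the inductions over the number
  of blocks.\<close>

lemma JE_Suc:
  assumes n: "n \<ge> 1"
  shows "JE n (Suc b) f = avg n (\<lambda>k. JE n b (\<lambda>J. f (J(b := k))))"
proof -
  have "starts n (Suc b) = pmf_of_set {1..n} \<bind> (\<lambda>k. map_pmf (\<lambda>J. J(b := k)) (starts n b))"
    unfolding lessThan_Suc by (subst Pi_pmf_insert') (auto simp: map_pmf_def)
  then have "JE n (Suc b) f = (\<Sum>k\<in>{1..n}. pmf (pmf_of_set {1..n}) k *\<^sub>R
      measure_pmf.expectation (map_pmf (\<lambda>J. J(b := k)) (starts n b)) f)"
    unfolding JE_def using n finite_starts[OF n, of b] by (simp only:) (rule pmf_expectation_bind, auto)
  also have "\<dots> = avg n (\<lambda>k. JE n b (\<lambda>J. f (J(b := k))))"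
    using n unfolding avg_def JE_def sum_divide_distrib by (intro sum.cong) auto
  finally show ?thesis .
qed

lemma JE_sum_centered:
  assumes n: "n \<ge> 1" and \<phi>: "avg n \<phi> = 0"
  shows "JE n b (\<lambda>J. \<Sum>a<b. \<phi> (J a)) = 0"
    and "JE n b (\<lambda>J. (\<Sum>a<b. \<phi> (J a))\<^sup>2) = real b * avg n (\<lambda>j. (\<phi> j)\<^sup>2)"
proof (induction b)
  case 0
  { case 1 then show ?case by simp }
  { case 2 then show ?case by simp }
next
  case (Suc b)
  have e: "(\<Sum>a<Suc b. \<phi> ((J(b := k)) a)) = (\<Sum>a<b. \<phi> (J a)) + \<phi> k" for J k
    by (simp add: sum.lessThan_Suc)
  { case 1
    have "JE n (Suc b) (\<lambda>J. \<Sum>a<Suc b. \<phi> (J a)) = avg n (\<lambda>k. JE n b (\<lambda>J. \<Sum>a<b. \<phi> (J a)) + \<phi> k)"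
      unfolding JE_Suc[OF n] e by (simp add: JE_add[OF n])
    then show ?case using Suc(1) \<phi> by simp }
  { case 2
    have "JE n (Suc b) (\<lambda>J. (\<Sum>a<Suc b. \<phi> (J a))\<^sup>2)
      = avg n (\<lambda>k. JE n b (\<lambda>J. (\<Sum>a<b. \<phi> (J a))\<^sup>2) + 2 * \<phi> k * JE n b (\<lambda>J. \<Sum>a<b. \<phi> (J a)) + (\<phi> k)\<^sup>2)"
    proof -
      have "JE n b (\<lambda>J. ((\<Sum>a<b. \<phi> (J a)) + \<phi> k)\<^sup>2)
        = JE n b (\<lambda>J. (\<Sum>a<b. \<phi> (J a))\<^sup>2) + 2 * \<phi> k * JE n b (\<lambda>J. \<Sum>a<b. \<phi> (J a)) + (\<phi> k)\<^sup>2" for k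
      proof -
        have "(\<lambda>J. ((\<Sum>a<b. \<phi> (J a)) + \<phi> k)\<^sup>2) = (\<lambda>J. (\<Sum>a<b. \<phi> (J a))\<^sup>2 + (2 * \<phi> k) * (\<Sum>a<b. \<phi> (J a)) + (\<phi> k)\<^sup>2)"
          by (auto simp: power2_sum)
        then show ?thesis by (simp only: JE_add[OF n] JE_cmult) simp
      qed
      then show ?thesis unfolding JE_Suc[OF n] e by simp
    qed
    then show ?case using Suc n by (simp add: avg_add avg_const algebra_simps) }
qed

text \<open>Adding a block adds a sum over its pairs with earlier blocks. By centring in the second
  argument this increment is orthogonal to what was there; by centring in the first its square
  averages to b times the mean of \<psi>^2. Summing the increments gives b (b - 1) / 2 times that
  mean, hence at most b^2.\<close>

lemma JE_pairs_centered:
  assumes n: "n \<ge> 1" and \<psi>1: "\<And>k. avg n (\<lambda>j. \<psi> j k) = 0" and \<psi>2: "\<And>j. avg n (\<lambda>k. \<psi> j k) = 0"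
  shows "JE n b (\<lambda>J. (\<Sum>c<b. \<Sum>a<c. \<psi> (J a) (J c))\<^sup>2) \<le> (real b)\<^sup>2 * avg n (\<lambda>k. avg n (\<lambda>j. (\<psi> j k)\<^sup>2))"
proof (induction b)
  case (Suc b)
  define T where "T J = (\<Sum>c<b. \<Sum>a<c. \<psi> (J a) (J c))" for J :: "nat \<Rightarrow> nat"
  define s where "s = avg n (\<lambda>k. avg n (\<lambda>j. (\<psi> j k)\<^sup>2))"
  have s0: "0 \<le> s" unfolding s_def by (intro avg_nonneg) simp
  have e: "(\<Sum>c<Suc b. \<Sum>a<c. \<psi> ((J(b := k)) a) ((J(b := k)) c)) = T J + (\<Sum>a<b. \<psi> (J a) k)" for J k
    unfolding T_def by (simp add: sum.lessThan_Suc)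
  have q: "JE n b (\<lambda>J. (T J + (\<Sum>a<b. \<psi> (J a) k))\<^sup>2)
     = JE n b (\<lambda>J. (T J)\<^sup>2) + 2 * JE n b (\<lambda>J. T J * (\<Sum>a<b. \<psi> (J a) k)) + real b * avg n (\<lambda>j. (\<psi> j k)\<^sup>2)" for k
  proof -
    have "(\<lambda>J. (T J + (\<Sum>a<b. \<psi> (J a) k))\<^sup>2) = (\<lambda>J. (T J)\<^sup>2 + 2 * (T J * (\<Sum>a<b. \<psi> (J a) k)) + (\<Sum>a<b. \<psi> (J a) k)\<^sup>2)"
      by (auto simp: power2_sum)
    then show ?thesis by (simp only: JE_add[OF n] JE_cmult JE_sum_centered(2)[OF n \<psi>1])
  qed
  \<comment> \<open>Averaging over the new start k is moved inside, where it meets \<psi>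
    alone.\<close>
  have cross: "avg n (\<lambda>k. JE n b (\<lambda>J. T J * (\<Sum>a<b. \<psi> (J a) k))) = 0"
  proof -
    have "avg n (\<lambda>k. JE n b (\<lambda>J. T J * (\<Sum>a<b. \<psi> (J a) k))) = JE n b (\<lambda>J. avg n (\<lambda>k. T J * (\<Sum>a<b. \<psi> (J a) k)))"
      unfolding avg_def divide_inverse mult.commute[of _ "inverse (real n)"] by (simp only: JE_cmult JE_sum[OF n])
    also have "\<dots> = JE n b (\<lambda>J. T J * (\<Sum>a<b. avg n (\<lambda>k. \<psi> (J a) k)))"
      unfolding avg_cmult unfolding avg_def sum_divide_distrib by (subst sum.swap) simp
    finally show ?thesis by (simp add: \<psi>2)
  qed
  have "JE n (Suc b) (\<lambda>J. (\<Sum>c<Suc b. \<Sum>a<c. \<psi> (J a) (J c))\<^sup>2) = JE n b (\<lambda>J. (T J)\<^sup>2) + real b * s"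
    unfolding JE_Suc[OF n] e q s_def avg_add avg_cmult cross by (simp add: avg_const[OF n])
  also have "\<dots> \<le> (real b)\<^sup>2 * s + real b * s"
    using Suc unfolding T_def s_def by simp
  also have "\<dots> \<le> (real (Suc b))\<^sup>2 * s"
    using s0 by (simp add: power2_eq_square algebra_simps)
  finally show ?case by (simp add: s_def)
qed simp

section \<open>Algebra of sums over increasing pairs\<close>

lemma sum_pairs_sym:
  fixes f :: "nat \<Rightarrow> nat \<Rightarrow> real"
  assumes "\<And>a c. f a c = f c a"
  shows "(\<Sum>a<b. \<Sum>c<b. f a c) = 2 * (\<Sum>c<b. \<Sum>a<c. f a c) + (\<Sum>a<b. f a a)"
proof (induction b)
  case (Suc b)
  have "(\<Sum>c<b. f b c) = (\<Sum>a<b. f a b)" using assms by (intro sum.cong) auto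
  then show ?case using Suc by (simp add: sum.lessThan_Suc sum.distrib)
qed simp

lemma sum_pairs_marginal:
  fixes y :: "nat \<Rightarrow> real"
  shows "(\<Sum>c<b. \<Sum>a<c. y a + y c) = (real b - 1) * (\<Sum>a<b. y a)"
proof (induction b)
  case (Suc b)
  then show ?case by (simp add: sum.lessThan_Suc sum.distrib algebra_simps)
qed simp

lemma sum_pairs_const: "(\<Sum>c<b. \<Sum>a<c. t) = t * (real b * (real b - 1) / 2)"
  by (induction b) (simp_all add: algebra_simps add_divide_distrib diff_divide_distrib)

lemma sum_increasing_pairs:
  fixes f :: "nat \<Rightarrow> nat \<Rightarrow> real"
  shows "(\<Sum>(i, j)\<in>{(i, j). 1 \<le> i \<and> i < j \<and> j \<le> n}. f i j) = (\<Sum>c<n. \<Sum>a<c. f (Suc a) (Suc c))"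
proof -
  have "(\<Sum>c<n. \<Sum>a<c. f (Suc a) (Suc c)) = (\<Sum>(c, a)\<in>Sigma {..<n} (\<lambda>c. {..<c}). f (Suc a) (Suc c))"
    by (rule sum.Sigma) auto
  also have "\<dots> = (\<Sum>(i, j)\<in>{(i, j). 1 \<le> i \<and> i < j \<and> j \<le> n}. f i j)"
    by (rule sum.reindex_bij_witness[of _ "\<lambda>(i, j). (j - 1, i - 1)" "\<lambda>(c, a). (Suc a, Suc c)"]) auto
  finally show ?thesis ..
qed

lemma U_stat_decomposition:
  assumes N: "N \<ge> 2" and h: "\<And>x y. h x y = \<theta> + h1 x + h1 y + h2 x y"
  shows "U_stat h N x = \<theta> + 2 / real N * (\<Sum>i=1..N. h1 (x i)) + U_stat h2 N x"
proof -
  have "(\<Sum>(i, j)\<in>{(i, j). 1 \<le> i \<and> i < j \<and> j \<le> N}. h (x i) (x j))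
     = (\<Sum>c<N. \<Sum>a<c. \<theta>) + (\<Sum>c<N. \<Sum>a<c. h1 (x (Suc a)) + h1 (x (Suc c)))
       + (\<Sum>c<N. \<Sum>a<c. h2 (x (Suc a)) (x (Suc c)))"
    unfolding sum_increasing_pairs h by (simp only: sum.distrib add.assoc)
  also have "\<dots> = \<theta> * (real N * (real N - 1) / 2) + (real N - 1) * (\<Sum>i=1..N. h1 (x i))
      + (\<Sum>(i, j)\<in>{(i, j). 1 \<le> i \<and> i < j \<and> j \<le> N}. h2 (x i) (x j))"
    unfolding sum_pairs_const sum_pairs_marginal[of "\<lambda>a. h1 (x (Suc a))"] sum_increasing_pairs
    by (simp only: sum.atLeast1_atMost_eq One_nat_def)
  also have "2 / (real N * (real N - 1)) * \<dots> = \<theta> + 2 / real N * (\<Sum>i=1..N. h1 (x i)) + U_stat h2 N x"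
  proof -
    have "2 / (u * v) * (\<theta> * (u * v / 2) + v * s + p) = \<theta> + 2 / u * s + 2 / (u * v) * p"
      if "u \<noteq> 0" "v \<noteq> 0" for u v s p :: real
      using that by (simp add: field_simps)
    then show ?thesis using N unfolding U_stat_def by simp
  qed
  finally show ?thesis unfolding U_stat_def .
qed

section \<open>Variance inequalities\<close>

lemma (in prob_space) variance_le_second_moment:
  fixes f :: "'a \<Rightarrow> real"
  assumes "f \<in> borel_measurable M" "integrable M (\<lambda>\<omega>. (f \<omega>)\<^sup>2)"
  shows "variance f \<le> expectation (\<lambda>\<omega>. (f \<omega> - m)\<^sup>2)"
proof -
  have i: "integrable M f" by (rule square_integrable_imp_integrable[OF assms])
  have "expectation (\<lambda>\<omega>. (f \<omega> - m)\<^sup>2) = expectation (\<lambda>\<omega>. (f \<omega>)\<^sup>2 + ((- 2 * m) * f \<omega> + m\<^sup>2))"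
    by (intro Bochner_Integration.integral_cong) (auto simp: power2_diff)
  also have "\<dots> = expectation (\<lambda>\<omega>. (f \<omega>)\<^sup>2) + ((- 2 * m) * expectation f + m\<^sup>2)"
    using i assms by (simp add: prob_space)
  also have "\<dots> = variance f + (expectation f - m)\<^sup>2"
    unfolding variance_eq[OF i assms(2)] by (simp add: power2_diff)
  finally show ?thesis by simp
qed

text \<open>The covariance is absorbed by \<open>2 x y \<le> \<eta> x\<^sup>2 + y\<^sup>2 / \<eta>\<close>.\<close>

lemma (in prob_space) variance_perturbation:
  fixes f g :: "'a \<Rightarrow> real"
  assumes f: "f \<in> borel_measurable M" "integrable M (\<lambda>\<omega>. (f \<omega>)\<^sup>2)"
    and g: "g \<in> borel_measurable M" "integrable M (\<lambda>\<omega>. (g \<omega>)\<^sup>2)" and \<eta>: "0 < \<eta>"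
  shows "\<bar>variance (\<lambda>\<omega>. c + f \<omega> + g \<omega>) - variance f\<bar> \<le> (1 + 1 / \<eta>) * variance g + \<eta> * variance f"
proof -
  have i: "integrable M f" "integrable M g"
    by (rule square_integrable_imp_integrable; fact)+
  define u where "u \<omega> = f \<omega> - expectation f" for \<omega>
  define v where "v \<omega> = g \<omega> - expectation g" for \<omega>
  have u2: "integrable M (\<lambda>\<omega>. (u \<omega>)\<^sup>2)" and v2: "integrable M (\<lambda>\<omega>. (v \<omega>)\<^sup>2)"
    unfolding u_def v_def power2_diff using i f g by auto
  have [measurable]: "u \<in> borel_measurable M" "v \<in> borel_measurable M"
    unfolding u_def v_def using f g by auto
  have b: "\<bar>2 * (x * y)\<bar> \<le> \<eta> * x\<^sup>2 + y\<^sup>2 / \<eta>" for x y :: real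
  proof -
    have "0 \<le> (\<eta> * \<bar>x\<bar> - \<bar>y\<bar>)\<^sup>2 / \<eta>" using \<eta> by simp
    also have "\<dots> = \<eta> * x\<^sup>2 + y\<^sup>2 / \<eta> - 2 * \<bar>x * y\<bar>"
      using \<eta> by (simp add: power2_diff power_mult_distrib abs_mult field_simps power2_eq_square)
    finally show ?thesis by (simp add: abs_mult)
  qed
  have bi: "integrable M (\<lambda>\<omega>. \<eta> * (u \<omega>)\<^sup>2 + (v \<omega>)\<^sup>2 / \<eta>)" using u2 v2 by auto
  have uv: "integrable M (\<lambda>\<omega>. 2 * (u \<omega> * v \<omega>))"
    by (rule Bochner_Integration.integrable_bound[OF bi]) (auto intro!: AE_I2 order_trans[OF b])
  have "expectation (\<lambda>\<omega>. c + f \<omega> + g \<omega>) = c + expectation f + expectation g"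
    using i by (simp add: prob_space)
  then have "variance (\<lambda>\<omega>. c + f \<omega> + g \<omega>) = expectation (\<lambda>\<omega>. (u \<omega>)\<^sup>2 + (v \<omega>)\<^sup>2 + 2 * (u \<omega> * v \<omega>))"
    by (intro Bochner_Integration.integral_cong) (auto simp: u_def v_def power2_eq_square algebra_simps)
  also have "\<dots> = variance f + variance g + expectation (\<lambda>\<omega>. 2 * (u \<omega> * v \<omega>))"
    using u2 v2 uv by (simp add: u_def v_def)
  finally have "variance (\<lambda>\<omega>. c + f \<omega> + g \<omega>) - variance f = variance g + expectation (\<lambda>\<omega>. 2 * (u \<omega> * v \<omega>))"
    by simp
  moreover have "\<bar>expectation (\<lambda>\<omega>. 2 * (u \<omega> * v \<omega>))\<bar> \<le> \<eta> * variance f + variance g / \<eta>"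
  proof -
    have "\<bar>expectation (\<lambda>\<omega>. 2 * (u \<omega> * v \<omega>))\<bar> \<le> expectation (\<lambda>\<omega>. \<bar>2 * (u \<omega> * v \<omega>)\<bar>)"
      by (rule integral_abs_bound)
    also have "\<dots> \<le> expectation (\<lambda>\<omega>. \<eta> * (u \<omega>)\<^sup>2 + (v \<omega>)\<^sup>2 / \<eta>)"
      by (rule integral_mono[OF _ bi b]) (use uv in auto)
    also have "\<dots> = \<eta> * variance f + variance g / \<eta>" using u2 v2 by (simp add: u_def v_def)
    finally show ?thesis .
  qed
  moreover have "0 \<le> variance g" by (rule variance_positive)
  moreover have "(1 + 1 / \<eta>) * variance g = variance g + variance g / \<eta>" by (simp add: distrib_right)
  ultimately show ?thesis by linarith
qed

text \<open>\<open>G\<close> is not centred under the bootstrap law, even when it comes from a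
  degenerate kernel. A second Hoeffding decomposition, now with respect to the uniform start, splits
  it into a doubly centred part \<psi> with variance of order b^2 and a marginal part g, which
  occurs in b - 1 pairs per block and so contributes order b^3.\<close>

lemma JE_quadratic:
  assumes n: "n \<ge> 1" and b: "b \<ge> 1" and sym: "\<And>j k. G j k = G k j"
  defines "g \<equiv> \<lambda>j. avg n (G j)"
  shows "measure_pmf.variance (starts n b) (\<lambda>J. 2 * (\<Sum>c<b. \<Sum>a<c. G (J a) (J c)) + (\<Sum>a<b. D (J a)))
    \<le> 128 * (real b)\<^sup>2 * avg n (\<lambda>k. avg n (\<lambda>j. (G j k)\<^sup>2)) + 16 * real b ^ 3 * avg n (\<lambda>j. (g j)\<^sup>2)
      + 4 * real b * avg n (\<lambda>j. (D j)\<^sup>2)"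
proof -
  define gg where "gg = avg n g"
  \<comment> \<open>Doubly centred by inclusion and exclusion; its mean square is at most 16 s,
    since (x - y - z + t)^2 is at most 4 times the sum of the four squares.\<close>
  define \<psi> where "\<psi> j k = G j k - g j - g k + gg" for j k
  \<comment> \<open>All single-block terms: each block meets b - 1 others, and the pair sum carries
    the factor 2.\<close>
  define \<phi> where "\<phi> j = 2 * (real b - 1) * g j + D j" for j
  define w where "w j = \<phi> j - avg n \<phi>" for j
  define s where "s = avg n (\<lambda>k. avg n (\<lambda>j. (G j k)\<^sup>2))"
  have \<psi>2: "avg n (\<lambda>k. \<psi> j k) = 0" for j
    unfolding \<psi>_def avg_add avg_diff using n by (simp add: g_def gg_def avg_const)
  have \<psi>1: "avg n (\<lambda>j. \<psi> j k) = 0" for k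
  proof -
    have "(\<lambda>j. \<psi> j k) = (\<lambda>j. \<psi> k j)" by (auto simp: \<psi>_def sym[of _ k])
    then show ?thesis using \<psi>2 by simp
  qed
  have w: "avg n w = 0" unfolding w_def avg_diff using n by (simp add: avg_const)
  have gs: "avg n (\<lambda>j. (g j)\<^sup>2) \<le> s"
  proof -
    have "avg n (\<lambda>j. (g j)\<^sup>2) \<le> avg n (\<lambda>j. avg n (\<lambda>k. (G j k)\<^sup>2))"
      unfolding g_def by (intro avg_mono avg_square_le)
    then show ?thesis unfolding s_def by (subst avg_swap)
  qed
  have ggs: "gg\<^sup>2 \<le> s" unfolding gg_def using avg_square_le gs by (rule order_trans)
  have \<psi>s: "avg n (\<lambda>k. avg n (\<lambda>j. (\<psi> j k)\<^sup>2)) \<le> 16 * s"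
  proof -
    have q4: "(x - y - z + t)\<^sup>2 \<le> 4 * (x\<^sup>2 + y\<^sup>2 + z\<^sup>2 + t\<^sup>2)" for x y z t :: real
    proof -
      have "0 \<le> (x + y)\<^sup>2 + (x + z)\<^sup>2 + (x - t)\<^sup>2 + (y - z)\<^sup>2 + (y + t)\<^sup>2 + (z + t)\<^sup>2" by simp
      then show ?thesis by (simp add: power2_eq_square algebra_simps)
    qed
    have "avg n (\<lambda>k. avg n (\<lambda>j. (\<psi> j k)\<^sup>2)) \<le> avg n (\<lambda>k. avg n (\<lambda>j. 4 * ((G j k)\<^sup>2 + (g j)\<^sup>2 + (g k)\<^sup>2 + gg\<^sup>2)))"
      unfolding \<psi>_def by (intro avg_mono q4)
    also have "\<dots> = 4 * (s + avg n (\<lambda>j. (g j)\<^sup>2) + avg n (\<lambda>j. (g j)\<^sup>2) + gg\<^sup>2)"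
      unfolding avg_cmult avg_add using n by (simp add: avg_const s_def)
    also have "\<dots> \<le> 4 * (s + s + s + s)" using gs ggs by simp
    finally show ?thesis by simp
  qed
  let ?T = "\<lambda>J. \<Sum>c<b. \<Sum>a<c. \<psi> (J a) (J c)" and ?W = "\<lambda>J. \<Sum>a<b. w (J a)"
  \<comment> \<open>What the centring of \<psi> and of \<phi> removes, collected into one constant;
    the variance is at most the second moment about it.\<close>
  define m where "m = real b * avg n \<phi> - real b * (real b - 1) * gg"
  have dec: "2 * (\<Sum>c<b. \<Sum>a<c. G (J a) (J c)) + (\<Sum>a<b. D (J a)) - m = 2 * ?T J + ?W J" for J
  proof -
    have "(\<Sum>c<b. \<Sum>a<c. G (J a) (J c)) = (\<Sum>c<b. \<Sum>a<c. \<psi> (J a) (J c) + (g (J a) + g (J c)) + (- gg))"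
      by (simp add: \<psi>_def)
    also have "\<dots> = ?T J + (real b - 1) * (\<Sum>a<b. g (J a)) - gg * (real b * (real b - 1) / 2)"
      using sum_pairs_marginal[of "\<lambda>a. g (J a)" b] sum_pairs_const[where t="- gg" and b=b]
      unfolding sum.distrib by simp
    finally have "(\<Sum>c<b. \<Sum>a<c. G (J a) (J c)) = ?T J + (real b - 1) * (\<Sum>a<b. g (J a)) - gg * (real b * (real b - 1) / 2)" .
    moreover have "2 * (gg * (real b * (real b - 1) / 2)) = real b * (real b - 1) * gg" by simp
    moreover have "?W J = 2 * (real b - 1) * (\<Sum>a<b. g (J a)) + (\<Sum>a<b. D (J a)) - real b * avg n \<phi>"
      unfolding w_def by (simp add: \<phi>_def sum_subtractf sum.distrib sum_distrib_left)
    moreover have "2 * ((real b - 1) * (\<Sum>a<b. g (J a))) = 2 * (real b - 1) * (\<Sum>a<b. g (J a))" by simp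
    ultimately show ?thesis unfolding m_def by linarith
  qed
  have "measure_pmf.variance (starts n b) (\<lambda>J. 2 * (\<Sum>c<b. \<Sum>a<c. G (J a) (J c)) + (\<Sum>a<b. D (J a)))
    \<le> JE n b (\<lambda>J. (2 * (\<Sum>c<b. \<Sum>a<c. G (J a) (J c)) + (\<Sum>a<b. D (J a)) - m)\<^sup>2)"
    unfolding JE_def by (rule measure_pmf.variance_le_second_moment; (rule starts_integrable[OF n])?; simp)
  also have "\<dots> = JE n b (\<lambda>J. (2 * ?T J + ?W J)\<^sup>2)" by (simp only: dec)
  also have "\<dots> \<le> JE n b (\<lambda>J. 8 * (?T J)\<^sup>2 + 2 * (?W J)\<^sup>2)"
  proof (rule JE_mono[OF n])
    fix J show "(2 * ?T J + ?W J)\<^sup>2 \<le> 8 * (?T J)\<^sup>2 + 2 * (?W J)\<^sup>2"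
      using zero_le_power2[of "2 * ?T J - ?W J"] by (simp only: power2_sum power2_diff power_mult_distrib) simp
  qed
  also have "\<dots> = 8 * JE n b (\<lambda>J. (?T J)\<^sup>2) + 2 * (real b * avg n (\<lambda>j. (w j)\<^sup>2))"
    by (simp only: JE_add[OF n] JE_cmult JE_sum_centered(2)[OF n w])
  also have "\<dots> \<le> 8 * ((real b)\<^sup>2 * (16 * s)) + 2 * (real b * avg n (\<lambda>j. (w j)\<^sup>2))"
    by (intro add_right_mono mult_left_mono order_trans[OF JE_pairs_centered[OF n \<psi>1 \<psi>2] mult_left_mono[OF \<psi>s]]) auto
  finally have main: "measure_pmf.variance (starts n b) (\<lambda>J. 2 * (\<Sum>c<b. \<Sum>a<c. G (J a) (J c)) + (\<Sum>a<b. D (J a)))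
    \<le> 8 * ((real b)\<^sup>2 * (16 * s)) + 2 * (real b * avg n (\<lambda>j. (w j)\<^sup>2))" .
  have "avg n (\<lambda>j. (w j)\<^sup>2) \<le> avg n (\<lambda>j. (\<phi> j)\<^sup>2)"
  proof -
    have "avg n (\<lambda>j. (w j)\<^sup>2) = avg n (\<lambda>j. (\<phi> j)\<^sup>2 + ((- 2 * avg n \<phi>) * \<phi> j + (avg n \<phi>)\<^sup>2))"
      by (simp add: w_def power2_diff algebra_simps)
    also have "\<dots> = avg n (\<lambda>j. (\<phi> j)\<^sup>2) - (avg n \<phi>)\<^sup>2"
      unfolding avg_add avg_cmult using n by (simp add: avg_const power2_eq_square)
    finally show ?thesis by simp
  qed
  also have "avg n (\<lambda>j. (\<phi> j)\<^sup>2) \<le> avg n (\<lambda>j. 8 * (real b)\<^sup>2 * (g j)\<^sup>2 + 2 * (D j)\<^sup>2)"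
  proof (rule avg_mono)
    fix j
    have "(\<phi> j)\<^sup>2 \<le> 2 * (2 * (real b - 1) * g j)\<^sup>2 + 2 * (D j)\<^sup>2"
      unfolding \<phi>_def using zero_le_power2[of "2 * (real b - 1) * g j - D j"] by (simp only: power2_sum power2_diff)
    also have "(2 * (real b - 1) * g j)\<^sup>2 = 4 * ((real b - 1)\<^sup>2 * (g j)\<^sup>2)"
      unfolding power_mult_distrib by simp
    also have "(real b - 1)\<^sup>2 * (g j)\<^sup>2 \<le> (real b)\<^sup>2 * (g j)\<^sup>2"
      using b by (intro mult_right_mono power_mono) auto
    finally show "(\<phi> j)\<^sup>2 \<le> 8 * (real b)\<^sup>2 * (g j)\<^sup>2 + 2 * (D j)\<^sup>2" by simp
  qed
  finally have "2 * (real b * avg n (\<lambda>j. (w j)\<^sup>2))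
    \<le> 2 * (real b * (8 * (real b)\<^sup>2 * avg n (\<lambda>j. (g j)\<^sup>2) + 2 * avg n (\<lambda>j. (D j)\<^sup>2)))"
    unfolding avg_add avg_cmult by (intro mult_left_mono) auto
  also have "\<dots> = 16 * real b ^ 3 * avg n (\<lambda>j. (g j)\<^sup>2) + 4 * real b * avg n (\<lambda>j. (D j)\<^sup>2)"
    by (simp add: algebra_simps power3_eq_cube power2_eq_square)
  finally show ?thesis using main unfolding s_def[symmetric] by linarith
qed


section \<open>Block form of the bootstrapped U-statistic\<close>

lemma sum_blocks:
  fixes F :: "nat \<Rightarrow> nat \<Rightarrow> real"
  assumes l: "l \<ge> 1"
  shows "(\<Sum>i=1..b * l. F ((i - 1) div l) ((i - 1) mod l)) = (\<Sum>a<b. \<Sum>r<l. F a r)"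
proof -
  have "(\<Sum>i=1..b * l. F ((i - 1) div l) ((i - 1) mod l)) = (\<Sum>i<b * l. F (i div l) (i mod l))"
    by (simp add: sum.atLeast1_atMost_eq)
  also have "\<dots> = (\<Sum>a<b. \<Sum>i=a * l..<a * l + l. F (i div l) (i mod l))"
    by (rule sum.nat_group[symmetric])
  also have "\<dots> = (\<Sum>a<b. \<Sum>r<l. F a r)"
  proof (rule sum.cong[OF refl])
    fix a
    have "(\<Sum>i=a * l..<a * l + l. F (i div l) (i mod l)) = (\<Sum>r<l. F ((r + a * l) div l) ((r + a * l) mod l))"
      using sum.shift_bounds_nat_ivl[of "\<lambda>i. F (i div l) (i mod l)" 0 "a * l" l]
      by (simp add: add.commute atLeast0LessThan)
    also have "\<dots> = (\<Sum>r<l. F a r)" using l by (intro sum.cong) auto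
    finally show "(\<Sum>i=a * l..<a * l + l. F (i div l) (i mod l)) = (\<Sum>r<l. F a r)" .
  qed
  finally show ?thesis .
qed

definition block_sum :: "(real \<Rightarrow> real) \<Rightarrow> nat \<Rightarrow> nat \<Rightarrow> (nat \<Rightarrow> real) \<Rightarrow> nat \<Rightarrow> real" where
  "block_sum y n l x j = (\<Sum>r<l. y (periodic_ext n x (j + r)))"

definition block_pair_sum :: "(real \<Rightarrow> real \<Rightarrow> real) \<Rightarrow> nat \<Rightarrow> nat \<Rightarrow> (nat \<Rightarrow> real) \<Rightarrow> nat \<Rightarrow> nat \<Rightarrow> real" where
  "block_pair_sum g n l x j k = (\<Sum>r<l. \<Sum>s<l. g (periodic_ext n x (j + r)) (periodic_ext n x (k + s)))"

text \<open>Ordered pairs of distinct positions inside one block: the U-statistic has no terms with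
  i = j, so these are taken off.\<close>

definition block_diag :: "(real \<Rightarrow> real \<Rightarrow> real) \<Rightarrow> nat \<Rightarrow> nat \<Rightarrow> (nat \<Rightarrow> real) \<Rightarrow> nat \<Rightarrow> real" where
  "block_diag g n l x j = block_pair_sum g n l x j j - (\<Sum>r<l. g (periodic_ext n x (j + r)) (periodic_ext n x (j + r)))"

text \<open>The exact conditional variance of the linear part: it is 2 / sqrt (b l) times a sum of b
  independent block sums, and b / (b l) = 1 / l.\<close>

definition linear_variance :: "(real \<Rightarrow> real) \<Rightarrow> nat \<Rightarrow> nat \<Rightarrow> (nat \<Rightarrow> real) \<Rightarrow> real" where
  "linear_variance y n l x = 4 / real l *
     (avg n (\<lambda>j. (block_sum y n l x j)\<^sup>2) - (avg n (block_sum y n l x))\<^sup>2)"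

text \<open>The bound of \<open>JE_quadratic\<close> times the squared normalisation of the
  degenerate part.\<close>

definition remainder_bound :: "(real \<Rightarrow> real \<Rightarrow> real) \<Rightarrow> nat \<Rightarrow> nat \<Rightarrow> nat \<Rightarrow> (nat \<Rightarrow> real) \<Rightarrow> real" where
  "remainder_bound g n l b x =
     (128 * (real b)\<^sup>2 * avg n (\<lambda>k. avg n (\<lambda>j. (block_pair_sum g n l x j k)\<^sup>2))
      + 16 * real b ^ 3 * avg n (\<lambda>j. (avg n (block_pair_sum g n l x j))\<^sup>2)
      + 4 * real b * avg n (\<lambda>j. (block_diag g n l x j)\<^sup>2)) / (real (b * l) * (real (b * l) - 1)\<^sup>2)"

text \<open>In terms of the independent block starts the linear part is a sum and the degenerate
  part a quadratic form; the former has an explicit variance, the latter is treated as a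
  perturbation.\<close>

lemma cbb_variance_perturbation:
  assumes n: "n \<ge> 1" and l: "l \<ge> 1" "l \<le> n" and N: "n div l * l \<ge> 2" and \<eta>: "0 < \<eta>"
    and h: "\<And>x y. h x y = \<theta> + h1 x + h1 y + h2 x y" and sym: "\<And>x y. h2 x y = h2 y x"
  shows "\<bar>cbb_variance h n l x - linear_variance h1 n l x\<bar>
    \<le> (1 + 1 / \<eta>) * remainder_bound h2 n l (n div l) x + \<eta> * linear_variance h1 n l x"
proof -
  define b where "b = n div l"
  define N' where "N' = b * l"
  have N2: "N' \<ge> 2" using N by (simp add: N'_def b_def)
  have b1: "b \<ge> 1" using N by (cases "n div l = 0") (auto simp: b_def)
  let ?p = "periodic_ext n x" and ?G = "block_pair_sum h2 n l x" and ?S = "block_sum h1 n l x"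
    and ?D = "block_diag h2 n l x"
  define x' where "x' J i = ?p (J ((i - 1) div l) + (i - 1) mod l)" for J i
  define c where "c = sqrt (real N') * \<theta>"
  define f where "f J = sqrt (real N') * (2 / real N' * (\<Sum>i=1..N'. h1 (x' J i)))" for J
  define g where "g J = sqrt (real N') * U_stat h2 N' (x' J)" for J
  have cbb: "cbb_variance h n l x = measure_pmf.variance (starts n b) (\<lambda>J. c + f J + g J)"
  proof -
    have "cbb_variance h n l x = measure_pmf.variance (starts n b) (\<lambda>J. sqrt (real N') * U_stat h N' (x' J))"
      unfolding cbb_variance_def cbb_sample_def num_blocks_def b_def[symmetric] N'_def[symmetric] x'_def
      by simp
    also have "(\<lambda>J. sqrt (real N') * U_stat h N' (x' J)) = (\<lambda>J. c + f J + g J)"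
      unfolding c_def f_def g_def U_stat_decomposition[OF N2 h] by (simp add: distrib_left)
    finally show ?thesis .
  qed
  have sb: "(\<Sum>i=1..N'. F (x' J i)) = (\<Sum>a<b. \<Sum>r<l. F (?p (J a + r)))" for F :: "real \<Rightarrow> real" and J
    unfolding N'_def x'_def by (rule sum_blocks[OF l(1), of "\<lambda>a r. F (?p (J a + r))"])
  have f_eq: "f J = 2 / sqrt (real N') * (\<Sum>a<b. ?S (J a))" for J
  proof -
    have "sqrt (real N') * (2 / real N') = 2 / sqrt (real N')"
      using N2 by (simp add: field_simps)
    then show ?thesis unfolding f_def sb block_sum_def by (simp only: mult.assoc[symmetric])
  qed
  have g_eq: "g J = sqrt (real N') / (real N' * (real N' - 1)) * (2 * (\<Sum>c<b. \<Sum>a<c. ?G (J a) (J c)) + (\<Sum>a<b. ?D (J a)))" for J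
  proof -
    \<comment> \<open>Symmetry turns the sum over i < j into the full double sum minus its diagonal.
      The full sum regroups into blocks and is reduced again to increasing pairs of blocks, the
      pairs inside a block going to \<open>block_diag\<close>.\<close>
    have "2 * (\<Sum>c<N'. \<Sum>a<c. h2 (x' J (Suc a)) (x' J (Suc c))) =
      (\<Sum>a<N'. \<Sum>c<N'. h2 (x' J (Suc a)) (x' J (Suc c))) - (\<Sum>a<N'. h2 (x' J (Suc a)) (x' J (Suc a)))"
      using sum_pairs_sym[of "\<lambda>a c. h2 (x' J (Suc a)) (x' J (Suc c))" N'] sym by simp
    also have "\<dots> = (\<Sum>i=1..N'. \<Sum>j=1..N'. h2 (x' J i) (x' J j)) - (\<Sum>i=1..N'. h2 (x' J i) (x' J i))"
      by (simp only: sum.atLeast1_atMost_eq One_nat_def)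
    also have "(\<Sum>i=1..N'. \<Sum>j=1..N'. h2 (x' J i) (x' J j)) = (\<Sum>a<b. \<Sum>r<l. \<Sum>c<b. \<Sum>s<l. h2 (?p (J a + r)) (?p (J c + s)))"
      by (subst sb[of "\<lambda>y. \<Sum>j=1..N'. h2 y (x' J j)"]) (simp only: sb[of "h2 y" for y])
    also have "\<dots> = (\<Sum>a<b. \<Sum>c<b. ?G (J a) (J c))"
      unfolding block_pair_sum_def by (rule sum.cong[OF refl], subst sum.swap, rule refl)
    also have "(\<Sum>i=1..N'. h2 (x' J i) (x' J i)) = (\<Sum>a<b. \<Sum>r<l. h2 (?p (J a + r)) (?p (J a + r)))"
      by (rule sb)
    also have "(\<Sum>a<b. \<Sum>c<b. ?G (J a) (J c)) = 2 * (\<Sum>c<b. \<Sum>a<c. ?G (J a) (J c)) + (\<Sum>a<b. ?G (J a) (J a))"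
    proof (rule sum_pairs_sym)
      fix a c show "?G (J a) (J c) = ?G (J c) (J a)"
        unfolding block_pair_sum_def by (subst sum.swap) (simp add: sym)
    qed
    finally show ?thesis
      unfolding g_def U_stat_def sum_increasing_pairs block_diag_def sum_subtractf by simp
  qed
  let ?var = "\<lambda>F. measure_pmf.variance (starts n b) F"
  have varf: "?var f = linear_variance h1 n l x"
  proof -
    define w where "w j = ?S j - avg n ?S" for j
    have w: "avg n w = 0" unfolding w_def avg_diff using n by (simp add: avg_const)
    have wS: "(\<Sum>a<b. ?S (J a)) = (\<Sum>a<b. w (J a)) + real b * avg n ?S" for J
      by (simp add: w_def sum_subtractf)
    have "JE n b (\<lambda>J. \<Sum>a<b. ?S (J a)) = real b * avg n ?S"
      unfolding wS JE_add[OF n] JE_sum_centered(1)[OF n w] by simp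
    then have "JE n b f = 2 / sqrt (real N') * (real b * avg n ?S)"
      unfolding f_eq JE_cmult by simp
    then have "f J - JE n b f = 2 / sqrt (real N') * (\<Sum>a<b. w (J a))" for J
      unfolding f_eq wS by (simp add: algebra_simps)
    then have "JE n b (\<lambda>J. (f J - JE n b f)\<^sup>2) = JE n b (\<lambda>J. 4 / real N' * (\<Sum>a<b. w (J a))\<^sup>2)"
      by (simp add: power_mult_distrib power_divide)
    also have "\<dots> = 4 / real N' * (real b * avg n (\<lambda>j. (w j)\<^sup>2))"
      unfolding JE_cmult JE_sum_centered(2)[OF n w] ..
    also have "avg n (\<lambda>j. (w j)\<^sup>2) = avg n (\<lambda>j. (?S j)\<^sup>2) - (avg n ?S)\<^sup>2"
    proof -
      have "avg n (\<lambda>j. (w j)\<^sup>2) = avg n (\<lambda>j. (?S j)\<^sup>2 + ((- 2 * avg n ?S) * ?S j + (avg n ?S)\<^sup>2))"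
        by (simp add: w_def power2_diff algebra_simps)
      also have "\<dots> = avg n (\<lambda>j. (?S j)\<^sup>2) - (avg n ?S)\<^sup>2"
        unfolding avg_add avg_cmult using n by (simp add: avg_const power2_eq_square)
      finally show ?thesis .
    qed
    also have "4 / real N' * (real b * z) = 4 / real l * z" for z
      using b1 by (simp add: N'_def)
    finally show ?thesis
      unfolding JE_def linear_variance_def .
  qed
  have varg: "?var g \<le> remainder_bound h2 n l b x"
  proof -
    let ?Q = "\<lambda>J. 2 * (\<Sum>c<b. \<Sum>a<c. ?G (J a) (J c)) + (\<Sum>a<b. ?D (J a))"
    define t where "t = sqrt (real N') / (real N' * (real N' - 1))"
    have t2: "t\<^sup>2 = 1 / (real N' * (real N' - 1)\<^sup>2)"
    proof -
      have "t\<^sup>2 = real N' / ((real N')\<^sup>2 * (real N' - 1)\<^sup>2)"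
        unfolding t_def power_divide power_mult_distrib by simp
      then show ?thesis using N2 by (simp add: power2_eq_square)
    qed
    have g': "g = (\<lambda>J. t * ?Q J)" unfolding t_def g_eq[abs_def] ..
    have "?var g = t\<^sup>2 * ?var ?Q"
      unfolding g' by (simp add: power_mult_distrib right_diff_distrib[symmetric])
    also have "\<dots> \<le> t\<^sup>2 * (128 * (real b)\<^sup>2 * avg n (\<lambda>k. avg n (\<lambda>j. (?G j k)\<^sup>2))
      + 16 * real b ^ 3 * avg n (\<lambda>j. (avg n (?G j))\<^sup>2) + 4 * real b * avg n (\<lambda>j. (?D j)\<^sup>2))"
    proof (intro mult_left_mono JE_quadratic n b1)
      fix j k show "?G j k = ?G k j"
        unfolding block_pair_sum_def by (subst sum.swap) (simp add: sym)
    qed simp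
    also have "\<dots> = remainder_bound h2 n l b x"
      unfolding remainder_bound_def t2 N'_def[symmetric] by simp
    finally show ?thesis .
  qed
  have "\<bar>?var (\<lambda>J. c + f J + g J) - ?var f\<bar> \<le> (1 + 1 / \<eta>) * ?var g + \<eta> * ?var f"
    by (rule measure_pmf.variance_perturbation[OF _ _ _ _ \<eta>]; (rule starts_integrable[OF n])?; simp)
  also have "\<dots> \<le> (1 + 1 / \<eta>) * remainder_bound h2 n l b x + \<eta> * ?var f"
    using varg \<eta> by (intro add_right_mono mult_left_mono) auto
  finally show ?thesis unfolding cbb varf unfolding b_def .
qed

section \<open>Moments of the Hoeffding components\<close>

lemma powr_add_le:
  fixes a b :: real
  assumes "0 \<le> p"
  shows "\<bar>a + b\<bar> powr p \<le> 2 powr p * (\<bar>a\<bar> powr p + \<bar>b\<bar> powr p)"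
proof -
  have "\<bar>a + b\<bar> powr p \<le> (2 * max \<bar>a\<bar> \<bar>b\<bar>) powr p" using assms by (intro powr_mono2) auto
  also have "\<dots> = 2 powr p * (max \<bar>a\<bar> \<bar>b\<bar>) powr p" by (simp add: powr_mult)
  also have "(max \<bar>a\<bar> \<bar>b\<bar>) powr p \<le> \<bar>a\<bar> powr p + \<bar>b\<bar> powr p" by (simp add: max_def)
  finally show ?thesis by simp
qed

lemma powr_moment_add:
  fixes a b :: "'b \<Rightarrow> real"
  assumes [measurable]: "a \<in> borel_measurable N" "b \<in> borel_measurable N" and p: "0 \<le> p"
    and i: "integrable N (\<lambda>z. \<bar>a z\<bar> powr p)" "integrable N (\<lambda>z. \<bar>b z\<bar> powr p)"
    and k: "(\<integral>z. \<bar>a z\<bar> powr p \<partial>N) \<le> K" "(\<integral>z. \<bar>b z\<bar> powr p \<partial>N) \<le> K'"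
  shows "integrable N (\<lambda>z. \<bar>a z + b z\<bar> powr p) \<and> (\<integral>z. \<bar>a z + b z\<bar> powr p \<partial>N) \<le> 2 powr p * (K + K')"
proof -
  note pt = powr_add_le[OF p]
  have bi: "integrable N (\<lambda>z. 2 powr p * (\<bar>a z\<bar> powr p + \<bar>b z\<bar> powr p))" using i by auto
  have 1: "integrable N (\<lambda>z. \<bar>a z + b z\<bar> powr p)"
    by (rule Bochner_Integration.integrable_bound[OF bi]) (auto intro!: AE_I2 order_trans[OF pt])
  have "(\<integral>z. \<bar>a z + b z\<bar> powr p \<partial>N) \<le> (\<integral>z. 2 powr p * (\<bar>a z\<bar> powr p + \<bar>b z\<bar> powr p) \<partial>N)"
    by (rule integral_mono[OF 1 bi pt])
  also have "\<dots> = 2 powr p * ((\<integral>z. \<bar>a z\<bar> powr p \<partial>N) + (\<integral>z. \<bar>b z\<bar> powr p \<partial>N))" using i by simp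
  also have "\<dots> \<le> 2 powr p * (K + K')" using k by (intro mult_left_mono add_mono) auto
  finally show ?thesis using 1 by simp
qed

text \<open>Stated in \<open>ennreal\<close>, so that it applies to every section of a kernel before
  it is known which sections are integrable. Jensen is applied to |f| + 1 to stay in the open half
  line; the shift costs the factor \<open>2 powr p\<close>.\<close>

lemma (in prob_space) powr_integral_le:
  fixes f :: "'a \<Rightarrow> real"
  assumes [measurable]: "f \<in> borel_measurable M" and p: "1 \<le> p"
  shows "ennreal (\<bar>expectation f\<bar> powr p) \<le> ennreal (2 powr p) * (1 + (\<integral>\<^sup>+\<omega>. ennreal (\<bar>f \<omega>\<bar> powr p) \<partial>M))"
proof (cases "(\<integral>\<^sup>+\<omega>. ennreal (\<bar>f \<omega>\<bar> powr p) \<partial>M) = \<infinity>")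
  case True
  then show ?thesis by (simp add: ennreal_mult_top)
next
  case False
  then have i: "integrable M (\<lambda>\<omega>. \<bar>f \<omega>\<bar> powr p)"
    by (intro integrableI_nonneg) (auto simp: less_top)
  have le1: "\<bar>x\<bar> \<le> 1 + \<bar>x\<bar> powr p" for x :: real
  proof (cases "\<bar>x\<bar> \<le> 1")
    case False
    then have "\<bar>x\<bar> powr 1 \<le> \<bar>x\<bar> powr p" using p by (intro powr_mono) auto
    then show ?thesis using False by simp
  qed (use powr_ge_zero[of "\<bar>x\<bar>" p] in linarith)
  have fi: "integrable M f"
    by (rule Bochner_Integration.integrable_bound[of M "\<lambda>\<omega>. 1 + \<bar>f \<omega>\<bar> powr p"])
       (use i in \<open>auto intro!: AE_I2 order_trans[OF le1]\<close>)
  have pt: "(\<bar>x\<bar> + 1) powr p \<le> 2 powr p * (\<bar>x\<bar> powr p + 1)" for x :: real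
    using powr_add_le[of p "\<bar>x\<bar>" 1] p by simp
  have bi: "integrable M (\<lambda>\<omega>. 2 powr p * (\<bar>f \<omega>\<bar> powr p + 1))" using i by auto
  have gi: "integrable M (\<lambda>\<omega>. (\<bar>f \<omega>\<bar> + 1) powr p)"
    by (rule Bochner_Integration.integrable_bound[OF bi])
       (auto intro!: AE_I2 order_trans[OF pt])
  have "\<bar>expectation f\<bar> \<le> expectation (\<lambda>\<omega>. \<bar>f \<omega>\<bar>)" by (rule integral_abs_bound)
  also have "\<dots> \<le> expectation (\<lambda>\<omega>. \<bar>f \<omega>\<bar> + 1)" using fi by (intro integral_mono) auto
  finally have "\<bar>expectation f\<bar> powr p \<le> expectation (\<lambda>\<omega>. \<bar>f \<omega>\<bar> + 1) powr p"
    using p by (intro powr_mono2) auto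
  also have "\<dots> \<le> expectation (\<lambda>\<omega>. (\<bar>f \<omega>\<bar> + 1) powr p)"
    by (rule jensens_inequality[where I="{0<..}" and a=0]) (use fi gi powr_convex[OF p] in auto)
  also have "\<dots> \<le> expectation (\<lambda>\<omega>. 2 powr p * (\<bar>f \<omega>\<bar> powr p + 1))"
    by (rule integral_mono[OF gi bi pt])
  also have "\<dots> = 2 powr p * (1 + expectation (\<lambda>\<omega>. \<bar>f \<omega>\<bar> powr p))"
    using i by (simp add: prob_space)
  finally have "ennreal (\<bar>expectation f\<bar> powr p) \<le> ennreal (2 powr p * (1 + expectation (\<lambda>\<omega>. \<bar>f \<omega>\<bar> powr p)))"
    by (rule ennreal_leI)
  also have "\<dots> = ennreal (2 powr p) * (1 + ennreal (expectation (\<lambda>\<omega>. \<bar>f \<omega>\<bar> powr p)))"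
    by (simp add: ennreal_mult)
  also have "ennreal (expectation (\<lambda>\<omega>. \<bar>f \<omega>\<bar> powr p)) = (\<integral>\<^sup>+\<omega>. ennreal (\<bar>f \<omega>\<bar> powr p) \<partial>M)"
    by (rule nn_integral_eq_integral[symmetric, OF i]) auto
  finally show ?thesis .
qed

section \<open>Marginal laws and closure properties of the moment condition\<close>

context mixing_process
begin

abbreviation p_mom :: real where "p_mom \<equiv> 4 + 2 / 3 * \<delta>"

lemma p_mom_ge: "1 \<le> p_mom" "0 \<le> p_mom" using \<delta> by auto

definition F1 :: "real measure" where "F1 = distr M borel (X 1)"

lemma distr_X: "i \<ge> 1 \<Longrightarrow> distr M borel (X i) = F1"
proof -
  assume i: "i \<ge> 1"
  let ?P = "\<Pi>\<^sub>M i\<in>{1::nat}. (borel :: real measure)"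
  have s: "distr M ?P (\<lambda>\<omega>. \<lambda>k\<in>{1}. X (k + (i - 1)) \<omega>) = distr M ?P (\<lambda>\<omega>. \<lambda>k\<in>{1}. X k \<omega>)"
    using stationary unfolding strictly_stationary_def by (metis empty_subsetI finite.emptyI finite_insert insert_subset atLeast_iff order_refl)
  have m: "(\<lambda>\<omega>. \<lambda>k\<in>{1}. X (k + t) \<omega>) \<in> measurable M ?P" for t
    by (intro measurable_restrict X_meas) auto
  have c: "(\<lambda>z. z 1) \<in> measurable ?P borel" by (rule measurable_component_singleton) simp
  have "distr M borel (X i) = distr (distr M ?P (\<lambda>\<omega>. \<lambda>k\<in>{1}. X (k + (i - 1)) \<omega>)) borel (\<lambda>z. z 1)"
    using i by (subst distr_distr[OF c m]) (simp add: comp_def)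
  also have "\<dots> = distr M borel (X 1)"
    unfolding s using m[of 0] by (subst distr_distr[OF c]) (auto simp add: comp_def)
  finally show ?thesis by (simp add: F1_def)
qed

lemma distr_X_pair:
  assumes i: "i \<ge> 1"
  shows "distr M (borel \<Otimes>\<^sub>M borel) (\<lambda>\<omega>. (X i \<omega>, X (i + k) \<omega>)) = distr M (borel \<Otimes>\<^sub>M borel) (\<lambda>\<omega>. (X 1 \<omega>, X (1 + k) \<omega>))"
proof -
  let ?I = "{1, 1 + k}"
  let ?P = "\<Pi>\<^sub>M i\<in>?I. (borel :: real measure)"
  have s: "distr M ?P (\<lambda>\<omega>. \<lambda>k\<in>?I. X (k + (i - 1)) \<omega>) = distr M ?P (\<lambda>\<omega>. \<lambda>k\<in>?I. X k \<omega>)"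
    using stationary unfolding strictly_stationary_def by (rule allE[of _ ?I]) auto
  have m: "(\<lambda>\<omega>. \<lambda>k\<in>?I. X (k + t) \<omega>) \<in> measurable M ?P" for t
    by (intro measurable_restrict X_meas) auto
  have c: "(\<lambda>z. (z 1, z (1 + k))) \<in> measurable ?P (borel \<Otimes>\<^sub>M borel)"
    by (intro measurable_Pair measurable_component_singleton) auto
  have "distr M (borel \<Otimes>\<^sub>M borel) (\<lambda>\<omega>. (X i \<omega>, X (i + k) \<omega>))
      = distr (distr M ?P (\<lambda>\<omega>. \<lambda>k\<in>?I. X (k + (i - 1)) \<omega>)) (borel \<Otimes>\<^sub>M borel) (\<lambda>z. (z 1, z (1 + k)))"
    using i by (subst distr_distr[OF c m]) (simp add: comp_def add.commute)
  also have "\<dots> = distr M (borel \<Otimes>\<^sub>M borel) (\<lambda>\<omega>. (X 1 \<omega>, X (1 + k) \<omega>))"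
    unfolding s using m[of 0] by (subst distr_distr[OF c]) (auto simp add: comp_def)
  finally show ?thesis .
qed

lemma F1_sets [measurable_cong]: "sets F1 = sets borel"
  by (simp add: F1_def)

lemma F1_prob: "prob_space F1"
  unfolding F1_def by (rule prob_space_distr) (rule X_meas, simp)

lemma nn_integral_X: "i \<ge> 1 \<Longrightarrow> f \<in> borel_measurable borel \<Longrightarrow> (\<integral>\<^sup>+\<omega>. f (X i \<omega>) \<partial>M) = (\<integral>\<^sup>+x. f x \<partial>F1)"
  using nn_integral_distr[OF X_meas, of i f] by (simp add: distr_X)

lemma integral_X: "i \<ge> 1 \<Longrightarrow> f \<in> borel_measurable borel \<Longrightarrow> (\<integral>\<omega>. f (X i \<omega>) \<partial>M) = (\<integral>x. f x \<partial>F1 :: real)"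
  using integral_distr[OF X_meas, of i f] by (simp add: distr_X)

lemma AE_X: "i \<ge> 1 \<Longrightarrow> AE x in F1. P x \<Longrightarrow> AE \<omega> in M. P (X i \<omega>)"
  by (rule AE_distrD[OF X_meas]) (simp_all only: distr_X)

text \<open>By stationarity the moments of all independent pairs coincide with one double integral
  over \<open>F1\<close>, so a single hypothesis covers all i and j.\<close>

lemma bounded_momentsI:
  assumes m: "case_prod g \<in> borel_measurable (borel \<Otimes>\<^sub>M borel)" and K: "0 \<le> K"
    and joint: "\<And>i j. i \<ge> 1 \<Longrightarrow> j \<ge> 1 \<Longrightarrow> (\<integral>\<^sup>+\<omega>. ennreal (\<bar>g (X i \<omega>) (X j \<omega>)\<bar> powr p_mom) \<partial>M) \<le> ennreal K"
    and prod: "(\<integral>\<^sup>+x. \<integral>\<^sup>+y. ennreal (\<bar>g x y\<bar> powr p_mom) \<partial>F1 \<partial>F1) \<le> ennreal K"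
  shows "bounded_moments K g"
  unfolding bounded_moments_def
proof (intro conjI allI impI m)
  fix i j :: nat assume ij: "1 \<le> i" "1 \<le> j"
  note [measurable] = X_meas[OF ij(1)] X_meas[OF ij(2)]
  have gm [measurable]: "(\<lambda>z. g (u z) (v z)) \<in> borel_measurable N"
    if "u \<in> borel_measurable N" "v \<in> borel_measurable N" for u v and N :: "'c measure"
    using measurable_compose[OF measurable_Pair[OF that] m] by simp
  have bound: "integrable N f \<and> (\<integral>z. f z \<partial>N) \<le> K"
    if "f \<in> borel_measurable N" "\<And>z. 0 \<le> f z" "(\<integral>\<^sup>+z. ennreal (f z) \<partial>N) \<le> ennreal K" for f and N :: "'c measure"
  proof -
    have i: "integrable N f"
      by (intro integrableI_nonneg that(1) AE_I2 that(2)) (rule le_less_trans[OF that(3)], simp)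
    then have "ennreal (\<integral>z. f z \<partial>N) \<le> ennreal K"
      using that(2,3) by (subst nn_integral_eq_integral[symmetric]) auto
    then show ?thesis using i K by simp
  qed
  have 1: "integrable M (\<lambda>\<omega>. \<bar>g (X i \<omega>) (X j \<omega>)\<bar> powr p_mom) \<and> expectation (\<lambda>\<omega>. \<bar>g (X i \<omega>) (X j \<omega>)\<bar> powr p_mom) \<le> K"
    by (rule bound) (use joint[OF ij] in auto)
  have m2: "(\<lambda>z. \<bar>g (X i (fst z)) (X j (snd z))\<bar> powr p_mom) \<in> borel_measurable (M \<Otimes>\<^sub>M M)" by measurable
  have "(\<integral>\<^sup>+z. ennreal (\<bar>g (X i (fst z)) (X j (snd z))\<bar> powr p_mom) \<partial>(M \<Otimes>\<^sub>M M))
      = (\<integral>\<^sup>+\<omega>'. \<integral>\<^sup>+\<omega>. ennreal (\<bar>g (X i \<omega>') (X j \<omega>)\<bar> powr p_mom) \<partial>M \<partial>M)"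
    by (subst nn_integral_fst[symmetric]) auto
  also have "\<dots> = (\<integral>\<^sup>+\<omega>'. \<integral>\<^sup>+y. ennreal (\<bar>g (X i \<omega>') y\<bar> powr p_mom) \<partial>F1 \<partial>M)"
    by (intro nn_integral_cong nn_integral_X[OF ij(2)]) measurable
  also have "\<dots> = (\<integral>\<^sup>+x. \<integral>\<^sup>+y. ennreal (\<bar>g x y\<bar> powr p_mom) \<partial>F1 \<partial>F1)"
  proof (rule nn_integral_X[OF ij(1)])
    interpret F: prob_space F1 by (rule F1_prob)
    show "(\<lambda>x. \<integral>\<^sup>+y. ennreal (\<bar>g x y\<bar> powr p_mom) \<partial>F1) \<in> borel_measurable borel"
      by (rule F.borel_measurable_nn_integral) (simp add: case_prod_beta')
  qed
  finally have "(\<integral>\<^sup>+z. ennreal (\<bar>g (X i (fst z)) (X j (snd z))\<bar> powr p_mom) \<partial>(M \<Otimes>\<^sub>M M)) \<le> ennreal K"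
    using prod by simp
  then have 2: "integrable (M \<Otimes>\<^sub>M M) (\<lambda>z. \<bar>g (X i (fst z)) (X j (snd z))\<bar> powr p_mom) \<and>
      (\<integral>z. \<bar>g (X i (fst z)) (X j (snd z))\<bar> powr p_mom \<partial>(M \<Otimes>\<^sub>M M)) \<le> K"
    by (intro bound m2) auto
  show "integrable M (\<lambda>\<omega>. \<bar>g (X i \<omega>) (X j \<omega>)\<bar> powr p_mom)"
    "expectation (\<lambda>\<omega>. \<bar>g (X i \<omega>) (X j \<omega>)\<bar> powr p_mom) \<le> K"
    "integrable (M \<Otimes>\<^sub>M M) (\<lambda>(\<omega>', \<omega>). \<bar>g (X i \<omega>') (X j \<omega>)\<bar> powr p_mom)"
    "(\<integral>(\<omega>', \<omega>). \<bar>g (X i \<omega>') (X j \<omega>)\<bar> powr p_mom \<partial>(M \<Otimes>\<^sub>M M)) \<le> K"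
    using 1 2 by (auto simp: case_prod_beta')
qed

lemma bounded_moments_add:
  assumes g: "bounded_moments K g" and g': "bounded_moments K' g'"
  shows "bounded_moments (2 powr p_mom * (K + K')) (\<lambda>x y. g x y + g' x y)"
  unfolding bounded_moments_def
proof (intro conjI allI impI)
  have [measurable]: "case_prod g \<in> borel_measurable (borel \<Otimes>\<^sub>M borel)" "case_prod g' \<in> borel_measurable (borel \<Otimes>\<^sub>M borel)"
    using assms by (auto simp: bounded_moments_def)
  show "(\<lambda>(x, y). g x y + g' x y) \<in> borel_measurable (borel \<Otimes>\<^sub>M borel)"
    using borel_measurable_add[of "case_prod g" _ "case_prod g'"] by (simp add: case_prod_beta')
  fix i j :: nat assume ij: "1 \<le> i" "1 \<le> j"
  note Xf = measurable_compose[OF measurable_fst X_meas] and Xs = measurable_compose[OF measurable_snd X_meas]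
  have 1: "integrable M (\<lambda>\<omega>. \<bar>g (X i \<omega>) (X j \<omega>) + g' (X i \<omega>) (X j \<omega>)\<bar> powr p_mom) \<and>
    expectation (\<lambda>\<omega>. \<bar>g (X i \<omega>) (X j \<omega>) + g' (X i \<omega>) (X j \<omega>)\<bar> powr p_mom) \<le> 2 powr p_mom * (K + K')"
    using ij g g' by (intro powr_moment_add p_mom_ge bounded_moments_comp[OF g] bounded_moments_comp[OF g'] X_meas)
      (auto simp: bounded_moments_def)
  have 2: "integrable (M \<Otimes>\<^sub>M M) (\<lambda>z. \<bar>g (X i (fst z)) (X j (snd z)) + g' (X i (fst z)) (X j (snd z))\<bar> powr p_mom) \<and>
    (\<integral>z. \<bar>g (X i (fst z)) (X j (snd z)) + g' (X i (fst z)) (X j (snd z))\<bar> powr p_mom \<partial>(M \<Otimes>\<^sub>M M)) \<le> 2 powr p_mom * (K + K')"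
    using ij g g' by (intro powr_moment_add p_mom_ge bounded_moments_comp[OF g] bounded_moments_comp[OF g'] Xf Xs)
      (auto simp: bounded_moments_def case_prod_beta')
  show "integrable M (\<lambda>\<omega>. \<bar>g (X i \<omega>) (X j \<omega>) + g' (X i \<omega>) (X j \<omega>)\<bar> powr p_mom)"
    "expectation (\<lambda>\<omega>. \<bar>g (X i \<omega>) (X j \<omega>) + g' (X i \<omega>) (X j \<omega>)\<bar> powr p_mom) \<le> 2 powr p_mom * (K + K')"
    "integrable (M \<Otimes>\<^sub>M M) (\<lambda>(\<omega>', \<omega>). \<bar>g (X i \<omega>') (X j \<omega>) + g' (X i \<omega>') (X j \<omega>)\<bar> powr p_mom)"
    "(\<integral>(\<omega>', \<omega>). \<bar>g (X i \<omega>') (X j \<omega>) + g' (X i \<omega>') (X j \<omega>)\<bar> powr p_mom \<partial>(M \<Otimes>\<^sub>M M)) \<le> 2 powr p_mom * (K + K')"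
    using 1 2 by (auto simp: case_prod_beta')
qed

lemma bounded_moments_uminus: "bounded_moments K g \<Longrightarrow> bounded_moments K (\<lambda>x y. - g x y)"
proof -
  assume g: "bounded_moments K g"
  have "(\<lambda>z. - case_prod g z) \<in> borel_measurable (borel \<Otimes>\<^sub>M borel)"
    by (rule borel_measurable_uminus) (use g in \<open>auto simp: bounded_moments_def\<close>)
  then show ?thesis using g by (simp add: bounded_moments_def case_prod_beta')
qed

lemma bounded_moments_mono: "bounded_moments K g \<Longrightarrow> K \<le> K' \<Longrightarrow> bounded_moments K' g"
  unfolding bounded_moments_def by (meson order_trans)

lemma bounded_moments_const: "bounded_moments (\<bar>c\<bar> powr p_mom) (\<lambda>_ _. c)"
  by (auto simp: bounded_moments_def prob_space MM.P.prob_space case_prod_beta')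

lemma bounded_moments_margin:
  assumes y [measurable]: "y \<in> borel_measurable borel" and K: "0 \<le> K"
    and b: "(\<integral>\<^sup>+x. ennreal (\<bar>y x\<bar> powr p_mom) \<partial>F1) \<le> ennreal K"
  shows "bounded_moments K (\<lambda>x _. y x)" "bounded_moments K (\<lambda>_ x. y x)"
proof -
  interpret F: prob_space F1 by (rule F1_prob)
  have j: "(\<integral>\<^sup>+\<omega>. ennreal (\<bar>y (X i \<omega>)\<bar> powr p_mom) \<partial>M) \<le> ennreal K" if "i \<ge> 1" for i
    using b by (subst nn_integral_X[OF that]) auto
  show "bounded_moments K (\<lambda>x _. y x)" "bounded_moments K (\<lambda>_ x. y x)"
    by (rule bounded_momentsI; use K j b F.emeasure_space_1 in \<open>simp add: case_prod_beta'\<close>)+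
qed

end

section \<open>Hoeffding decomposition of the given kernel\<close>

locale kernel_process = mixing_process +
  fixes h :: "real \<Rightarrow> real \<Rightarrow> real" and K :: real
  assumes h_meas: "case_prod h \<in> borel_measurable (borel \<Otimes>\<^sub>M borel)"
    and h_sym: "\<And>x y. h x y = h y x" and K0: "0 < K"
    and moment_prod: "(\<integral>\<^sup>+x2. \<integral>\<^sup>+x1. ennreal (\<bar>h x1 x2\<bar> powr (6 + \<delta>)) \<partial>F1 \<partial>F1) \<le> ennreal K"
    and moment_joint: "\<And>k :: nat.
      (\<integral>\<^sup>+(x, y). ennreal (\<bar>h x y\<bar> powr (4 + 2 / 3 * \<delta>))
         \<partial>(distr M (borel \<Otimes>\<^sub>M borel) (\<lambda>\<omega>. (X 1 \<omega>, X (1 + k) \<omega>)))) \<le> ennreal K"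
begin

interpretation F: prob_space F1 by (rule F1_prob)

lemma h_comp [measurable]: "u \<in> borel_measurable N \<Longrightarrow> v \<in> borel_measurable N \<Longrightarrow> (\<lambda>z. h (u z) (v z)) \<in> borel_measurable N"
  using measurable_compose[OF measurable_Pair h_meas] by simp

lemma bounded_moments_h: "bounded_moments (1 + K) h"
proof (rule bounded_momentsI[OF h_meas])
  have *: "(\<integral>\<^sup>+\<omega>. ennreal (\<bar>h (X i \<omega>) (X j \<omega>)\<bar> powr p_mom) \<partial>M) \<le> ennreal K" if "i \<ge> 1" "i \<le> j" for i j
  proof -
    have [measurable]: "X i \<in> borel_measurable M" "X j \<in> borel_measurable M" "X (i + (j - i)) \<in> borel_measurable M"
      using that by (auto intro: X_meas)
    have "(\<integral>\<^sup>+\<omega>. ennreal (\<bar>h (X i \<omega>) (X j \<omega>)\<bar> powr p_mom) \<partial>M)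
      = (\<integral>\<^sup>+z. ennreal (\<bar>h (fst z) (snd z)\<bar> powr p_mom) \<partial>(distr M (borel \<Otimes>\<^sub>M borel) (\<lambda>\<omega>. (X i \<omega>, X (i + (j - i)) \<omega>))))"
      using that by (subst nn_integral_distr) auto
    also have "\<dots> \<le> ennreal K"
      unfolding distr_X_pair[OF that(1)] using moment_joint[of "j - i"] by (simp add: case_prod_beta')
    finally show ?thesis .
  qed
  show "(\<integral>\<^sup>+\<omega>. ennreal (\<bar>h (X i \<omega>) (X j \<omega>)\<bar> powr p_mom) \<partial>M) \<le> ennreal (1 + K)" if "i \<ge> 1" "j \<ge> 1" for i j
  proof (cases "i \<le> j")
    case True
    then show ?thesis using *[of i j] that K0 by (auto elim: order_trans intro: ennreal_leI)
  next
    case False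
    then show ?thesis using *[of j i] that K0 h_sym[of "X j _"] by (auto elim: order_trans intro: ennreal_leI)
  qed
  \<comment> \<open>The order 4 + 2/3 \<delta> is below 6 + \<delta>; the 1 covers |x| <= 1 and is
    the reason for 1 + K.\<close>
  have pt: "\<bar>x\<bar> powr p_mom \<le> 1 + \<bar>x\<bar> powr (6 + \<delta>)" for x :: real
  proof (cases "\<bar>x\<bar> \<le> 1")
    case True
    then have "\<bar>x\<bar> powr p_mom \<le> 1" using powr_mono2[of p_mom "\<bar>x\<bar>" 1] \<delta> by simp
    then show ?thesis by (simp add: add_increasing2)
  next
    case False
    then have "\<bar>x\<bar> powr p_mom \<le> \<bar>x\<bar> powr (6 + \<delta>)" using \<delta> by (intro powr_mono) auto
    then show ?thesis by simp
  qed
  have "(\<integral>\<^sup>+x. \<integral>\<^sup>+y. ennreal (\<bar>h x y\<bar> powr p_mom) \<partial>F1 \<partial>F1)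
    \<le> (\<integral>\<^sup>+x. \<integral>\<^sup>+y. (1 + ennreal (\<bar>h y x\<bar> powr (6 + \<delta>))) \<partial>F1 \<partial>F1)"
  proof (intro nn_integral_mono)
    fix x y
    have "ennreal (\<bar>h x y\<bar> powr p_mom) \<le> ennreal (1 + \<bar>h y x\<bar> powr (6 + \<delta>))"
      unfolding h_sym[of x y] by (intro ennreal_leI pt)
    then show "ennreal (\<bar>h x y\<bar> powr p_mom) \<le> 1 + ennreal (\<bar>h y x\<bar> powr (6 + \<delta>))" by simp
  qed
  also have "\<dots> = 1 + (\<integral>\<^sup>+x. \<integral>\<^sup>+y. ennreal (\<bar>h y x\<bar> powr (6 + \<delta>)) \<partial>F1 \<partial>F1)"
    by (simp add: nn_integral_add F.emeasure_space_1)
  also have "\<dots> \<le> 1 + ennreal K" by (rule add_left_mono) (rule moment_prod)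
  also have "\<dots> = ennreal (1 + K)" using K0 by simp
  finally show "(\<integral>\<^sup>+x. \<integral>\<^sup>+y. ennreal (\<bar>h x y\<bar> powr p_mom) \<partial>F1 \<partial>F1) \<le> ennreal (1 + K)" .
qed (use K0 in auto)

definition m1 :: "real \<Rightarrow> real" where "m1 x = (\<integral>y. h x y \<partial>F1)"
definition \<theta> :: real where "\<theta> = (\<integral>x. m1 x \<partial>F1)"
definition h1 :: "real \<Rightarrow> real" where "h1 x = m1 x - \<theta>"
definition h2 :: "real \<Rightarrow> real \<Rightarrow> real" where "h2 x y = h x y - m1 x - m1 y + \<theta>"

lemma hoeffding: "h x y = \<theta> + h1 x + h1 y + h2 x y" and h2_sym: "h2 x y = h2 y x"
  by (simp_all add: h1_def h2_def h_sym[of x y])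

lemma m1_meas [measurable]: "m1 \<in> borel_measurable borel"
  unfolding m1_def[abs_def] by (rule F.borel_measurable_lebesgue_integral) measurable

lemma h_prod_moment: "(\<integral>\<^sup>+x. \<integral>\<^sup>+y. ennreal (\<bar>h x y\<bar> powr p_mom) \<partial>F1 \<partial>F1) \<le> ennreal (1 + K)"
proof -
  have b: "bounded_moments (1 + K) h" by (rule bounded_moments_h)
  have [measurable]: "X 1 \<in> borel_measurable M" "X (Suc 0) \<in> borel_measurable M" by (simp_all add: X_meas)
  have i: "integrable (M \<Otimes>\<^sub>M M) (\<lambda>z. \<bar>h (X 1 (fst z)) (X 1 (snd z))\<bar> powr p_mom)"
    and k: "(\<integral>z. \<bar>h (X 1 (fst z)) (X 1 (snd z))\<bar> powr p_mom \<partial>(M \<Otimes>\<^sub>M M)) \<le> 1 + K"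
    using b by (auto simp: bounded_moments_def case_prod_beta')
  have "(\<integral>\<^sup>+x. \<integral>\<^sup>+y. ennreal (\<bar>h x y\<bar> powr p_mom) \<partial>F1 \<partial>F1)
     = (\<integral>\<^sup>+\<omega>'. \<integral>\<^sup>+y. ennreal (\<bar>h (X 1 \<omega>') y\<bar> powr p_mom) \<partial>F1 \<partial>M)"
    by (rule nn_integral_X[symmetric]) (auto intro!: F.borel_measurable_nn_integral simp: case_prod_beta')
  also have "\<dots> = (\<integral>\<^sup>+\<omega>'. \<integral>\<^sup>+\<omega>. ennreal (\<bar>h (X 1 \<omega>') (X 1 \<omega>)\<bar> powr p_mom) \<partial>M \<partial>M)"
    by (intro nn_integral_cong nn_integral_X[symmetric]) auto
  also have "\<dots> = (\<integral>\<^sup>+z. ennreal (\<bar>h (X 1 (fst z)) (X 1 (snd z))\<bar> powr p_mom) \<partial>(M \<Otimes>\<^sub>M M))"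
    by (subst nn_integral_fst[symmetric]) auto
  also have "\<dots> = ennreal (\<integral>z. \<bar>h (X 1 (fst z)) (X 1 (snd z))\<bar> powr p_mom \<partial>(M \<Otimes>\<^sub>M M))"
    by (rule nn_integral_eq_integral[OF i]) auto
  also have "\<dots> \<le> ennreal (1 + K)" using k by (rule ennreal_leI)
  finally show ?thesis .
qed

text \<open>\<open>m1\<close> averages over one argument, so its moment is inherited from the
  independent pair by the sectionwise power inequality; 2 + K is 1 + (1 + K).\<close>

lemma m1_moment: "(\<integral>\<^sup>+x. ennreal (\<bar>m1 x\<bar> powr p_mom) \<partial>F1) \<le> ennreal (2 powr p_mom * (2 + K))"
proof -
  have "(\<integral>\<^sup>+x. ennreal (\<bar>m1 x\<bar> powr p_mom) \<partial>F1)
     \<le> (\<integral>\<^sup>+x. ennreal (2 powr p_mom) * (1 + (\<integral>\<^sup>+y. ennreal (\<bar>h x y\<bar> powr p_mom) \<partial>F1)) \<partial>F1)"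
    unfolding m1_def by (intro nn_integral_mono F.powr_integral_le p_mom_ge) auto
  also have "\<dots> = ennreal (2 powr p_mom) * (1 + (\<integral>\<^sup>+x. \<integral>\<^sup>+y. ennreal (\<bar>h x y\<bar> powr p_mom) \<partial>F1 \<partial>F1))"
    by (simp add: nn_integral_cmult nn_integral_add F.emeasure_space_1)
  also have "\<dots> \<le> ennreal (2 powr p_mom) * (1 + ennreal (1 + K))"
    by (intro mult_left_mono add_left_mono h_prod_moment) auto
  also have "\<dots> = ennreal (2 powr p_mom * (2 + K))"
    using K0 by (simp add: ennreal_mult ennreal_plus[symmetric] ennreal_1[symmetric] add.assoc[symmetric] del: ennreal_plus ennreal_1)
  finally show ?thesis .
qed

lemma integrable_of_moment:
  assumes [measurable]: "f \<in> borel_measurable borel" and "(\<integral>\<^sup>+x. ennreal (\<bar>f x\<bar> powr p_mom) \<partial>F1) < \<infinity>"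
  shows "integrable F1 (f :: real \<Rightarrow> real)"
proof -
  have "integrable F1 (\<lambda>x. \<bar>f x\<bar> powr p_mom)" using assms(2) by (intro integrableI_nonneg) auto
  then show ?thesis using F.truncation_error(1)[of f p_mom _ 1] \<delta> by auto
qed

lemma m1_integrable: "integrable F1 m1"
  by (rule integrable_of_moment) (use m1_moment in \<open>auto intro: le_less_trans\<close>)

lemma degenerate_h1: "degenerate (\<lambda>x _. h1 x)"
proof -
  have "(\<integral>\<omega>. h1 (X i \<omega>) \<partial>M) = 0" if "i \<ge> 1" for i
  proof -
    have "(\<integral>\<omega>. h1 (X i \<omega>) \<partial>M) = (\<integral>x. h1 x \<partial>F1)"
      by (rule integral_X[OF that]) (simp add: h1_def[abs_def])
    also have "\<dots> = 0" unfolding h1_def using m1_integrable by (simp add: \<theta>_def F.prob_space)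
    finally show ?thesis .
  qed
  then show ?thesis by (simp add: degenerate_def)
qed

text \<open>The finite product moment makes almost every section of h integrable. On those sections
  the integral of h is m1(y), and the terms of \<open>h2\<close> cancel.\<close>

lemma degenerate_h2: "degenerate h2"
  unfolding degenerate_def
proof (intro allI impI)
  fix i j :: nat assume ij: "1 \<le> i" "1 \<le> j"
  have "AE y in F1. (\<integral>\<^sup>+x. ennreal (\<bar>h y x\<bar> powr p_mom) \<partial>F1) \<noteq> \<infinity>"
  proof (rule nn_integral_PInf_AE)
    show "(\<lambda>y. \<integral>\<^sup>+x. ennreal (\<bar>h y x\<bar> powr p_mom) \<partial>F1) \<in> borel_measurable F1"
      by (intro F.borel_measurable_nn_integral) (simp add: case_prod_beta')
    show "(\<integral>\<^sup>+y. \<integral>\<^sup>+x. ennreal (\<bar>h y x\<bar> powr p_mom) \<partial>F1 \<partial>F1) \<noteq> \<infinity>"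
      using h_prod_moment by (auto simp: top_unique)
  qed
  then have "AE y in F1. (\<integral>x. h2 x y \<partial>F1) = 0"
  proof eventually_elim
    case (elim y)
    have i: "integrable F1 (h y)"
      by (rule integrable_of_moment) (use elim in \<open>auto simp: less_top\<close>)
    have "(\<integral>x. h2 x y \<partial>F1) = (\<integral>x. h y x - m1 x - m1 y + \<theta> \<partial>F1)"
      by (simp add: h2_def h_sym[of _ y])
    also have "\<dots> = m1 y - \<theta> - m1 y + \<theta>"
      using i m1_integrable by (simp add: F.prob_space \<theta>_def[symmetric] m1_def[symmetric])
    finally show ?case by simp
  qed
  from AE_X[OF ij(2) this] show "AE \<omega> in M. (\<integral>\<omega>'. h2 (X i \<omega>') (X j \<omega>) \<partial>M) = 0"
  proof eventually_elim
    case (elim \<omega>)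
    then show ?case
      by (subst integral_X[OF ij(1)]) (auto simp: h2_def[abs_def])
  qed
qed

text \<open>Closure of \<open>bounded_moments\<close> under sums and signs. Only the existence of
  one common constant matters for the rate; L >= 1 admits the constant kernel 1 as well.\<close>

lemma components_bounded: "\<exists>L\<ge>1. bounded_moments L h2 \<and> bounded_moments L (\<lambda>x _. h1 x)"
proof -
  have K': "0 \<le> 2 powr p_mom * (2 + K)" using K0 by simp
  note mm = bounded_moments_margin[OF m1_meas K' m1_moment]
  note c = bounded_moments_const[of \<theta>]
  note bounded_moments_add[OF bounded_moments_add[OF bounded_moments_add[OF bounded_moments_h
        bounded_moments_uminus[OF mm(1)]] bounded_moments_uminus[OF mm(2)]] c]
  then have "\<exists>L. bounded_moments L (\<lambda>x y. ((h x y + (- m1 x)) + (- m1 y)) + \<theta>)" by blast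
  moreover have "(\<lambda>x y. ((h x y + (- m1 x)) + (- m1 y)) + \<theta>) = h2" by (auto simp: h2_def fun_eq_iff)
  ultimately obtain L where L: "bounded_moments L h2" by auto
  have "\<exists>L. bounded_moments L (\<lambda>x _ :: real. m1 x + (- \<theta>))"
    using bounded_moments_add[OF mm(1) bounded_moments_uminus[OF c]] by blast
  then obtain L' where L': "bounded_moments L' (\<lambda>x _. h1 x)" by (auto simp: h1_def)
  show ?thesis
    by (rule exI[of _ "max 1 (max L L')"]) (use bounded_moments_mono[OF L] bounded_moments_mono[OF L'] in auto)
qed

end

section \<open>Moments of block sums\<close>

text \<open>Of two kernel factors, one can pay for a weight as large as the distance while the other
  stays summable. This yields the first moment of the covariances and saves a factor l for distant
  blocks.\<close>

lemma kern_dist_le: "\<bar>real s - real t\<bar> * kern s t \<le> 1"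
proof -
  let ?d = "max 1 \<bar>real s - real t\<bar>"
  have "?d * kern s t = ?d powr 1 * ?d powr (- 3 / 2)" by (simp add: kern_def)
  also have "\<dots> = ?d powr (- 1 / 2)" by (subst powr_add[symmetric]) simp
  also have "\<dots> \<le> ?d powr 0" by (intro powr_mono) auto
  also have "\<dots> \<le> 1" by simp
  finally have "?d * kern s t \<le> 1" .
  moreover have "\<bar>real s - real t\<bar> * kern s t \<le> ?d * kern s t"
    using kern_pos[of s t] by (intro mult_right_mono) auto
  ultimately show ?thesis by linarith
qed

text \<open>The indices of the circular block starting at j. As a plain set it fits the moment
  bounds for arbitrary index sets, whether or not the block wraps around.\<close>

definition window :: "nat \<Rightarrow> nat \<Rightarrow> nat \<Rightarrow> nat set" where
  "window n l j = (\<lambda>r. (j + r - 1) mod n + 1) ` {..<l}"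

lemma window_inj:
  fixes j l n :: nat
  assumes "j \<ge> 1" "l \<le> n"
  shows "inj_on (\<lambda>r. (j + r - 1) mod n + 1) {..<l}"
proof -
  have *: False if "r < r'" "r' < l" "(j + r - 1) mod n = (j + r' - 1) mod n" for r r' :: nat
  proof -
    have "n dvd (j + r' - 1) - (j + r - 1)" using mod_eq_dvd_iff_nat[of "j + r - 1" "j + r' - 1" n] that by simp
    moreover have "(j + r' - 1) - (j + r - 1) = r' - r" using assms by simp
    ultimately show False using that assms by (auto dest: dvd_imp_le)
  qed
  show ?thesis
  proof (rule inj_onI)
    fix r r' assume "r \<in> {..<l}" "r' \<in> {..<l}" "(j + r - 1) mod n + 1 = (j + r' - 1) mod n + 1"
    then show "r = r'" using *[of r r'] *[of r' r] by (cases r r' rule: linorder_cases) auto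
  qed
qed

lemma sum_window:
  assumes "j \<ge> 1" "l \<le> n"
  shows "(\<Sum>r<l. f (periodic_ext n x (j + r))) = (\<Sum>s\<in>window n l j. f (x s))"
  unfolding window_def periodic_ext_def by (subst sum.reindex[OF window_inj[OF assms]]) simp

lemma card_window: "j \<ge> 1 \<Longrightarrow> l \<le> n \<Longrightarrow> card (window n l j) = l"
  unfolding window_def by (subst card_image[OF window_inj]) auto

lemma window_subset: "n \<ge> 1 \<Longrightarrow> window n l j \<subseteq> {1..n}"
  unfolding window_def using mod_less_divisor[of n] by (auto simp: Suc_le_eq)

lemma finite_window: "finite (window n l j)"
  by (simp add: window_def)

lemma window_full: "n \<ge> 1 \<Longrightarrow> j \<ge> 1 \<Longrightarrow> window n n j = {1..n}"
  by (rule card_subset_eq[OF finite_atLeastAtMost window_subset]) (auto simp: card_window)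

lemma window_no_wrap: "j \<ge> 1 \<Longrightarrow> j + l \<le> n + 1 \<Longrightarrow> window n l j = {j..<j + l}"
proof -
  assume a: "j \<ge> 1" "j + l \<le> n + 1"
  have "window n l j = (\<lambda>r. j + r) ` {..<l}"
    unfolding window_def using a by (intro image_cong) auto
  also have "\<dots> = {j..<j + l}" by (simp add: lessThan_atLeast0 add.commute)
  finally show ?thesis .
qed

lemma block_sum_window: "j \<ge> 1 \<Longrightarrow> l \<le> n \<Longrightarrow> block_sum y n l x j = (\<Sum>s\<in>window n l j. y (x s))"
  unfolding block_sum_def by (rule sum_window)

lemma block_pair_sum_window:
  "j \<ge> 1 \<Longrightarrow> k \<ge> 1 \<Longrightarrow> l \<le> n \<Longrightarrow>
    block_pair_sum g n l x j k = (\<Sum>r\<in>window n l j. \<Sum>s\<in>window n l k. g (x r) (x s))"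
  unfolding block_pair_sum_def
  using sum_window[of j l n "\<lambda>y. \<Sum>s<l. g y (periodic_ext n x (k + s))" x] sum_window[of k l n "g _" x] by simp

text \<open>A shifted full cycle visits every observation exactly once, so averages over circular
  starts have no edge effect.\<close>

lemma sum_shift:
  assumes n: "n \<ge> 1"
  shows "(\<Sum>k=1..n. f (periodic_ext n x (k + s))) = (\<Sum>i=1..n. f (x i))"
proof -
  have "(\<Sum>k=1..n. f (periodic_ext n x (k + s))) = (\<Sum>r<n. f (periodic_ext n x ((s + 1) + r)))"
    by (simp add: sum.atLeast1_atMost_eq add.commute)
  also have "\<dots> = (\<Sum>i\<in>window n n (s + 1). f (x i))" by (rule sum_window) auto
  finally show ?thesis using n by (simp add: window_full)
qed

lemma avg_block_sum:
  assumes "n \<ge> 1"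
  shows "avg n (block_sum y n l x) = real l / real n * (\<Sum>i=1..n. y (x i))"
proof -
  have "(\<Sum>j=1..n. block_sum y n l x j) = (\<Sum>r<l. \<Sum>j=1..n. y (periodic_ext n x (j + r)))"
    unfolding block_sum_def by (rule sum.swap)
  also have "\<dots> = real l * (\<Sum>i=1..n. y (x i))" using sum_shift[OF assms, of y x] by simp
  finally show ?thesis by (simp add: avg_def)
qed

text \<open>Averaging over the second start replaces its block by the whole sample, so cancellation
  acts on n indices instead of l.\<close>

lemma avg_block_pair_sum:
  assumes "n \<ge> 1" "j \<ge> 1" "l \<le> n"
  shows "avg n (block_pair_sum g n l x j) = real l / real n * (\<Sum>r\<in>window n l j. \<Sum>i=1..n. g (x r) (x i))"
proof -
  have "(\<Sum>k=1..n. block_pair_sum g n l x j k)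
     = (\<Sum>r<l. \<Sum>s<l. \<Sum>k=1..n. g (periodic_ext n x (j + r)) (periodic_ext n x (k + s)))"
    unfolding block_pair_sum_def by (subst sum.swap) (rule sum.cong[OF refl], rule sum.swap)
  also have "\<dots> = (\<Sum>r<l. real l * (\<Sum>i=1..n. g (periodic_ext n x (j + r)) (x i)))"
    using sum_shift[OF assms(1), of "g _" x] by simp
  also have "\<dots> = real l * (\<Sum>r\<in>window n l j. \<Sum>i=1..n. g (x r) (x i))"
    unfolding sum_distrib_left[symmetric] using sum_window[of j l n "\<lambda>y. \<Sum>i=1..n. g y (x i)" x] assms by simp
  finally show ?thesis by (simp add: avg_def)
qed

lemma (in prob_space) avg_expectation:
  assumes n: "n \<ge> 1" and f: "\<And>j. j \<in> {1..n} \<Longrightarrow> integrable M (f j)" "\<And>j. j \<in> {1..n} \<Longrightarrow> expectation (f j) \<le> C"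
  shows "integrable M (\<lambda>\<omega>. avg n (\<lambda>j. f j \<omega>))" "expectation (\<lambda>\<omega>. avg n (\<lambda>j. f j \<omega>)) \<le> C"
proof -
  show "integrable M (\<lambda>\<omega>. avg n (\<lambda>j. f j \<omega>))"
    unfolding avg_def using f by (intro integrable_divide Bochner_Integration.integrable_sum) auto
  have "expectation (\<lambda>\<omega>. avg n (\<lambda>j. f j \<omega>)) = (\<Sum>j=1..n. expectation (f j)) / real n"
    unfolding avg_def using f by simp
  also have "\<dots> \<le> (\<Sum>j=1..n. C) / real n" using f by (intro divide_right_mono sum_mono) auto
  finally show "expectation (\<lambda>\<omega>. avg n (\<lambda>j. f j \<omega>)) \<le> C" using n by simp
qed

section \<open>Block sums and autocovariances of the Hoeffding components\<close>

locale decomposed_process = mixing_process +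
  fixes h :: "real \<Rightarrow> real \<Rightarrow> real" and \<theta> :: real and h1 :: "real \<Rightarrow> real" and h2 :: "real \<Rightarrow> real \<Rightarrow> real" and L :: real
  assumes dec: "\<And>x y. h x y = \<theta> + h1 x + h1 y + h2 x y" and sym2: "\<And>x y. h2 x y = h2 y x"
    and L: "1 \<le> L" and bm2: "bounded_moments L h2" and dg2: "degenerate h2"
    and bm1: "bounded_moments L (\<lambda>x _. h1 x)" and dg1: "degenerate (\<lambda>x _. h1 x)"
begin

definition c0 :: real where "c0 = 1 + 6 * B + 8 * L"
definition c4 :: real where "c4 = 32 * kern_mass\<^sup>2 * c0"

lemma c0: "1 \<le> c0" and c4: "0 \<le> c4"
  using B L by (auto simp: c0_def c4_def)

abbreviation Y :: "nat \<Rightarrow> 'a \<Rightarrow> real" where "Y i \<omega> \<equiv> h1 (X i \<omega>)"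
abbreviation sample :: "'a \<Rightarrow> nat \<Rightarrow> real" where "sample \<omega> \<equiv> (\<lambda>i. X i \<omega>)"

lemma h1_meas: "h1 \<in> borel_measurable borel"
  using bounded_moments_comp[OF bm1, of "\<lambda>x. x" borel "\<lambda>x. x"] by simp

lemma Y_meas [measurable]: "i \<ge> 1 \<Longrightarrow> Y i \<in> borel_measurable M"
  by (rule measurable_compose[OF X_meas h1_meas])

lemma h2_meas: "i \<ge> 1 \<Longrightarrow> j \<ge> 1 \<Longrightarrow> (\<lambda>\<omega>. h2 (X i \<omega>) (X j \<omega>)) \<in> borel_measurable M"
  by (rule bounded_moments_comp[OF bm2]; rule X_meas)

text \<open>\<open>h1\<close> enters as a kernel with a dummy second argument, so the common index
  in \<open>fourth_moment_sum\<close> can be any, here 1.\<close>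

lemma Y_sum4:
  assumes "finite S" "S \<subseteq> {1..}"
  shows "integrable M (\<lambda>\<omega>. (\<Sum>s\<in>S. Y s \<omega>) ^ 4)" "expectation (\<lambda>\<omega>. (\<Sum>s\<in>S. Y s \<omega>) ^ 4) \<le> c4 * (real (card S))\<^sup>2"
  using fourth_moment_sum[OF bm1 dg1 assms, of 1] by (auto simp: c4_def c0_def)

lemma window_ge: "n \<ge> 1 \<Longrightarrow> window n l j \<subseteq> {1..}"
  using window_subset[of n l j] by auto

lemma block_sum4:
  assumes "n \<ge> 1" "l \<le> n" "j \<ge> 1"
  shows "integrable M (\<lambda>\<omega>. block_sum h1 n l (sample \<omega>) j ^ 4)"
    "expectation (\<lambda>\<omega>. block_sum h1 n l (sample \<omega>) j ^ 4) \<le> c4 * (real l)\<^sup>2"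
  using Y_sum4[OF finite_window window_ge[OF assms(1)], of l j] assms
  by (simp_all add: block_sum_window card_window)

lemma block_pair_sum4:
  assumes n: "n \<ge> 1" "l \<le> n" "j \<ge> 1" "k \<ge> 1"
  shows "integrable M (\<lambda>\<omega>. block_pair_sum h2 n l (sample \<omega>) j k ^ 4)"
    "expectation (\<lambda>\<omega>. block_pair_sum h2 n l (sample \<omega>) j k ^ 4) \<le> c4 * real l ^ 6"
proof -
  have e: "block_pair_sum h2 n l (sample \<omega>) j k = (\<Sum>r\<in>window n l j. \<Sum>s\<in>window n l k. h2 (X s \<omega>) (X r \<omega>))" for \<omega>
    using n by (simp add: block_pair_sum_window sym2)
  note m = fourth_moment_double_sum[where S="window n l k" and A="window n l j",
      OF bm2 dg2 finite_window window_ge[OF n(1)] finite_window window_ge[OF n(1)]]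
  show "integrable M (\<lambda>\<omega>. block_pair_sum h2 n l (sample \<omega>) j k ^ 4)" unfolding e by (rule m(1))
  have "expectation (\<lambda>\<omega>. block_pair_sum h2 n l (sample \<omega>) j k ^ 4) \<le> c4 * real l ^ 4 * (real l)\<^sup>2"
    unfolding e using m(2) n by (simp add: card_window c4_def c0_def)
  also have "\<dots> = c4 * real l ^ 6" by (simp add: power_add[symmetric])
  finally show "expectation (\<lambda>\<omega>. block_pair_sum h2 n l (sample \<omega>) j k ^ 4) \<le> c4 * real l ^ 6" .
qed

text \<open>The gain of (l/n)^2 over the order l^6 of a single block pair compensates the prefactor
  b^3, against b^2, of this term in \<open>remainder_bound\<close>.\<close>

lemma avg_block_pair_sum4:
  assumes n: "n \<ge> 1" "l \<le> n" "j \<ge> 1"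
  shows "integrable M (\<lambda>\<omega>. avg n (block_pair_sum h2 n l (sample \<omega>) j) ^ 4)"
    "expectation (\<lambda>\<omega>. avg n (block_pair_sum h2 n l (sample \<omega>) j) ^ 4) \<le> c4 * real l ^ 8 / (real n)\<^sup>2"
proof -
  have e: "avg n (block_pair_sum h2 n l (sample \<omega>) j) ^ 4
     = (real l / real n) ^ 4 * (\<Sum>r\<in>window n l j. \<Sum>s\<in>{1..n}. h2 (X s \<omega>) (X r \<omega>)) ^ 4" for \<omega>
    using n by (simp add: avg_block_pair_sum sym2 power_mult_distrib power_divide)
  have "{1..n} \<subseteq> {1..}" by auto
  note m = fourth_moment_double_sum[where S="{1..n}" and A="window n l j",
      OF bm2 dg2 finite_atLeastAtMost this finite_window window_ge[OF n(1)]]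
  show "integrable M (\<lambda>\<omega>. avg n (block_pair_sum h2 n l (sample \<omega>) j) ^ 4)"
    unfolding e by (intro integrable_mult_right m(1))
  have "expectation (\<lambda>\<omega>. avg n (block_pair_sum h2 n l (sample \<omega>) j) ^ 4)
     = (real l / real n) ^ 4 * expectation (\<lambda>\<omega>. (\<Sum>r\<in>window n l j. \<Sum>s\<in>{1..n}. h2 (X s \<omega>) (X r \<omega>)) ^ 4)"
    unfolding e by simp
  also have "\<dots> \<le> (real l / real n) ^ 4 * (c4 * real l ^ 4 * (real n)\<^sup>2)"
    using m(2) n by (intro mult_left_mono) (auto simp: card_window c4_def c0_def)
  also have "\<dots> = c4 * real l ^ 8 / (real n)\<^sup>2"
  proof -
    have "(u / w) ^ 4 * (c * u ^ 4 * w\<^sup>2) = c * u ^ 8 / w\<^sup>2" if "w \<noteq> 0" for u w c :: real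
      using that by (simp add: power_divide field_simps power_add[symmetric])
    then show ?thesis using n by simp
  qed
  finally show "expectation (\<lambda>\<omega>. avg n (block_pair_sum h2 n l (sample \<omega>) j) ^ 4) \<le> c4 * real l ^ 8 / (real n)\<^sup>2" .
qed

lemma h2_power4:
  assumes "i \<ge> 1" "j \<ge> 1"
  shows "integrable M (\<lambda>\<omega>. h2 (X i \<omega>) (X j \<omega>) ^ 4)" "expectation (\<lambda>\<omega>. h2 (X i \<omega>) (X j \<omega>) ^ 4) \<le> 1 + 4 * L"
proof -
  have e: "h2 (X i \<omega>) (X j \<omega>) ^ 4 = h2 (X i \<omega>) (X j \<omega>) * h2 (X i \<omega>) (X j \<omega>) * h2 (X i \<omega>) (X j \<omega>) * h2 (X i \<omega>) (X j \<omega>)" for \<omega>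
    by (simp add: power4_eq_xxxx)
  note p = product_integrable[OF bm2 bm2 bm2 bm2 assms assms assms assms]
  show "integrable M (\<lambda>\<omega>. h2 (X i \<omega>) (X j \<omega>) ^ 4)" "expectation (\<lambda>\<omega>. h2 (X i \<omega>) (X j \<omega>) ^ 4) \<le> 1 + 4 * L"
    unfolding e using p by linarith+
qed

text \<open>The diagonal terms need not be centred and no cancellation is used for them; their order
  l^4 is below the l^6 of the pair sum anyway.\<close>

lemma block_diag4:
  assumes n: "n \<ge> 1" "l \<le> n" "j \<ge> 1"
  shows "integrable M (\<lambda>\<omega>. block_diag h2 n l (sample \<omega>) j ^ 4)"
    "expectation (\<lambda>\<omega>. block_diag h2 n l (sample \<omega>) j ^ 4) \<le> (8 * c4 + 8 * (1 + 4 * L)) * real l ^ 6"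
proof -
  let ?W = "window n l j" and ?P = "\<lambda>\<omega>. block_pair_sum h2 n l (sample \<omega>) j j"
  let ?D = "\<lambda>\<omega>. \<Sum>s\<in>?W. h2 (X s \<omega>) (X s \<omega>)"
  have Wge: "s \<ge> 1" if "s \<in> ?W" for s using that window_ge[OF n(1)] by auto
  have e: "block_diag h2 n l (sample \<omega>) j = ?P \<omega> - ?D \<omega>" for \<omega>
    unfolding block_diag_def using sum_window[of j l n "\<lambda>y. h2 y y"] n by simp
  have le1: "(x - y) ^ 4 \<le> 8 * (x ^ 4 + y ^ 4)" for x y :: real
  proof -
    have "((x - y)\<^sup>2)\<^sup>2 \<le> (2 * (x\<^sup>2 + y\<^sup>2))\<^sup>2"
      using zero_le_power2[of "x + y"] zero_le_power2[of "x - y"] by (intro power_mono) (auto simp: power2_sum power2_diff)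
    also have "\<dots> = 4 * (x\<^sup>2 + y\<^sup>2)\<^sup>2" unfolding power_mult_distrib by simp
    also have "(x\<^sup>2 + y\<^sup>2)\<^sup>2 \<le> 2 * ((x\<^sup>2)\<^sup>2 + (y\<^sup>2)\<^sup>2)"
      using zero_le_power2[of "x\<^sup>2 - y\<^sup>2"] by (simp add: power2_sum power2_diff)
    finally show ?thesis by simp
  qed
  have pt: "block_diag h2 n l (sample \<omega>) j ^ 4 \<le> 8 * (?P \<omega> ^ 4 + real l ^ 3 * (\<Sum>s\<in>?W. h2 (X s \<omega>) (X s \<omega>) ^ 4))" for \<omega>
  proof -
    have "?D \<omega> ^ 4 \<le> real l ^ 3 * (\<Sum>s\<in>?W. h2 (X s \<omega>) (X s \<omega>) ^ 4)"
      using power4_sum_le[of "\<lambda>s. h2 (X s \<omega>) (X s \<omega>)" ?W] n by (simp add: card_window)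
    then show ?thesis unfolding e
      by (intro order_trans[OF le1[of "?P \<omega>" "?D \<omega>"]] mult_left_mono add_left_mono) auto
  qed
  note P4 = block_pair_sum4[OF n(1,2,3,3)]
  have i: "integrable M (\<lambda>\<omega>. 8 * (?P \<omega> ^ 4 + real l ^ 3 * (\<Sum>s\<in>?W. h2 (X s \<omega>) (X s \<omega>) ^ 4)))"
    by (intro integrable_mult_right Bochner_Integration.integrable_add P4 Bochner_Integration.integrable_sum h2_power4 Wge)
  have m: "(\<lambda>\<omega>. block_diag h2 n l (sample \<omega>) j ^ 4) \<in> borel_measurable M"
  proof -
    have "?P \<in> borel_measurable M"
      unfolding block_pair_sum_window[OF n(3,3,2)] by (intro borel_measurable_sum h2_meas Wge)
    moreover have "?D \<in> borel_measurable M" by (intro borel_measurable_sum h2_meas Wge)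
    ultimately show ?thesis unfolding e by (intro borel_measurable_power borel_measurable_diff)
  qed
  show 1: "integrable M (\<lambda>\<omega>. block_diag h2 n l (sample \<omega>) j ^ 4)"
    by (rule Bochner_Integration.integrable_bound[OF i m])
       (intro AE_I2, use pt in \<open>simp add: abs_of_nonneg zero_le_even_power order_trans[OF _ abs_ge_self]\<close>)
  have "expectation (\<lambda>\<omega>. block_diag h2 n l (sample \<omega>) j ^ 4)
    \<le> expectation (\<lambda>\<omega>. 8 * (?P \<omega> ^ 4 + real l ^ 3 * (\<Sum>s\<in>?W. h2 (X s \<omega>) (X s \<omega>) ^ 4)))"
    by (rule integral_mono[OF 1 i pt])
  also have "\<dots> = 8 * (expectation (\<lambda>\<omega>. ?P \<omega> ^ 4) + real l ^ 3 * (\<Sum>s\<in>?W. expectation (\<lambda>\<omega>. h2 (X s \<omega>) (X s \<omega>) ^ 4)))"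
    using P4 h2_power4 Wge by simp
  also have "\<dots> \<le> 8 * (c4 * real l ^ 6 + real l ^ 3 * (\<Sum>s\<in>?W. 1 + 4 * L))"
    by (intro mult_left_mono add_mono P4 sum_mono h2_power4 Wge) auto
  also have "\<dots> = 8 * (c4 * real l ^ 6 + (1 + 4 * L) * (real l ^ 3 * real l))"
    using n by (simp add: card_window)
  also have "\<dots> \<le> 8 * (c4 * real l ^ 6 + (1 + 4 * L) * real l ^ 6)"
  proof -
    have "real l ^ 3 * real l = real l ^ 4" by (simp add: power_Suc2[symmetric] del: power_Suc)
    also have "\<dots> \<le> real l ^ 6" by (cases "l = 0") (auto intro: power_increasing)
    finally show ?thesis using L by (intro mult_left_mono add_left_mono) auto
  qed
  also have "\<dots> = (8 * c4 + 8 * (1 + 4 * L)) * real l ^ 6" by (simp add: algebra_simps)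
  finally show "expectation (\<lambda>\<omega>. block_diag h2 n l (sample \<omega>) j ^ 4) \<le> (8 * c4 + 8 * (1 + 4 * L)) * real l ^ 6" .
qed

definition \<rho> :: "nat \<Rightarrow> real" where "\<rho> k = expectation (\<lambda>\<omega>. Y 1 \<omega> * Y (1 + k) \<omega>)"

lemma YY:
  assumes "i \<ge> 1" "j \<ge> 1"
  shows "integrable M (\<lambda>\<omega>. Y i \<omega> * Y j \<omega>)" "\<bar>expectation (\<lambda>\<omega>. Y i \<omega> * Y j \<omega>)\<bar> \<le> c0 * (kern i j)\<^sup>2"
proof -
  note one = bounded_moments_one[OF L]
  show "integrable M (\<lambda>\<omega>. Y i \<omega> * Y j \<omega>)"
    using product_integrable(1)[OF bm1 bm1 one one, of i i j j i i i i] assms by simp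
  show "\<bar>expectation (\<lambda>\<omega>. Y i \<omega> * Y j \<omega>)\<bar> \<le> c0 * (kern i j)\<^sup>2"
    using product_le_kern[OF bm1 bm1 one one dg1, of i j j j j j j j "{j}"] assms by (simp add: c0_def)
qed

lemma YYYY: "i \<ge> 1 \<Longrightarrow> j \<ge> 1 \<Longrightarrow> k \<ge> 1 \<Longrightarrow> m \<ge> 1 \<Longrightarrow> integrable M (\<lambda>\<omega>. Y i \<omega> * Y j \<omega> * Y k \<omega> * Y m \<omega>)"
  using product_integrable(1)[OF bm1 bm1 bm1 bm1, of i i j j k k m m] by simp

lemma YY_stationary: "i \<ge> 1 \<Longrightarrow> expectation (\<lambda>\<omega>. Y i \<omega> * Y (i + k) \<omega>) = \<rho> k"
proof -
  assume i: "i \<ge> 1"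
  note [measurable] = h1_meas
  have *: "expectation (\<lambda>\<omega>. Y i \<omega> * Y (i + k) \<omega>)
    = (\<integral>z. h1 (fst z) * h1 (snd z) \<partial>(distr M (borel \<Otimes>\<^sub>M borel) (\<lambda>\<omega>. (X i \<omega>, X (i + k) \<omega>))))" if "i \<ge> 1" for i
  proof -
    have [measurable]: "X i \<in> borel_measurable M" "X (i + k) \<in> borel_measurable M"
      using that by (auto intro: X_meas)
    show ?thesis by (subst integral_distr) auto
  qed
  show ?thesis unfolding \<rho>_def *[OF i] distr_X_pair[OF i] by (rule *[OF order_refl, symmetric])
qed

definition dist_nat :: "nat \<Rightarrow> nat \<Rightarrow> nat" where "dist_nat i j = (if i \<le> j then j - i else i - j)"

lemma dist_nat_shift [simp]: "dist_nat (j + a) (j + b) = dist_nat a b"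
  by (simp add: dist_nat_def)

lemma YY_rho: "i \<ge> 1 \<Longrightarrow> j \<ge> 1 \<Longrightarrow> expectation (\<lambda>\<omega>. Y i \<omega> * Y j \<omega>) = \<rho> (dist_nat i j)"
  using YY_stationary[of i "j - i"] YY_stationary[of j "i - j"]
  by (auto simp: dist_nat_def mult.commute)

lemma rho_le: "real k * \<bar>\<rho> k\<bar> \<le> c0 * kern 1 (1 + k)"
proof -
  have "real k * \<bar>\<rho> k\<bar> \<le> real k * (c0 * (kern 1 (1 + k))\<^sup>2)"
    using YY(2)[of 1 "1 + k"] by (intro mult_left_mono) (auto simp: \<rho>_def)
  also have "\<dots> = c0 * kern 1 (1 + k) * (\<bar>real 1 - real (1 + k)\<bar> * kern 1 (1 + k))"
    by (simp add: power2_eq_square)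
  also have "\<dots> \<le> c0 * kern 1 (1 + k) * 1"
    using c0 kern_pos[of 1 "1 + k"] by (intro mult_left_mono kern_dist_le) auto
  finally show ?thesis by simp
qed

text \<open>Finiteness of the weighted sum over all lags is what makes the bias of order
  1/l.\<close>

lemma rho_weighted_sum: "(\<Sum>k<m. real k * \<bar>\<rho> k\<bar>) \<le> c0 * kern_mass"
proof -
  have "(\<Sum>k<m. real k * \<bar>\<rho> k\<bar>) \<le> (\<Sum>k<m. c0 * kern 1 (1 + k))" by (intro sum_mono rho_le)
  also have "\<dots> = c0 * (\<Sum>s\<in>(+) 1 ` {..<m}. kern s 1)"
    by (subst sum.reindex) (auto simp: sum_distrib_left kern_sym)
  also have "\<dots> \<le> c0 * kern_mass" using c0 by (intro mult_left_mono sum_kern_le) auto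
  finally show ?thesis .
qed

text \<open>As \<open>Y\<close> is centred, this is the variance of a sum of m consecutive
  terms.\<close>

definition v :: "nat \<Rightarrow> real" where "v m = expectation (\<lambda>\<omega>. (\<Sum>i=1..m. Y i \<omega>)\<^sup>2)"

lemma square_sum_window:
  assumes "j \<ge> 1"
  shows "integrable M (\<lambda>\<omega>. (\<Sum>i\<in>{j..<j + m}. Y i \<omega>)\<^sup>2)"
    "expectation (\<lambda>\<omega>. (\<Sum>i\<in>{j..<j + m}. Y i \<omega>)\<^sup>2) = (\<Sum>a<m. \<Sum>b<m. \<rho> (dist_nat a b))"
proof -
  have e: "(\<Sum>i\<in>{j..<j + m}. Y i \<omega>)\<^sup>2 = (\<Sum>a<m. \<Sum>b<m. Y (j + a) \<omega> * Y (j + b) \<omega>)" for \<omega>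
  proof -
    have "(\<Sum>i\<in>{j..<j + m}. Y i \<omega>) = (\<Sum>a<m. Y (j + a) \<omega>)"
      using sum.shift_bounds_nat_ivl[of "\<lambda>i. Y i \<omega>" 0 j m] by (simp add: add.commute atLeast0LessThan)
    then show ?thesis by (simp add: power2_eq_square sum_product)
  qed
  have i: "integrable M (\<lambda>\<omega>. Y (j + a) \<omega> * Y (j + b) \<omega>)" for a b
    by (rule YY(1)) (use assms in auto)
  show "integrable M (\<lambda>\<omega>. (\<Sum>i\<in>{j..<j + m}. Y i \<omega>)\<^sup>2)"
    unfolding e by (intro Bochner_Integration.integrable_sum i)
  show "expectation (\<lambda>\<omega>. (\<Sum>i\<in>{j..<j + m}. Y i \<omega>)\<^sup>2) = (\<Sum>a<m. \<Sum>b<m. \<rho> (dist_nat a b))"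
    unfolding e using i assms by (simp add: YY_rho)
qed

lemma v_eq: "v m = (\<Sum>a<m. \<Sum>b<m. \<rho> (dist_nat a b))"
proof -
  have "{1..m} = {1..<1 + m}" by auto
  then show ?thesis unfolding v_def using square_sum_window(2)[of 1 m] by simp
qed

text \<open>Doubling counts lag 0 twice, which the last term corrects.\<close>

lemma v_formula: "v m = 2 * (\<Sum>k<m. (real m - real k) * \<rho> k) - real m * \<rho> 0"
proof -
  have "(\<Sum>a<m. \<Sum>b<m. \<rho> (dist_nat a b)) = 2 * (\<Sum>b<m. \<Sum>a<b. \<rho> (dist_nat a b)) + (\<Sum>a<m. \<rho> (dist_nat a a))"
    by (rule sum_pairs_sym) (auto simp: dist_nat_def)
  also have "(\<Sum>b<m. \<Sum>a<b. \<rho> (dist_nat a b)) = (\<Sum>k<m. (real m - real k) * \<rho> k) - real m * \<rho> 0"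
  proof (induction m)
    case (Suc m)
    have "(\<Sum>a<m. \<rho> (dist_nat a m)) = (\<Sum>a<m. \<rho> (m - a))" by (intro sum.cong) (auto simp: dist_nat_def)
    also have "\<dots> = (\<Sum>a<m. \<rho> (Suc (m - Suc a)))" by (intro sum.cong) (auto simp: Suc_diff_Suc)
    also have "\<dots> = (\<Sum>k<m. \<rho> (Suc k))" by (rule sum.nat_diff_reindex)
    also have "\<dots> = (\<Sum>k<Suc m. \<rho> k) - \<rho> 0" using sum.lessThan_Suc_shift[of \<rho> m] by linarith
    finally have "(\<Sum>b<Suc m. \<Sum>a<b. \<rho> (dist_nat a b))
       = (\<Sum>k<m. (real m - real k) * \<rho> k) - real m * \<rho> 0 + ((\<Sum>k<Suc m. \<rho> k) - \<rho> 0)"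
      using Suc by simp
    also have "(\<Sum>k<m. (real m - real k) * \<rho> k) = (\<Sum>k<Suc m. (real m - real k) * \<rho> k)" by simp
    finally show ?case
      by (simp only: sum.distrib[symmetric] of_nat_Suc) (simp add: algebra_simps sum.distrib sum_subtractf)
  qed simp
  finally show ?thesis unfolding v_eq by (simp add: dist_nat_def)
qed

text \<open>v(m)/m equals 2 (sum of \<rho>(k) for k < m) - \<rho>(0) minus twice (sum of k
  \<rho>(k)) / m. The difference for l and n thus consists of the tail over l <= k < n and two
  weighted sums; each is at most c0 \<open>kern_mass\<close> / l and enters with factor 2, which
  gives 6.\<close>

lemma v_ratio:
  assumes l: "1 \<le> l" "l \<le> n"
  shows "\<bar>v l / real l - v n / real n\<bar> \<le> 6 * c0 * kern_mass / real l"
proof -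
  let ?W = "c0 * kern_mass"
  have W: "0 \<le> ?W" using c0 kern_mass_pos by simp
  have f: "v m / real m = 2 * (\<Sum>k<m. \<rho> k) - \<rho> 0 - 2 * ((\<Sum>k<m. real k * \<rho> k) / real m)" if "m \<ge> 1" for m
  proof -
    have "(\<Sum>k<m. (real m - real k) * \<rho> k) = real m * (\<Sum>k<m. \<rho> k) - (\<Sum>k<m. real k * \<rho> k)"
      by (simp add: left_diff_distrib sum_subtractf sum_distrib_left)
    then show ?thesis using that unfolding v_formula by (simp add: field_simps)
  qed
  have w: "\<bar>(\<Sum>k<m. real k * \<rho> k) / real m\<bar> \<le> ?W / real l" if "l \<le> m" for m
  proof -
    have "\<bar>\<Sum>k<m. real k * \<rho> k\<bar> \<le> (\<Sum>k<m. real k * \<bar>\<rho> k\<bar>)"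
      by (rule order_trans[OF sum_abs]) (simp add: abs_mult)
    also have "\<dots> \<le> ?W" by (rule rho_weighted_sum)
    finally show ?thesis using that l W by (auto simp: intro!: frac_le)
  qed
  have split: "(\<Sum>k<n. \<rho> k) = (\<Sum>k<l. \<rho> k) + (\<Sum>k=l..<n. \<rho> k)"
    using l by (simp add: lessThan_atLeast0 sum.atLeastLessThan_concat)
  have tail: "\<bar>\<Sum>k=l..<n. \<rho> k\<bar> \<le> ?W / real l"
  proof -
    have "real l * \<bar>\<Sum>k=l..<n. \<rho> k\<bar> \<le> real l * (\<Sum>k=l..<n. \<bar>\<rho> k\<bar>)"
      by (intro mult_left_mono sum_abs) auto
    also have "\<dots> \<le> (\<Sum>k=l..<n. real k * \<bar>\<rho> k\<bar>)"
      unfolding sum_distrib_left by (intro sum_mono mult_right_mono) auto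
    also have "\<dots> \<le> (\<Sum>k<n. real k * \<bar>\<rho> k\<bar>)" by (intro sum_mono2) auto
    also have "\<dots> \<le> ?W" by (rule rho_weighted_sum)
    finally show ?thesis using l by (simp add: field_simps)
  qed
  have tri: "\<bar>(2 * a - r - 2 * p) - (2 * (a + d) - r - 2 * q)\<bar> \<le> 6 * w"
    if "\<bar>d\<bar> \<le> w" "\<bar>p\<bar> \<le> w" "\<bar>q\<bar> \<le> w" for a r p q d w :: real
    using that unfolding abs_le_iff by auto
  have "\<bar>v l / real l - v n / real n\<bar> \<le> 6 * (?W / real l)"
    unfolding f[OF l(1)] f[OF order_trans[OF l]] split by (rule tri[OF tail w[OF order_refl] w[OF l(2)]])
  then show ?thesis by simp
qed

lemma v_bounds:
  assumes "1 \<le> m" shows "0 \<le> v m" "v m \<le> (c4 + 1) * real m"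
proof -
  show "0 \<le> v m" unfolding v_def by simp
  let ?S = "\<lambda>\<omega>. \<Sum>i=1..m. Y i \<omega>"
  have sub: "{1..m} \<subseteq> {1..}" by auto
  note Y4 = Y_sum4[OF finite_atLeastAtMost sub]
  \<comment> \<open>The fourth moment is of order m^2, so dividing by m balances both summands and
    the second moment becomes linear in m.\<close>
  have pt: "x\<^sup>2 \<le> x ^ 4 / real m + real m" for x :: real
  proof -
    have "0 \<le> (x\<^sup>2 - real m)\<^sup>2 + x\<^sup>2 * real m" by simp
    also have "\<dots> = x ^ 4 + (real m)\<^sup>2 - x\<^sup>2 * real m" by (simp add: power2_diff)
    finally show ?thesis using assms by (simp add: field_simps power2_eq_square)
  qed
  have "{1..m} = {1..<1 + m}" by auto
  then have i2: "integrable M (\<lambda>\<omega>. (?S \<omega>)\<^sup>2)" using square_sum_window(1)[of 1 m] by simp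
  have "v m \<le> expectation (\<lambda>\<omega>. ?S \<omega> ^ 4 / real m + real m)"
    unfolding v_def by (rule integral_mono[OF i2 _ pt]) (use Y4 in auto)
  also have "\<dots> = expectation (\<lambda>\<omega>. ?S \<omega> ^ 4) / real m + real m" using Y4 by (simp add: prob_space)
  also have "\<dots> \<le> c4 * (real m)\<^sup>2 / real m + real m"
    using Y4(2) by (intro add_right_mono divide_right_mono) auto
  also have "\<dots> = (c4 + 1) * real m" using assms by (simp add: power2_eq_square algebra_simps)
  finally show "v m \<le> (c4 + 1) * real m" .
qed

end

section \<open>Mean squared error\<close>

lemma sum_times_sum:
  fixes F G :: "'b \<Rightarrow> 'b \<Rightarrow> real"
  shows "(\<Sum>a\<in>A. \<Sum>b\<in>A. F a b) * (\<Sum>c\<in>C. \<Sum>d\<in>C. G c d) = (\<Sum>a\<in>A. \<Sum>b\<in>A. \<Sum>c\<in>C. \<Sum>d\<in>C. F a b * G c d)"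
proof -
  have "(\<Sum>a\<in>A. \<Sum>b\<in>A. F a b) * S = (\<Sum>a\<in>A. \<Sum>b\<in>A. F a b * S)" for S
    by (simp only: sum_distrib_right)
  then have "(\<Sum>a\<in>A. \<Sum>b\<in>A. F a b) * (\<Sum>c\<in>C. \<Sum>d\<in>C. G c d) = (\<Sum>a\<in>A. \<Sum>b\<in>A. F a b * (\<Sum>c\<in>C. \<Sum>d\<in>C. G c d))" .
  then show ?thesis by (simp only: sum_distrib_left[of "F _ _"] sum_distrib_left[of "F _ _" "G _"])
qed

section \<open>Fluctuation of the squared block sums\<close>

context decomposed_process
begin

abbreviation T :: "nat \<Rightarrow> nat \<Rightarrow> nat \<Rightarrow> 'a \<Rightarrow> real" where
  "T n l j \<omega> \<equiv> block_sum h1 n l (sample \<omega>) j"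

abbreviation dev2 :: "nat \<Rightarrow> nat \<Rightarrow> nat \<Rightarrow> 'a \<Rightarrow> real" where
  "dev2 n l j \<omega> \<equiv> (T n l j \<omega>)\<^sup>2 - v l"

definition cA :: real where "cA = 2 * c4 + 2 * (c4 + 1)\<^sup>2"

lemma cA: "0 \<le> cA" using c4 by (simp add: cA_def)

lemma T_meas: "n \<ge> 1 \<Longrightarrow> l \<le> n \<Longrightarrow> j \<ge> 1 \<Longrightarrow> T n l j \<in> borel_measurable M"
  using window_ge[of n l j] by (simp add: block_sum_window) (intro borel_measurable_sum Y_meas, auto)

lemma dev2_square:
  assumes n: "n \<ge> 1" "1 \<le> l" "l \<le> n" "j \<ge> 1"
  shows "integrable M (\<lambda>\<omega>. (dev2 n l j \<omega>)\<^sup>2)" "expectation (\<lambda>\<omega>. (dev2 n l j \<omega>)\<^sup>2) \<le> cA * (real l)\<^sup>2"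
proof -
  note T4 = block_sum4[OF n(1,3,4)]
  note [measurable] = T_meas[OF n(1,3,4)]
  have pt: "(dev2 n l j \<omega>)\<^sup>2 \<le> 2 * T n l j \<omega> ^ 4 + 2 * (v l)\<^sup>2" for \<omega>
    using zero_le_power2[of "(T n l j \<omega>)\<^sup>2 + v l"] by (simp add: power2_sum power2_diff)
  have i: "integrable M (\<lambda>\<omega>. 2 * T n l j \<omega> ^ 4 + 2 * (v l)\<^sup>2)" using T4 by simp
  show 1: "integrable M (\<lambda>\<omega>. (dev2 n l j \<omega>)\<^sup>2)"
    by (rule Bochner_Integration.integrable_bound[OF i])
       (auto intro!: AE_I2 order_trans[OF pt] simp del: power2_diff)
  have "expectation (\<lambda>\<omega>. (dev2 n l j \<omega>)\<^sup>2) \<le> expectation (\<lambda>\<omega>. 2 * T n l j \<omega> ^ 4 + 2 * (v l)\<^sup>2)"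
    by (rule integral_mono[OF 1 i pt])
  also have "\<dots> = 2 * expectation (\<lambda>\<omega>. T n l j \<omega> ^ 4) + 2 * (v l)\<^sup>2" using T4 by (simp add: prob_space)
  also have "\<dots> \<le> 2 * (c4 * (real l)\<^sup>2) + 2 * ((c4 + 1) * real l)\<^sup>2"
    using T4(2) v_bounds[OF n(2)] by (intro add_mono mult_left_mono power_mono) auto
  also have "\<dots> = cA * (real l)\<^sup>2" 
    unfolding cA_def power_mult_distrib[of "c4 + 1"] by (simp only: distrib_right mult.assoc)
  finally show "expectation (\<lambda>\<omega>. (dev2 n l j \<omega>)\<^sup>2) \<le> cA * (real l)\<^sup>2" .
qed

lemma dev2_product:
  assumes n: "n \<ge> 1" "1 \<le> l" "l \<le> n" "j \<ge> 1" "k \<ge> 1"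
  shows "integrable M (\<lambda>\<omega>. dev2 n l j \<omega> * dev2 n l k \<omega>)"
    "\<bar>expectation (\<lambda>\<omega>. dev2 n l j \<omega> * dev2 n l k \<omega>)\<bar> \<le> cA * (real l)\<^sup>2"
proof -
  note dj = dev2_square[OF n(1-4)] and dk = dev2_square[OF n(1-3,5)]
  note [measurable] = T_meas[OF n(1,3,4)] T_meas[OF n(1,3,5)]
  have b: "\<bar>x * y\<bar> \<le> (x\<^sup>2 + y\<^sup>2) / 2" for x y :: real
    using zero_le_power2[of "\<bar>x\<bar> - \<bar>y\<bar>"] by (simp add: power2_diff abs_mult)
  have i: "integrable M (\<lambda>\<omega>. ((dev2 n l j \<omega>)\<^sup>2 + (dev2 n l k \<omega>)\<^sup>2) / 2)"
    by (intro integrable_divide Bochner_Integration.integrable_add dj dk)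
  show 1: "integrable M (\<lambda>\<omega>. dev2 n l j \<omega> * dev2 n l k \<omega>)"
    by (rule Bochner_Integration.integrable_bound[OF i]) (measurable, intro AE_I2, use b in simp)
  have "\<bar>expectation (\<lambda>\<omega>. dev2 n l j \<omega> * dev2 n l k \<omega>)\<bar> \<le> expectation (\<lambda>\<omega>. \<bar>dev2 n l j \<omega> * dev2 n l k \<omega>\<bar>)"
    by (rule integral_abs_bound)
  also have "\<dots> \<le> expectation (\<lambda>\<omega>. ((dev2 n l j \<omega>)\<^sup>2 + (dev2 n l k \<omega>)\<^sup>2) / 2)"
    by (rule integral_mono[OF integrable_abs[OF 1] i b])
  also have "\<dots> = (expectation (\<lambda>\<omega>. (dev2 n l j \<omega>)\<^sup>2) + expectation (\<lambda>\<omega>. (dev2 n l k \<omega>)\<^sup>2)) / 2"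
    by (simp only: Bochner_Integration.integral_add[OF dj(1) dk(1)] integral_divide_zero)
  also have "\<dots> \<le> cA * (real l)\<^sup>2" using dj(2) dk(2) by simp
  finally show "\<bar>expectation (\<lambda>\<omega>. dev2 n l j \<omega> * dev2 n l k \<omega>)\<bar> \<le> cA * (real l)\<^sup>2" .
qed

text \<open>Expanding both squares gives l^4 covariances of pairs across the gap. The gap is at
  least half the distance of the starts, hence 8 = 2^3, and each covariance is of the order of the
  squared kernel. One kernel factor absorbs one l because the distance exceeds l; the other is kept
  for the summation over starts.\<close>

lemma dev2_far:
  assumes l: "1 \<le> l" and j: "j \<ge> 1" and k: "j + 2 * l \<le> k" "k + l \<le> n + 1"
  shows "\<bar>expectation (\<lambda>\<omega>. dev2 n l j \<omega> * dev2 n l k \<omega>)\<bar> \<le> 8 * (2 * B + 8 * L) * real l ^ 3 * kern j k"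
proof -
  let ?J = "{j..<j + l}" and ?K = "{k..<k + l}" and ?d = "k - j" and ?C = "2 * B + 8 * L"
  have n1: "n \<ge> 1" "l \<le> n" "k \<ge> 1" "j + l \<le> n + 1" using l k j by auto
  have Tj: "T n l j \<omega> = (\<Sum>a\<in>?J. Y a \<omega>)" and Tk: "T n l k \<omega> = (\<Sum>a\<in>?K. Y a \<omega>)" for \<omega>
    using n1 j k by (simp_all add: block_sum_window window_no_wrap)
  \<comment> \<open>The gap from the last index of the first block, j + l - 1, to the first index of
    the second.\<close>
  define m where "m = k - (j + l - 1)"
  have m: "m \<ge> 1" "j + l - 1 + m = k" "?d \<le> 2 * m" using l k j by (auto simp: m_def)
  have sqj: "integrable M (\<lambda>\<omega>. (T n l j \<omega>)\<^sup>2)" "expectation (\<lambda>\<omega>. (T n l j \<omega>)\<^sup>2) = v l"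
    using square_sum_window[OF j, of l] unfolding Tj v_eq by auto
  have sqk: "integrable M (\<lambda>\<omega>. (T n l k \<omega>)\<^sup>2)" "expectation (\<lambda>\<omega>. (T n l k \<omega>)\<^sup>2) = v l"
    using square_sum_window[OF n1(3), of l] unfolding Tk v_eq by auto
  have prod: "(T n l j \<omega>)\<^sup>2 * (T n l k \<omega>)\<^sup>2 = (\<Sum>a\<in>?J. \<Sum>b\<in>?J. \<Sum>c\<in>?K. \<Sum>d\<in>?K. Y a \<omega> * Y b \<omega> * Y c \<omega> * Y d \<omega>)" for \<omega>
  proof -
    have "(T n l j \<omega>)\<^sup>2 = (\<Sum>a\<in>?J. \<Sum>b\<in>?J. Y a \<omega> * Y b \<omega>)" "(T n l k \<omega>)\<^sup>2 = (\<Sum>c\<in>?K. \<Sum>d\<in>?K. Y c \<omega> * Y d \<omega>)"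
      unfolding Tj Tk by (simp_all only: power2_eq_square sum_product)
    then have "(T n l j \<omega>)\<^sup>2 * (T n l k \<omega>)\<^sup>2
      = (\<Sum>a\<in>?J. \<Sum>b\<in>?J. \<Sum>c\<in>?K. \<Sum>d\<in>?K. (Y a \<omega> * Y b \<omega>) * (Y c \<omega> * Y d \<omega>))"
      by (simp only: sum_times_sum[of "\<lambda>a b. Y a \<omega> * Y b \<omega>" _ "\<lambda>a b. Y a \<omega> * Y b \<omega>"])
    then show ?thesis by (simp only: mult.assoc)
  qed
  have ge: "i \<ge> 1" if "i \<in> ?J \<union> ?K" for i using that j n1 by auto
  have i4: "integrable M (\<lambda>\<omega>. Y a \<omega> * Y b \<omega> * Y c \<omega> * Y d \<omega>)" if "a \<in> ?J" "b \<in> ?J" "c \<in> ?K" "d \<in> ?K" for a b c d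
    by (rule YYYY) (use that ge in auto)
  have pi: "integrable M (\<lambda>\<omega>. (T n l j \<omega>)\<^sup>2 * (T n l k \<omega>)\<^sup>2)"
    unfolding prod by (intro Bochner_Integration.integrable_sum i4)
  have ep: "expectation (\<lambda>\<omega>. (T n l j \<omega>)\<^sup>2 * (T n l k \<omega>)\<^sup>2)
    = (\<Sum>a\<in>?J. \<Sum>b\<in>?J. \<Sum>c\<in>?K. \<Sum>d\<in>?K. expectation (\<lambda>\<omega>. Y a \<omega> * Y b \<omega> * Y c \<omega> * Y d \<omega>))"
    unfolding prod
    by (subst Bochner_Integration.integral_sum, intro Bochner_Integration.integrable_sum i4, assumption+, rule sum.cong[OF refl])+
       (rule refl)
  have vj: "v l = (\<Sum>a\<in>?J. \<Sum>b\<in>?J. expectation (\<lambda>\<omega>. Y a \<omega> * Y b \<omega>))"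
  proof -
    have i: "integrable M (\<lambda>\<omega>. Y a \<omega> * Y b \<omega>)" if "a \<in> ?J" "b \<in> ?J" for a b
      by (rule YY(1)) (use that ge in auto)
    show ?thesis unfolding sqj(2)[symmetric] Tj power2_eq_square sum_product
      by (subst Bochner_Integration.integral_sum, intro Bochner_Integration.integrable_sum i, assumption+, rule sum.cong[OF refl])+
       (rule refl)
  qed
  have vk: "v l = (\<Sum>c\<in>?K. \<Sum>d\<in>?K. expectation (\<lambda>\<omega>. Y c \<omega> * Y d \<omega>))"
  proof -
    have i: "integrable M (\<lambda>\<omega>. Y a \<omega> * Y b \<omega>)" if "a \<in> ?K" "b \<in> ?K" for a b
      by (rule YY(1)) (use that ge in auto)
    show ?thesis unfolding sqk(2)[symmetric] Tk power2_eq_square sum_product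
      by (subst Bochner_Integration.integral_sum, intro Bochner_Integration.integrable_sum i, assumption+, rule sum.cong[OF refl])+
       (rule refl)
  qed
  have vv: "v l * v l = (\<Sum>a\<in>?J. \<Sum>b\<in>?J. \<Sum>c\<in>?K. \<Sum>d\<in>?K. expectation (\<lambda>\<omega>. Y a \<omega> * Y b \<omega>) * expectation (\<lambda>\<omega>. Y c \<omega> * Y d \<omega>))"
    by (rule trans[OF arg_cong2[where f="(*)", OF vj vk] sum_times_sum])
  have "expectation (\<lambda>\<omega>. dev2 n l j \<omega> * dev2 n l k \<omega>)
     = expectation (\<lambda>\<omega>. (T n l j \<omega>)\<^sup>2 * (T n l k \<omega>)\<^sup>2 - v l * (T n l j \<omega>)\<^sup>2 - v l * (T n l k \<omega>)\<^sup>2 + v l * v l)"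
    by (intro Bochner_Integration.integral_cong) (auto simp: algebra_simps)
  also have "\<dots> = expectation (\<lambda>\<omega>. (T n l j \<omega>)\<^sup>2 * (T n l k \<omega>)\<^sup>2) - v l * v l"
    using pi sqj sqk by (simp add: prob_space)
  also have "\<dots> = (\<Sum>a\<in>?J. \<Sum>b\<in>?J. \<Sum>c\<in>?K. \<Sum>d\<in>?K. expectation (\<lambda>\<omega>. Y a \<omega> * Y b \<omega> * Y c \<omega> * Y d \<omega>)
       - expectation (\<lambda>\<omega>. Y a \<omega> * Y b \<omega>) * expectation (\<lambda>\<omega>. Y c \<omega> * Y d \<omega>))"
    unfolding ep vv by (simp only: sum_subtractf)
  finally have eq: "expectation (\<lambda>\<omega>. dev2 n l j \<omega> * dev2 n l k \<omega>) = (\<Sum>a\<in>?J. \<Sum>b\<in>?J. \<Sum>c\<in>?K. \<Sum>d\<in>?K.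
       expectation (\<lambda>\<omega>. Y a \<omega> * Y b \<omega> * Y c \<omega> * Y d \<omega>)
       - expectation (\<lambda>\<omega>. Y a \<omega> * Y b \<omega>) * expectation (\<lambda>\<omega>. Y c \<omega> * Y d \<omega>))" .
  have "\<bar>expectation (\<lambda>\<omega>. dev2 n l j \<omega> * dev2 n l k \<omega>)\<bar> \<le> (\<Sum>a\<in>?J. \<Sum>b\<in>?J. \<Sum>c\<in>?K. \<Sum>d\<in>?K. ?C / real m ^ 3)"
    unfolding eq
  proof (rule order_trans[OF sum_abs], rule sum_mono, rule order_trans[OF sum_abs], rule sum_mono,
      rule order_trans[OF sum_abs], rule sum_mono, rule order_trans[OF sum_abs], rule sum_mono)
    fix a b c d assume "a \<in> ?J" "b \<in> ?J" "c \<in> ?K" "d \<in> ?K"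
    then show "\<bar>expectation (\<lambda>\<omega>. Y a \<omega> * Y b \<omega> * Y c \<omega> * Y d \<omega>)
       - expectation (\<lambda>\<omega>. Y a \<omega> * Y b \<omega>) * expectation (\<lambda>\<omega>. Y c \<omega> * Y d \<omega>)\<bar> \<le> ?C / real m ^ 3"
      using m j l by (intro product_covariance[OF bm1, of "j + l - 1"]) auto
  qed
  also have "\<dots> = real l ^ 4 * (?C / real m ^ 3)" by (simp add: power4_eq_xxxx)
  also have "\<dots> \<le> real l ^ 4 * (8 * ?C * (kern j k)\<^sup>2)"
  proof (intro mult_left_mono)
    have d1: "?d \<ge> 1" "\<bar>real j - real k\<bar> = real ?d" using k l by auto
    have "real ?d ^ 3 \<le> (2 * real m) ^ 3" using m by (intro power_mono) auto
    then have "1 / real m ^ 3 \<le> 8 * (1 / real ?d ^ 3)"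
      using m(1) d1(1) by (simp add: field_simps power_mult_distrib)
    then have "?C * (1 / real m ^ 3) \<le> ?C * (8 * (kern j k)\<^sup>2)"
      unfolding kern_square[OF d1] using B L by (intro mult_left_mono) auto
    moreover have "?C * (1 / real m ^ 3) = ?C / real m ^ 3" "?C * (8 * (kern j k)\<^sup>2) = 8 * ?C * (kern j k)\<^sup>2" by simp_all
    ultimately show "?C / real m ^ 3 \<le> 8 * ?C * (kern j k)\<^sup>2" by (simp only:)
  qed simp
  also have "\<dots> = 8 * ?C * real l ^ 3 * kern j k * (real l * kern j k)"
    by (simp add: power4_eq_xxxx power3_eq_cube power2_eq_square)
  also have "\<dots> \<le> 8 * ?C * real l ^ 3 * kern j k * 1"
  proof (intro mult_left_mono)
    have "real l * kern j k \<le> \<bar>real j - real k\<bar> * kern j k"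
      using k kern_pos[of j k] by (intro mult_right_mono) auto
    also have "\<dots> \<le> 1" by (rule kern_dist_le)
    finally show "real l * kern j k \<le> 1" .
  qed (use B L kern_pos[of j k] in auto)
  finally show ?thesis by simp
qed

definition cD :: real where "cD = 2 * (4 * cA + 8 * (2 * B + 8 * L) * kern_mass)"

lemma cD: "0 \<le> cD" "2 * cA \<le> cD"
  using cA B L kern_mass_pos by (simp_all add: cD_def)

text \<open>For a fixed start at most 4 l others are near, each contributing order l^2, and the
  distant ones add l^3 \<open>kern_mass\<close>. Rows are therefore of order l^3 and the total is n
  l^3. The blocks that wrap around add l^4.\<close>

lemma dev2_sum:
  assumes n: "n \<ge> 1" "1 \<le> l" "l \<le> n"
  shows "integrable M (\<lambda>\<omega>. (\<Sum>j=1..n. dev2 n l j \<omega>)\<^sup>2)"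
    "expectation (\<lambda>\<omega>. (\<Sum>j=1..n. dev2 n l j \<omega>)\<^sup>2) \<le> cD * (real n * real l ^ 3 + real l ^ 4)"
proof -
  \<comment> \<open>\<open>?N\<close> contains the starts of blocks that fit into the sample. The l
    - 1 starts in \<open>?W\<close> wrap around; there \<open>v l\<close> need not be the exact mean
    and no decay is used, since l^2 pairs at cost l^2 are affordable.\<close>
  let ?N = "{1..n + 1 - l}" and ?W = "{n + 2 - l..n}" and ?C = "8 * (2 * B + 8 * L)"
  have sq: "(\<Sum>j\<in>S. dev2 n l j \<omega>)\<^sup>2 = (\<Sum>j\<in>S. \<Sum>k\<in>S. dev2 n l j \<omega> * dev2 n l k \<omega>)" for S \<omega>
    by (simp only: power2_eq_square sum_product)
  have i: "integrable M (\<lambda>\<omega>. (\<Sum>j\<in>S. dev2 n l j \<omega>)\<^sup>2)" and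
    e: "expectation (\<lambda>\<omega>. (\<Sum>j\<in>S. dev2 n l j \<omega>)\<^sup>2) = (\<Sum>j\<in>S. \<Sum>k\<in>S. expectation (\<lambda>\<omega>. dev2 n l j \<omega> * dev2 n l k \<omega>))"
    if "S \<subseteq> {1..n}" for S
  proof -
    have p: "integrable M (\<lambda>\<omega>. dev2 n l j \<omega> * dev2 n l k \<omega>)" if "j \<in> S" "k \<in> S" for j k
      by (rule dev2_product(1)[OF n]) (use that \<open>S \<subseteq> {1..n}\<close> in auto)
    show "integrable M (\<lambda>\<omega>. (\<Sum>j\<in>S. dev2 n l j \<omega>)\<^sup>2)"
      unfolding sq by (intro Bochner_Integration.integrable_sum p)
    show "expectation (\<lambda>\<omega>. (\<Sum>j\<in>S. dev2 n l j \<omega>)\<^sup>2) = (\<Sum>j\<in>S. \<Sum>k\<in>S. expectation (\<lambda>\<omega>. dev2 n l j \<omega> * dev2 n l k \<omega>))"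
      unfolding sq
      by (subst Bochner_Integration.integral_sum, intro Bochner_Integration.integrable_sum p, assumption+, rule sum.cong[OF refl])+
         (rule refl)
  qed
  show "integrable M (\<lambda>\<omega>. (\<Sum>j=1..n. dev2 n l j \<omega>)\<^sup>2)" by (rule i) simp
  have NW: "?N \<subseteq> {1..n}" "?W \<subseteq> {1..n}" "?N \<inter> ?W = {}" "?N \<union> ?W = {1..n}" using n by auto
  have EN: "expectation (\<lambda>\<omega>. (\<Sum>j\<in>?N. dev2 n l j \<omega>)\<^sup>2) \<le> real n * ((4 * cA + ?C * kern_mass) * real l ^ 3)"
  proof -
    have row: "(\<Sum>k\<in>?N. expectation (\<lambda>\<omega>. dev2 n l j \<omega> * dev2 n l k \<omega>)) \<le> (4 * cA + ?C * kern_mass) * real l ^ 3"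
      if j: "j \<in> ?N" for j
    proof -
      let ?near = "{k \<in> ?N. k < j + 2 * l \<and> j < k + 2 * l}"
      have pt: "expectation (\<lambda>\<omega>. dev2 n l j \<omega> * dev2 n l k \<omega>)
        \<le> (if k < j + 2 * l \<and> j < k + 2 * l then cA * (real l)\<^sup>2 else 0) + ?C * real l ^ 3 * kern k j" if k: "k \<in> ?N" for k
      proof -
        have pos: "0 \<le> ?C * real l ^ 3 * kern k j"
          using B L kern_pos[of k j] by (intro mult_nonneg_nonneg) auto
        have fit: "k + l \<le> n + 1" "j + l \<le> n + 1" "1 \<le> j" "1 \<le> k" using j k n by auto
        consider "k < j + 2 * l \<and> j < k + 2 * l" | "j + 2 * l \<le> k" | "k + 2 * l \<le> j" by linarith
        then show ?thesis
        proof cases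
          case 1
          then show ?thesis using dev2_product(2)[OF n, of j k] j k pos by auto
        next
          case 2
          then show ?thesis using dev2_far[OF n(2) fit(3) 2 fit(1)] kern_sym[of j k] by auto
        next
          case 3
          then show ?thesis using dev2_far[OF n(2) fit(4) 3 fit(2)] by (auto simp: mult.commute)
        qed
      qed
      have "(\<Sum>k\<in>?N. expectation (\<lambda>\<omega>. dev2 n l j \<omega> * dev2 n l k \<omega>))
        \<le> (\<Sum>k\<in>?N. (if k < j + 2 * l \<and> j < k + 2 * l then cA * (real l)\<^sup>2 else 0) + ?C * real l ^ 3 * kern k j)"
        by (intro sum_mono pt)
      also have "\<dots> = real (card ?near) * (cA * (real l)\<^sup>2) + ?C * real l ^ 3 * (\<Sum>k\<in>?N. kern k j)"
        unfolding sum.distrib sum_distrib_left by (simp add: sum.inter_filter[symmetric])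
      also have "\<dots> \<le> (4 * real l) * (cA * (real l)\<^sup>2) + ?C * real l ^ 3 * kern_mass"
      proof (intro add_mono mult_right_mono mult_left_mono sum_kern_le)
        have "?near \<subseteq> {j + 1 - 2 * l..<j + 2 * l}" by auto
        then have "card ?near \<le> card {j + 1 - 2 * l..<j + 2 * l}" by (intro card_mono) auto
        also have "\<dots> \<le> 4 * l" by simp
        finally show "real (card ?near) \<le> 4 * real l" by linarith
      qed (use cA B L in auto)
      also have "\<dots> = (4 * cA + ?C * kern_mass) * real l ^ 3"
        by (simp add: algebra_simps power3_eq_cube power2_eq_square)
      finally show ?thesis .
    qed
    have "expectation (\<lambda>\<omega>. (\<Sum>j\<in>?N. dev2 n l j \<omega>)\<^sup>2) \<le> (\<Sum>j\<in>?N. (4 * cA + ?C * kern_mass) * real l ^ 3)"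
      unfolding e[OF NW(1)] by (intro sum_mono row)
    also have "\<dots> \<le> real n * ((4 * cA + ?C * kern_mass) * real l ^ 3)"
      unfolding sum_constant using n cA B L kern_mass_pos by (intro mult_right_mono) auto
    finally show ?thesis .
  qed
  have EW: "expectation (\<lambda>\<omega>. (\<Sum>j\<in>?W. dev2 n l j \<omega>)\<^sup>2) \<le> cA * real l ^ 4"
  proof -
    have "expectation (\<lambda>\<omega>. (\<Sum>j\<in>?W. dev2 n l j \<omega>)\<^sup>2) \<le> (\<Sum>j\<in>?W. \<Sum>k\<in>?W. cA * (real l)\<^sup>2)"
      unfolding e[OF NW(2)] using NW(2)
      by (intro sum_mono order_trans[OF abs_ge_self dev2_product(2)[OF n]]) auto
    also have "\<dots> = (real (card ?W) * real (card ?W)) * (cA * (real l)\<^sup>2)"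
      by (simp only: sum_constant mult.assoc)
    also have "\<dots> \<le> (real l * real l) * (cA * (real l)\<^sup>2)"
      using n cA by (intro mult_right_mono mult_mono) auto
    also have "\<dots> = cA * real l ^ 4" by (simp add: power4_eq_xxxx power2_eq_square)
    finally show ?thesis .
  qed
  have pt: "(\<Sum>j=1..n. dev2 n l j \<omega>)\<^sup>2 \<le> 2 * (\<Sum>j\<in>?N. dev2 n l j \<omega>)\<^sup>2 + 2 * (\<Sum>j\<in>?W. dev2 n l j \<omega>)\<^sup>2" for \<omega>
  proof -
    have "(\<Sum>j=1..n. dev2 n l j \<omega>) = (\<Sum>j\<in>?N. dev2 n l j \<omega>) + (\<Sum>j\<in>?W. dev2 n l j \<omega>)"
      using sum.union_disjoint[OF _ _ NW(3), of "\<lambda>j. dev2 n l j \<omega>"] unfolding NW(4) by simp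
    moreover have "(x + y)\<^sup>2 \<le> 2 * x\<^sup>2 + 2 * y\<^sup>2" for x y :: real
      using zero_le_power2[of "x - y"] by (simp add: power2_sum power2_diff)
    ultimately show ?thesis by simp
  qed
  have "expectation (\<lambda>\<omega>. (\<Sum>j=1..n. dev2 n l j \<omega>)\<^sup>2)
    \<le> expectation (\<lambda>\<omega>. 2 * (\<Sum>j\<in>?N. dev2 n l j \<omega>)\<^sup>2 + 2 * (\<Sum>j\<in>?W. dev2 n l j \<omega>)\<^sup>2)"
    by (intro integral_mono[OF i _ pt] Bochner_Integration.integrable_add integrable_mult_right i NW) simp
  also have "\<dots> = 2 * expectation (\<lambda>\<omega>. (\<Sum>j\<in>?N. dev2 n l j \<omega>)\<^sup>2) + 2 * expectation (\<lambda>\<omega>. (\<Sum>j\<in>?W. dev2 n l j \<omega>)\<^sup>2)"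
    by (simp only: Bochner_Integration.integral_add[OF integrable_mult_right[OF i[OF NW(1)]] integrable_mult_right[OF i[OF NW(2)]]]
        integral_mult_right_zero)
  also have "\<dots> \<le> 2 * (real n * ((4 * cA + ?C * kern_mass) * real l ^ 3)) + 2 * (cA * real l ^ 4)"
    using EN EW by simp
  also have "\<dots> = cD * (real n * real l ^ 3) + (2 * cA) * real l ^ 4" by (simp add: cD_def)
  also have "\<dots> \<le> cD * (real n * real l ^ 3) + cD * real l ^ 4"
    by (intro add_left_mono mult_right_mono cD) simp
  finally show "expectation (\<lambda>\<omega>. (\<Sum>j=1..n. dev2 n l j \<omega>)\<^sup>2) \<le> cD * (real n * real l ^ 3 + real l ^ 4)"
    by (simp add: distrib_left)
qed

text \<open>The linear part has variance exactly 4 v(n)/n and the degenerate part has variance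
  O(1/n). Taking \<eta> = 1/l keeps the covariance within the order 1/l of the bias, at the price of
  l times 1/n.\<close>

lemma U_variance_approx:
  assumes n: "n \<ge> 2" and l: "l \<ge> 1"
  shows "\<bar>U_variance M X h n - 4 * (v n / real n)\<bar> \<le> 32 * c4 * (real l / real n) + 4 * (c4 + 1) / real l"
proof -
  let ?P = "{(i, j). 1 \<le> i \<and> i < j \<and> j \<le> n}" and ?c = "sqrt (real n) * \<theta>"
  define f where "f \<omega> = 2 / sqrt (real n) * (\<Sum>i=1..n. Y i \<omega>)" for \<omega>
  define g where "g \<omega> = sqrt (real n) * U_stat h2 n (sample \<omega>)" for \<omega>
  have sn: "sqrt (real n) * (2 / real n) = 2 / sqrt (real n)" using n by (simp add: field_simps)
  have U: "sqrt (real n) * U_stat h n (sample \<omega>) = ?c + f \<omega> + g \<omega>" for \<omega>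
    unfolding U_stat_decomposition[OF n dec] f_def g_def sn[symmetric] by (simp add: distrib_left mult.assoc)
  have PS: "?P \<subseteq> {1..n} \<times> {1..n}" "finite ?P" by (auto intro: finite_subset[of _ "{1..n} \<times> {1..n}"])
  have sub: "{1..n} \<subseteq> {1..}" by auto
  note q = second_moment_pair_sum[OF bm2 dg2 sym2 L finite_atLeastAtMost sub PS(1)]
  let ?Q = "\<lambda>\<omega>. \<Sum>(i, j)\<in>?P. h2 (X i \<omega>) (X j \<omega>)"
  have fm: "f \<in> borel_measurable M" unfolding f_def by (intro borel_measurable_times borel_measurable_sum borel_measurable_const Y_meas) auto
  have Qm: "?Q \<in> borel_measurable M"
    unfolding case_prod_beta' by (intro borel_measurable_sum h2_meas) auto
  have gm: "g \<in> borel_measurable M" unfolding g_def U_stat_def using Qm by measurable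
  have f2: "(f \<omega>)\<^sup>2 = 4 / real n * (\<Sum>i=1..n. Y i \<omega>)\<^sup>2" for \<omega>
    by (simp add: f_def power_mult_distrib power_divide)
  have "{1..n} = {1..<1 + n}" by auto
  then have i2: "integrable M (\<lambda>\<omega>. (\<Sum>i=1..n. Y i \<omega>)\<^sup>2)" using square_sum_window(1)[of 1 n] by simp
  have fi: "integrable M (\<lambda>\<omega>. (f \<omega>)\<^sup>2)" unfolding f2 by (intro integrable_mult_right i2)
  have g2: "(g \<omega>)\<^sup>2 = 4 / (real n * (real n - 1)\<^sup>2) * (?Q \<omega>)\<^sup>2" for \<omega>
  proof -
    have "(g \<omega>)\<^sup>2 = real n * (4 / ((real n)\<^sup>2 * (real n - 1)\<^sup>2)) * (?Q \<omega>)\<^sup>2"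
      unfolding g_def U_stat_def power_mult_distrib power_divide by simp
    also have "real n * (4 / ((real n)\<^sup>2 * (real n - 1)\<^sup>2)) = 4 / (real n * (real n - 1)\<^sup>2)"
      using n by (simp add: power2_eq_square)
    finally show ?thesis .
  qed
  have gi: "integrable M (\<lambda>\<omega>. (g \<omega>)\<^sup>2)" unfolding g2 by (intro integrable_mult_right q(1))
  have EY: "expectation (Y i) = 0" if "i \<ge> 1" for i
    using dg1 that by (auto simp: degenerate_def)
  have Yi: "integrable M (Y i)" if "i \<ge> 1" for i
    by (rule square_integrable_imp_integrable[OF Y_meas[OF that]]) (use YY(1)[OF that that] in \<open>simp add: power2_eq_square\<close>)
  have Ef: "expectation f = 0"
    unfolding f_def using Yi EY by simp
  have Vf: "variance f = 4 * (v n / real n)"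
    unfolding Ef v_def by (simp add: f2)
  have Vg: "variance g \<le> 16 * c4 / real n"
  proof -
    have "variance g \<le> expectation (\<lambda>\<omega>. (g \<omega> - 0)\<^sup>2)" by (rule variance_le_second_moment[OF gm gi])
    also have "\<dots> = 4 / (real n * (real n - 1)\<^sup>2) * expectation (\<lambda>\<omega>. (?Q \<omega>)\<^sup>2)" unfolding diff_zero g2 by simp
    \<comment> \<open>For n >= 2 one has n - 1 >= n/2.\<close>
    also have "\<dots> \<le> 4 / (real n * (real n / 2)\<^sup>2) * (c4 * (real n)\<^sup>2)"
      using q(2) n c4 by (intro mult_mono frac_le mult_left_mono power_mono mult_pos_pos) (auto simp: c4_def c0_def)
    also have "\<dots> = 16 * c4 / real n" using n by (simp add: power2_eq_square)
    finally show ?thesis .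
  qed
  have l0: "0 < 1 / real l" using l by simp
  have "\<bar>variance (\<lambda>\<omega>. ?c + f \<omega> + g \<omega>) - variance f\<bar> \<le> (1 + 1 / (1 / real l)) * variance g + 1 / real l * variance f"
    by (rule variance_perturbation[OF fm fi gm gi l0])
  also have "\<dots> \<le> (2 * real l) * (16 * c4 / real n) + 1 / real l * (4 * (c4 + 1))"
  proof (intro add_mono mult_mono Vg)
    have "v n / real n \<le> c4 + 1" using v_bounds[of n] n by (simp add: field_simps)
    then show "variance f \<le> 4 * (c4 + 1)" unfolding Vf by simp
  qed (use l c4 in \<open>auto intro: integral_nonneg\<close>)
  also have "\<dots> = 32 * c4 * (real l / real n) + 4 * (c4 + 1) / real l" by simp
  finally show ?thesis unfolding U_variance_def U Vf .
qed


section \<open>Collecting the error terms\<close>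

abbreviation GG :: "nat \<Rightarrow> nat \<Rightarrow> 'a \<Rightarrow> nat \<Rightarrow> nat \<Rightarrow> real" where
  "GG n l \<omega> \<equiv> block_pair_sum h2 n l (sample \<omega>)"

abbreviation DD :: "nat \<Rightarrow> nat \<Rightarrow> 'a \<Rightarrow> nat \<Rightarrow> real" where
  "DD n l \<omega> \<equiv> block_diag h2 n l (sample \<omega>)"

definition pair_moment4 where "pair_moment4 n l \<omega> = avg n (\<lambda>k. avg n (\<lambda>j. GG n l \<omega> j k ^ 4))"
definition margin_moment4 where "margin_moment4 n l \<omega> = avg n (\<lambda>j. avg n (GG n l \<omega> j) ^ 4)"
definition diag_moment4 where "diag_moment4 n l \<omega> = avg n (\<lambda>j. DD n l \<omega> j ^ 4)"
definition block_moment4 where "block_moment4 n l \<omega> = avg n (\<lambda>j. T n l j \<omega> ^ 4)"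
definition dev2_total where "dev2_total n l \<omega> = (\<Sum>j=1..n. dev2 n l j \<omega>)\<^sup>2"
definition mean_moment4 where "mean_moment4 n l \<omega> = avg n (block_sum h1 n l (sample \<omega>)) ^ 4"

definition c5 :: real where "c5 = 8 * c4 + 8 * (1 + 4 * L)"

lemma averages_moments:
  assumes n: "n \<ge> 1" "1 \<le> l" "l \<le> n"
  shows "integrable M (pair_moment4 n l)" "expectation (pair_moment4 n l) \<le> c4 * real l ^ 6"
    "integrable M (margin_moment4 n l)" "expectation (margin_moment4 n l) \<le> c4 * real l ^ 8 / (real n)\<^sup>2"
    "integrable M (diag_moment4 n l)" "expectation (diag_moment4 n l) \<le> c5 * real l ^ 6"
    "integrable M (block_moment4 n l)" "expectation (block_moment4 n l) \<le> c4 * (real l)\<^sup>2"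
    "integrable M (dev2_total n l)" "expectation (dev2_total n l) \<le> cD * (real n * real l ^ 3 + real l ^ 4)"
    "integrable M (mean_moment4 n l)" "expectation (mean_moment4 n l) \<le> c4 * real l ^ 4 / (real n)\<^sup>2"
proof -
  have g: "integrable M (\<lambda>\<omega>. avg n (\<lambda>j. GG n l \<omega> j k ^ 4))"
      "expectation (\<lambda>\<omega>. avg n (\<lambda>j. GG n l \<omega> j k ^ 4)) \<le> c4 * real l ^ 6" if "k \<in> {1..n}" for k
    by (rule avg_expectation[OF n(1), where C="c4 * real l ^ 6"]; use block_pair_sum4[OF n(1,3)] that in simp)+
  show "integrable M (pair_moment4 n l)" "expectation (pair_moment4 n l) \<le> c4 * real l ^ 6"
    unfolding pair_moment4_def by (rule avg_expectation[OF n(1) g]; assumption)+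
  show "integrable M (margin_moment4 n l)" "expectation (margin_moment4 n l) \<le> c4 * real l ^ 8 / (real n)\<^sup>2"
    unfolding margin_moment4_def
    by (rule avg_expectation[OF n(1), where C="c4 * real l ^ 8 / (real n)\<^sup>2"]; use avg_block_pair_sum4[OF n(1,3)] in simp)+
  show "integrable M (diag_moment4 n l)" "expectation (diag_moment4 n l) \<le> c5 * real l ^ 6"
    unfolding diag_moment4_def
    by (rule avg_expectation[OF n(1), where C="c5 * real l ^ 6"]; use block_diag4[OF n(1,3)] in \<open>simp add: c5_def\<close>)+
  show "integrable M (block_moment4 n l)" "expectation (block_moment4 n l) \<le> c4 * (real l)\<^sup>2"
    unfolding block_moment4_def
    by (rule avg_expectation[OF n(1), where C="c4 * (real l)\<^sup>2"]; use block_sum4[OF n(1,3)] in simp)+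
  show "integrable M (dev2_total n l)" "expectation (dev2_total n l) \<le> cD * (real n * real l ^ 3 + real l ^ 4)"
    unfolding dev2_total_def using dev2_sum[OF n] by auto
  have sub: "{1..n} \<subseteq> {1..}" by auto
  note Y4 = Y_sum4[OF finite_atLeastAtMost sub]
  have e: "mean_moment4 n l \<omega> = (real l / real n) ^ 4 * (\<Sum>i=1..n. Y i \<omega>) ^ 4" for \<omega>
    unfolding mean_moment4_def avg_block_sum[OF n(1)] by (rule power_mult_distrib)
  show "integrable M (mean_moment4 n l)" unfolding e by (intro integrable_mult_right Y4)
  have "expectation (mean_moment4 n l) = (real l / real n) ^ 4 * expectation (\<lambda>\<omega>. (\<Sum>i=1..n. Y i \<omega>) ^ 4)"
    unfolding e by simp
  also have "\<dots> \<le> (real l / real n) ^ 4 * (c4 * (real n)\<^sup>2)"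
    using Y4(2) by (intro mult_left_mono) auto
  also have "\<dots> = c4 * real l ^ 4 / (real n)\<^sup>2"
  proof -
    have "(u / w) ^ 4 * (c * w\<^sup>2) = c * u ^ 4 / w\<^sup>2" if "w \<noteq> 0" for u w c :: real
      using that by (simp add: power_divide field_simps power_add[symmetric])
    then show ?thesis using n by simp
  qed
  finally show "expectation (mean_moment4 n l) \<le> c4 * real l ^ 4 / (real n)\<^sup>2" .
qed

text \<open>With b l comparable to n, the three terms have weights (l/n), 1 and (l/n)^2 over l^3.
  The numbers arise from (z - 1)^2 >= z^2/4 and 1/b <= 2 l/n, giving 1024, 64 and 64; they are then
  squared, with a factor 3 for the square of a sum of three. By \<open>averages_moments\<close> the
  first two squares are in expectation of order (l/n)^2 and the third of order (l/n)^4.\<close>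

lemma remainder_bound_square:
  assumes n: "n \<ge> 2" "1 \<le> l" "l \<le> n"
  defines "x \<equiv> real l" and "N \<equiv> real n"
  shows "0 \<le> remainder_bound h2 n l (n div l) (sample \<omega>)"
    "(remainder_bound h2 n l (n div l) (sample \<omega>))\<^sup>2
      \<le> 3 / x ^ 6 * (1048576 * (x / N)\<^sup>2 * pair_moment4 n l \<omega> + 4096 * margin_moment4 n l \<omega> + 4096 * (x / N) ^ 4 * diag_moment4 n l \<omega>)"
proof -
  define b where "b = n div l"
  define P where "P = avg n (\<lambda>k. avg n (\<lambda>j. (GG n l \<omega> j k)\<^sup>2))"
  define Q where "Q = avg n (\<lambda>j. (avg n (GG n l \<omega> j))\<^sup>2)"
  define R where "R = avg n (\<lambda>j. (DD n l \<omega> j)\<^sup>2)"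
  have pos: "0 \<le> P" "0 \<le> Q" "0 \<le> R" unfolding P_def Q_def R_def by (intro avg_nonneg; simp)+
  have p4: "(y\<^sup>2)\<^sup>2 = y ^ 4" for y :: real by simp
  have P2: "P\<^sup>2 \<le> pair_moment4 n l \<omega>"
    unfolding P_def pair_moment4_def p4[symmetric] by (rule order_trans[OF avg_square_le]) (intro avg_mono avg_square_le)
  have Q2: "Q\<^sup>2 \<le> margin_moment4 n l \<omega>" unfolding Q_def margin_moment4_def p4[symmetric] by (rule avg_square_le)
  have R2: "R\<^sup>2 \<le> diag_moment4 n l \<omega>" unfolding R_def diag_moment4_def p4[symmetric] by (rule avg_square_le)
  have x: "1 \<le> x" "2 \<le> N" using n by (auto simp: x_def N_def)
  have b1: "b \<ge> 1" using n div_greater_zero_iff[of n l] by (simp add: b_def)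
  have nb: "n = b * l + n mod l" by (simp add: b_def)
  have modl: "n mod l < l" using n by simp
  \<comment> \<open>Needed below for z - 1 >= z/2 with z = b l.\<close>
  have bl2: "b * l \<ge> 2"
  proof (cases "l = 1")
    case True
    then show ?thesis using n by (simp add: b_def)
  next
    case False
    then have "2 \<le> l" using n by simp
    also have "l \<le> b * l" using b1 by simp
    finally show ?thesis .
  qed
  \<comment> \<open>The part of n not covered by full blocks is shorter than l, hence shorter than b
    l.\<close>
  have "n \<le> 2 * (b * l)" using nb modl b1 by (metis add_le_mono less_imp_le mult_2 mult_le_mono1 nat_mult_1 le_trans order_refl)
  then have Nb: "N \<le> 2 * (real b * x)" unfolding N_def x_def by (metis of_nat_le_iff of_nat_mult of_nat_numeral)
  have bp: "0 < real b" using b1 by simp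
  have inv_b: "1 / real b \<le> 2 * (x / N)" using Nb bp x by (simp add: field_simps)
  let ?V = "remainder_bound h2 n l b (sample \<omega>)"
  let ?S = "128 * (real b)\<^sup>2 * P + 16 * real b ^ 3 * Q + 4 * real b * R"
  define z where "z = real b * x"
  have z2: "z \<ge> 2" using bl2 unfolding z_def x_def by (metis of_nat_le_iff of_nat_mult of_nat_numeral)
  have V: "?V = ?S / (z * (z - 1)\<^sup>2)"
    unfolding remainder_bound_def P_def Q_def R_def z_def x_def by simp
  have S0: "0 \<le> ?S" using pos by (intro add_nonneg_nonneg mult_nonneg_nonneg) auto
  show nonneg: "0 \<le> remainder_bound h2 n l (n div l) (sample \<omega>)"
    unfolding b_def[symmetric] V using S0 z2 by (intro divide_nonneg_nonneg mult_nonneg_nonneg) auto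
  have "?V \<le> ?S / (z * (z / 2)\<^sup>2)"
    unfolding V using S0 z2 by (intro divide_left_mono mult_left_mono power_mono mult_pos_pos) auto
  also have "\<dots> = (512 * (1 / real b) * P + 64 * Q + 16 * (1 / real b)\<^sup>2 * R) / x ^ 3"
    using bp x unfolding z_def by (simp add: field_simps power2_eq_square power3_eq_cube)
  also have "\<dots> \<le> (512 * (2 * (x / N)) * P + 64 * Q + 16 * (2 * (x / N))\<^sup>2 * R) / x ^ 3"
    using inv_b pos bp x by (intro divide_right_mono add_mono mult_right_mono mult_left_mono power_mono) auto
  finally have "?V \<le> (1024 * (x / N) * P + 64 * Q + 64 * (x / N)\<^sup>2 * R) / x ^ 3"
    by (simp add: power2_eq_square)
  then have "?V\<^sup>2 \<le> ((1024 * (x / N) * P + 64 * Q + 64 * (x / N)\<^sup>2 * R) / x ^ 3)\<^sup>2"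
    using nonneg by (intro power_mono) (auto simp: b_def)
  also have "\<dots> = (1024 * (x / N) * P + 64 * Q + 64 * (x / N)\<^sup>2 * R)\<^sup>2 / x ^ 6"
    by (simp add: power_divide)
  also have "\<dots> \<le> (3 * ((1024 * (x / N) * P)\<^sup>2 + (64 * Q)\<^sup>2 + (64 * (x / N)\<^sup>2 * R)\<^sup>2)) / x ^ 6"
  proof (intro divide_right_mono)
    have "(u + w + t)\<^sup>2 \<le> 3 * (u\<^sup>2 + w\<^sup>2 + t\<^sup>2)" for u w t :: real
    proof -
      have "0 \<le> (u - w)\<^sup>2 + (u - t)\<^sup>2 + (w - t)\<^sup>2" by simp
      then show ?thesis by (simp add: power2_eq_square algebra_simps)
    qed
    then show "(1024 * (x / N) * P + 64 * Q + 64 * (x / N)\<^sup>2 * R)\<^sup>2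
      \<le> 3 * ((1024 * (x / N) * P)\<^sup>2 + (64 * Q)\<^sup>2 + (64 * (x / N)\<^sup>2 * R)\<^sup>2)" .
  qed (use x in auto)
  also have "\<dots> = 3 / x ^ 6 * (1048576 * (x / N)\<^sup>2 * P\<^sup>2 + 4096 * Q\<^sup>2 + 4096 * (x / N) ^ 4 * R\<^sup>2)"
    unfolding power_mult_distrib p4 by simp
  also have "\<dots> \<le> 3 / x ^ 6 * (1048576 * (x / N)\<^sup>2 * pair_moment4 n l \<omega> + 4096 * margin_moment4 n l \<omega> + 4096 * (x / N) ^ 4 * diag_moment4 n l \<omega>)"
    using P2 Q2 R2 x by (intro mult_left_mono add_mono) auto
  finally show "(remainder_bound h2 n l (n div l) (sample \<omega>))\<^sup>2
      \<le> 3 / x ^ 6 * (1048576 * (x / N)\<^sup>2 * pair_moment4 n l \<omega> + 4096 * margin_moment4 n l \<omega> + 4096 * (x / N) ^ 4 * diag_moment4 n l \<omega>)"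
    unfolding b_def .
qed

text \<open>The second bound has expectation O(1) and serves for the term multiplied by \<eta>. The
  third is the actual fluctuation: the mean of \<open>dev2\<close> over all starts and the squared
  bootstrap mean.\<close>

lemma linear_variance_bounds:
  assumes n: "n \<ge> 2" "1 \<le> l" "l \<le> n"
  defines "x \<equiv> real l" and "N \<equiv> real n"
  shows "0 \<le> linear_variance h1 n l (sample \<omega>)"
    "(linear_variance h1 n l (sample \<omega>))\<^sup>2 \<le> 16 / x\<^sup>2 * block_moment4 n l \<omega>"
    "(linear_variance h1 n l (sample \<omega>) - 4 * (v l / x))\<^sup>2 \<le> 32 / x\<^sup>2 * (dev2_total n l \<omega> / N\<^sup>2 + mean_moment4 n l \<omega>)"
proof -
  let ?V = "linear_variance h1 n l (sample \<omega>)"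
  let ?A = "avg n (\<lambda>j. (T n l j \<omega>)\<^sup>2)" and ?m = "avg n (block_sum h1 n l (sample \<omega>))"
  have x: "1 \<le> x" "2 \<le> N" using n by (auto simp: x_def N_def)
  have V: "?V = 4 / x * (?A - ?m\<^sup>2)" by (simp add: linear_variance_def x_def)
  have "?m\<^sup>2 \<le> ?A" by (rule avg_square_le)
  then show V0: "0 \<le> ?V" unfolding V using x by simp
  have p4: "(y\<^sup>2)\<^sup>2 = y ^ 4" for y :: real by simp
  have "?V\<^sup>2 \<le> (4 / x * ?A)\<^sup>2" using V0 x by (intro power_mono) (auto simp: V intro!: divide_right_mono)
  also have "\<dots> = 16 / x\<^sup>2 * ?A\<^sup>2" unfolding power_mult_distrib power_divide by simp
  also have "\<dots> \<le> 16 / x\<^sup>2 * block_moment4 n l \<omega>"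
    unfolding block_moment4_def p4[symmetric] by (intro mult_left_mono avg_square_le) auto
  finally show "?V\<^sup>2 \<le> 16 / x\<^sup>2 * block_moment4 n l \<omega>" .
  have A: "?A - v l = (\<Sum>j=1..n. dev2 n l j \<omega>) / N"
    using n by (simp add: avg_def N_def sum_subtractf diff_divide_distrib)
  have "?V - 4 * (v l / x) = 4 / x * ((\<Sum>j=1..n. dev2 n l j \<omega>) / N - ?m\<^sup>2)"
    unfolding V A[symmetric] using x by (simp add: field_simps)
  moreover have "(4 / x * y)\<^sup>2 = 16 / x\<^sup>2 * y\<^sup>2" for y
    by (simp add: power_mult_distrib power_divide)
  ultimately have "(?V - 4 * (v l / x))\<^sup>2 = 16 / x\<^sup>2 * ((\<Sum>j=1..n. dev2 n l j \<omega>) / N - ?m\<^sup>2)\<^sup>2"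
    by (simp only:)
  also have "\<dots> \<le> 16 / x\<^sup>2 * (2 * (((\<Sum>j=1..n. dev2 n l j \<omega>) / N)\<^sup>2 + (?m\<^sup>2)\<^sup>2))"
  proof (intro mult_left_mono)
    have "(u - w)\<^sup>2 \<le> 2 * (u\<^sup>2 + w\<^sup>2)" for u w :: real
      using zero_le_power2[of "u + w"] by (simp add: power2_sum power2_diff)
    then show "((\<Sum>j=1..n. dev2 n l j \<omega>) / N - ?m\<^sup>2)\<^sup>2 \<le> 2 * (((\<Sum>j=1..n. dev2 n l j \<omega>) / N)\<^sup>2 + (?m\<^sup>2)\<^sup>2)" .
  qed simp
  also have "\<dots> = 32 / x\<^sup>2 * (dev2_total n l \<omega> / N\<^sup>2 + mean_moment4 n l \<omega>)"
    unfolding dev2_total_def mean_moment4_def power_divide p4 by simp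
  finally show "(?V - 4 * (v l / x))\<^sup>2 \<le> 32 / x\<^sup>2 * (dev2_total n l \<omega> / N\<^sup>2 + mean_moment4 n l \<omega>)" .
qed

definition cV :: real where "cV = 24 * c0 * kern_mass + 32 * c4 * 8 + 4 * (c4 + 1)"

text \<open>The condition l^3 <= 8 n makes l/n at most 8/l, so the degenerate contribution joins the
  bias of order 1/l. The three summands of \<open>cV\<close> are the three constants met
  here.\<close>

lemma bias_bound:
  assumes n: "n \<ge> 2" "1 \<le> l" "l \<le> n" and ln: "real l ^ 3 \<le> 8 * real n"
  shows "\<bar>4 * (v l / real l) - U_variance M X h n\<bar> \<le> cV / real l"
proof -
  have "real l * real l \<le> real l ^ 3" using n by (simp add: power3_eq_cube)
  then have "real l / real n \<le> 8 / real l" using ln n by (simp add: field_simps)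
  then have "32 * c4 * (real l / real n) \<le> 32 * c4 * (8 / real l)" using c4 by (intro mult_left_mono) auto
  then have "\<bar>U_variance M X h n - 4 * (v n / real n)\<bar> \<le> 32 * c4 * (8 / real l) + 4 * (c4 + 1) / real l"
    using U_variance_approx[OF n(1,2)] by linarith
  moreover have "\<bar>4 * (v l / real l) - 4 * (v n / real n)\<bar> \<le> 4 * (6 * c0 * kern_mass / real l)"
    using v_ratio[OF n(2,3)] by linarith
  ultimately have "\<bar>4 * (v l / real l) - U_variance M X h n\<bar>
     \<le> 4 * (6 * c0 * kern_mass / real l) + (32 * c4 * (8 / real l) + 4 * (c4 + 1) / real l)" by linarith
  also have "\<dots> = cV / real l" by (simp add: cV_def add_divide_distrib)
  finally show ?thesis .
qed

text \<open>The error is split into the effect of the degenerate part, the fluctuation of the linear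
  variance estimator, and the bias. With \<eta> = 1/l and l^3 <= 8 n each has second moment
  O(1/l^2).\<close>

lemma cbb_MSE_le:
  assumes n: "n \<ge> 2" "1 \<le> l" "l \<le> n" and ln: "real l ^ 3 \<le> 8 * real n"
  shows "cbb_MSE M X h n l \<le> ennreal ((48 * 1048576 * 64 * c4 + 48 * 4096 * 64 * c4 + 48 * 4096 * 4096 * c5
      + 64 * c4 + 128 * (72 * cD) + 128 * (64 * c4) + 4 * cV\<^sup>2) / (real l)\<^sup>2)"
proof -
  define x where "x = real l"
  define N where "N = real n"
  define VB where "VB \<omega> = remainder_bound h2 n l (n div l) (sample \<omega>)" for \<omega>
  define VA where "VA \<omega> = linear_variance h1 n l (sample \<omega>)" for \<omega>
  define U where "U = U_variance M X h n"
  note m = averages_moments[OF _ n(2,3), folded x_def N_def]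
  have x: "1 \<le> x" "2 \<le> N" using n by (auto simp: x_def N_def)
  have xN: "x ^ 3 \<le> 8 * N" using ln by (simp add: x_def N_def)
  define k1 where "k1 = 48 * 1048576 * ((x / N)\<^sup>2 / x ^ 4)"
  define k2 where "k2 = 48 * 4096 / x ^ 4"
  define k3 where "k3 = 48 * 4096 * ((x / N) ^ 4 / x ^ 4)"
  define k4 where "k4 = 64 / x ^ 4"
  define k5 where "k5 = 128 / x\<^sup>2 / N\<^sup>2"
  define k6 where "k6 = 128 / x\<^sup>2"
  define k7 where "k7 = 4 * cV\<^sup>2 / x\<^sup>2"
  define R where "R \<omega> = k1 * pair_moment4 n l \<omega> + k2 * margin_moment4 n l \<omega> + k3 * diag_moment4 n l \<omega> + k4 * block_moment4 n l \<omega> + k5 * dev2_total n l \<omega> + k6 * mean_moment4 n l \<omega> + k7" for \<omega>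
  have k0: "0 \<le> k1" "0 \<le> k2" "0 \<le> k3" "0 \<le> k4" "0 \<le> k5" "0 \<le> k6"
    using x by (auto simp: k1_def k2_def k3_def k4_def k5_def k6_def)
  have N2: "n div l * l \<ge> 2"
  proof (cases "l = 1")
    case False
    have "1 \<le> n div l" using n div_greater_zero_iff[of n l] by simp
    then have "l \<le> n div l * l" by simp
    then show ?thesis using False n by linarith
  qed (use n in simp)
  have pt: "(cbb_variance h n l (sample \<omega>) - U)\<^sup>2 \<le> R \<omega>" for \<omega>
  proof -
    note rb = remainder_bound_square[OF n, of \<omega>, folded VB_def x_def N_def]
    note lb = linear_variance_bounds[OF n, of \<omega>, folded VA_def x_def N_def]
    \<comment> \<open>Effect of the degenerate part (a), fluctuation (b) and bias (c).\<close>
    define a where "a = cbb_variance h n l (sample \<omega>) - VA \<omega>"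
    define b where "b = VA \<omega> - 4 * (v l / x)"
    define c where "c = 4 * (v l / x) - U"
    \<comment> \<open>The perturbation bound with \<eta> = 1/x; the next step uses 1 + x <= 2
      x.\<close>
    have "\<bar>a\<bar> \<le> (1 + 1 / (1 / x)) * VB \<omega> + 1 / x * VA \<omega>"
      unfolding a_def VA_def VB_def
      by (rule cbb_variance_perturbation[OF _ n(2,3) N2 _ dec sym2]) (use x n in auto)
    also have "\<dots> \<le> (2 * x) * VB \<omega> + 1 / x * VA \<omega>"
      using x rb(1) by (intro add_right_mono mult_right_mono) auto
    finally have a: "\<bar>a\<bar> \<le> 2 * x * VB \<omega> + VA \<omega> / x" by simp
    have c: "\<bar>c\<bar> \<le> cV / x" unfolding c_def U_def x_def by (rule bias_bound[OF n ln])
    have sq4: "(p + q + r + t)\<^sup>2 \<le> 4 * (p\<^sup>2 + q\<^sup>2 + r\<^sup>2 + t\<^sup>2)" for p q r t :: real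
    proof -
      have "0 \<le> (p - q)\<^sup>2 + (p - r)\<^sup>2 + (p - t)\<^sup>2 + (q - r)\<^sup>2 + (q - t)\<^sup>2 + (r - t)\<^sup>2" by simp
      then show ?thesis by (simp add: power2_eq_square algebra_simps)
    qed
    have "cbb_variance h n l (sample \<omega>) - U = a + b + c" by (simp add: a_def b_def c_def)
    then have "(cbb_variance h n l (sample \<omega>) - U)\<^sup>2 = \<bar>a + b + c\<bar>\<^sup>2" by simp
    also have "\<dots> \<le> (2 * x * VB \<omega> + VA \<omega> / x + \<bar>b\<bar> + cV / x)\<^sup>2"
      using a c by (intro power_mono) auto
    also have "\<dots> \<le> 4 * ((2 * x * VB \<omega>)\<^sup>2 + (VA \<omega> / x)\<^sup>2 + \<bar>b\<bar>\<^sup>2 + (cV / x)\<^sup>2)" by (rule sq4)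
    also have "\<dots> = 16 * x\<^sup>2 * (VB \<omega>)\<^sup>2 + 4 / x\<^sup>2 * (VA \<omega>)\<^sup>2 + 4 * b\<^sup>2 + k7"
      by (simp add: power_mult_distrib power_divide k7_def)
    also have "\<dots> \<le> 16 * x\<^sup>2 * (3 / x ^ 6 * (1048576 * (x / N)\<^sup>2 * pair_moment4 n l \<omega> + 4096 * margin_moment4 n l \<omega> + 4096 * (x / N) ^ 4 * diag_moment4 n l \<omega>))
       + 4 / x\<^sup>2 * (16 / x\<^sup>2 * block_moment4 n l \<omega>) + 4 * (32 / x\<^sup>2 * (dev2_total n l \<omega> / N\<^sup>2 + mean_moment4 n l \<omega>)) + k7"
      using rb(2) lb(2,3) x unfolding b_def by (intro add_mono mult_left_mono order_refl) auto
    also have "\<dots> = R \<omega>"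
    proof -
      have e1: "16 * x\<^sup>2 * (3 / x ^ 6 * y) = 48 / x ^ 4 * y" for y
        using x by (simp add: field_simps)
      have e2: "4 / x\<^sup>2 * (16 / x\<^sup>2 * y) = 64 / x ^ 4 * y" for y
        by (simp add: power_add[symmetric])
      show ?thesis unfolding e1 e2 R_def k1_def k2_def k3_def k4_def k5_def k6_def by (simp add: algebra_simps)
    qed
    finally show ?thesis .
  qed
  have Ri: "integrable M R"
    unfolding R_def using n
    by (intro Bochner_Integration.integrable_add integrable_mult_right m integrable_const) auto
  have R0: "0 \<le> R \<omega>" for \<omega> using pt[of \<omega>] by (rule order_trans[rotated]) simp
  have "cbb_MSE M X h n l = (\<integral>\<^sup>+\<omega>. ennreal ((cbb_variance h n l (sample \<omega>) - U)\<^sup>2) \<partial>M)"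
    by (simp add: cbb_MSE_def U_def)
  \<comment> \<open>In \<open>ennreal\<close> the pointwise domination passes to the integral, and
    integrability is asked of \<open>R\<close> alone.\<close>
  also have "\<dots> \<le> (\<integral>\<^sup>+\<omega>. ennreal (R \<omega>) \<partial>M)"
    by (intro nn_integral_mono ennreal_leI pt)
  also have "\<dots> = ennreal (expectation R)"
    by (rule nn_integral_eq_integral[OF Ri]) (simp add: R0)
  also have "\<dots> \<le> ennreal ((48 * 1048576 * 64 * c4 + 48 * 4096 * 64 * c4 + 48 * 4096 * 4096 * c5
      + 64 * c4 + 128 * (72 * cD) + 128 * (64 * c4) + 4 * cV\<^sup>2) / x\<^sup>2)"
  proof (rule ennreal_leI)
    have n1: "n \<ge> 1" using n by simp
    note m = m[OF n1]
    have ER: "expectation R = k1 * expectation (pair_moment4 n l) + k2 * expectation (margin_moment4 n l) + k3 * expectation (diag_moment4 n l)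
       + k4 * expectation (block_moment4 n l) + k5 * expectation (dev2_total n l) + k6 * expectation (mean_moment4 n l) + k7"
      unfolding R_def using m by (simp add: prob_space)
    \<comment> \<open>The form in which x^3 <= 8 N enters all terms of the degenerate part.\<close>
    have r1: "x / N \<le> 8 / x\<^sup>2" using xN x by (simp add: field_simps power2_eq_square power3_eq_cube)
    have r2: "(x / N)\<^sup>2 \<le> 64 / x ^ 4"
    proof -
      have "(x / N)\<^sup>2 \<le> (8 / x\<^sup>2)\<^sup>2" using r1 x by (intro power_mono) auto
      also have "\<dots> = 64 / x ^ 4" by (simp add: power_divide)
      finally show ?thesis .
    qed
    have r4: "(x / N) ^ 4 \<le> 4096 / x ^ 8"
    proof -
      have "((x / N)\<^sup>2)\<^sup>2 \<le> (64 / x ^ 4)\<^sup>2" using r2 by (intro power_mono) auto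
      then show ?thesis by (simp add: power_divide)
    qed
    have c5: "0 \<le> c5" using c4 L by (simp add: c5_def)
    have t1: "k1 * expectation (pair_moment4 n l) \<le> 48 * 1048576 * 64 * c4 / x\<^sup>2"
    proof -
      have "k1 * expectation (pair_moment4 n l) \<le> k1 * (c4 * x ^ 6)" by (intro mult_left_mono m k0)
      also have "\<dots> = 48 * 1048576 * c4 * (x\<^sup>2 * (x / N)\<^sup>2)"
        using x by (simp add: k1_def field_simps)
      also have "\<dots> \<le> 48 * 1048576 * c4 * (x\<^sup>2 * (64 / x ^ 4))"
        using r2 c4 by (intro mult_left_mono) auto
      also have "\<dots> = 48 * 1048576 * 64 * c4 / x\<^sup>2"
        using x by (simp add: power4_eq_xxxx power2_eq_square)
      finally show ?thesis .
    qed
    have t2: "k2 * expectation (margin_moment4 n l) \<le> 48 * 4096 * 64 * c4 / x\<^sup>2"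
    proof -
      have "k2 * expectation (margin_moment4 n l) \<le> k2 * (c4 * x ^ 8 / N\<^sup>2)" by (intro mult_left_mono m k0)
      also have "\<dots> = 48 * 4096 * c4 * (x\<^sup>2 * (x / N)\<^sup>2)"
        using x by (simp add: k2_def power_divide field_simps)
      also have "\<dots> \<le> 48 * 4096 * c4 * (x\<^sup>2 * (64 / x ^ 4))"
        using r2 c4 by (intro mult_left_mono) auto
      also have "\<dots> = 48 * 4096 * 64 * c4 / x\<^sup>2"
        using x by (simp add: power4_eq_xxxx power2_eq_square)
      finally show ?thesis .
    qed
    have t3: "k3 * expectation (diag_moment4 n l) \<le> 48 * 4096 * 4096 * c5 / x\<^sup>2"
    proof -
      have "k3 * expectation (diag_moment4 n l) \<le> k3 * (c5 * x ^ 6)" by (intro mult_left_mono m k0)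
      also have "\<dots> = 48 * 4096 * c5 * (x\<^sup>2 * (x / N) ^ 4)"
        using x by (simp add: k3_def field_simps)
      also have "\<dots> \<le> 48 * 4096 * c5 * (x\<^sup>2 * (4096 / x ^ 8))"
        using r4 c5 by (intro mult_left_mono) auto
      also have "\<dots> = 48 * 4096 * 4096 * c5 / x ^ 6"
        using x by (simp add: field_simps)
      also have "\<dots> \<le> 48 * 4096 * 4096 * c5 / x\<^sup>2"
        using x c5 by (intro divide_left_mono power_increasing mult_nonneg_nonneg) auto
      finally show ?thesis .
    qed
    have t4: "k4 * expectation (block_moment4 n l) \<le> 64 * c4 / x\<^sup>2"
    proof -
      have "k4 * expectation (block_moment4 n l) \<le> k4 * (c4 * x\<^sup>2)" by (intro mult_left_mono m k0)
      also have "\<dots> = 64 * c4 / x\<^sup>2" using x by (simp add: k4_def power4_eq_xxxx power2_eq_square)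
      finally show ?thesis .
    qed
    have xx: "(x\<^sup>2 / N)\<^sup>2 \<le> 64"
    proof -
      have "x\<^sup>2 \<le> x ^ 3" using x by (intro power_increasing) auto
      then have "x\<^sup>2 / N \<le> 8" using xN x by (simp add: field_simps)
      then have "(x\<^sup>2 / N)\<^sup>2 \<le> 8\<^sup>2" using x by (intro power_mono) auto
      then show ?thesis by simp
    qed
    then have xx4: "x ^ 4 / N\<^sup>2 \<le> 64" by (simp add: power_divide)
    \<comment> \<open>The constant 72 = 8 + 64 joins the bound 8 for x^3 / N from the fitting blocks
      and the bound 64 for x^4 / N^2 from the wrapping ones.\<close>
    have t5: "k5 * expectation (dev2_total n l) \<le> 128 * (72 * cD) / x\<^sup>2"
    proof -
      have "k5 * expectation (dev2_total n l) \<le> k5 * (cD * (N * x ^ 3 + x ^ 4))" by (intro mult_left_mono m k0)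
      also have "\<dots> = 128 * (cD * (x ^ 3 / N + x ^ 4 / N\<^sup>2)) / x\<^sup>2"
      proof -
        have "N * x ^ 3 / N\<^sup>2 = x ^ 3 / N" using x by (simp add: power2_eq_square)
        then have "x ^ 3 / N + x ^ 4 / N\<^sup>2 = (N * x ^ 3 + x ^ 4) / N\<^sup>2" by (simp only: add_divide_distrib)
        then show ?thesis by (simp add: k5_def)
      qed
      also have "\<dots> \<le> 128 * (cD * (8 + 64)) / x\<^sup>2"
      proof (intro divide_right_mono mult_left_mono add_mono xx4 cD(1))
        show "x ^ 3 / N \<le> 8" using xN x by (simp add: field_simps)
      qed auto
      finally show ?thesis by (simp add: mult.commute)
    qed
    have t6: "k6 * expectation (mean_moment4 n l) \<le> 128 * (64 * c4) / x\<^sup>2"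
    proof -
      have "k6 * expectation (mean_moment4 n l) \<le> k6 * (c4 * x ^ 4 / N\<^sup>2)" by (intro mult_left_mono m k0)
      also have "\<dots> = 128 * (c4 * (x ^ 4 / N\<^sup>2)) / x\<^sup>2" by (simp add: k6_def)
      also have "\<dots> \<le> 128 * (c4 * 64) / x\<^sup>2"
        by (intro divide_right_mono mult_left_mono xx4 c4) auto
      finally show ?thesis by (simp add: mult.commute)
    qed
    show "expectation R \<le> (48 * 1048576 * 64 * c4 + 48 * 4096 * 64 * c4 + 48 * 4096 * 4096 * c5
      + 64 * c4 + 128 * (72 * cD) + 128 * (64 * c4) + 4 * cV\<^sup>2) / x\<^sup>2"
      unfolding ER k7_def add_divide_distrib
      by (intro add_mono t1 t2 t3 t4 t5 t6 order_refl)
  qed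
  finally show ?thesis by (simp only: x_def)
qed

end

section \<open>Choice of the block length and conclusion\<close>

lemma cube_root_block_length:
  fixes n :: nat
  assumes "n \<ge> 1"
  defines "l \<equiv> nat \<lceil>real n powr (1 / 3)\<rceil>"
  shows "1 \<le> l" "l \<le> n" "real n powr (1 / 3) \<le> real l" "real l \<le> 2 * real n powr (1 / 3)" "real l ^ 3 \<le> 8 * real n"
proof -
  let ?r = "real n powr (1 / 3)"
  have r1: "1 \<le> ?r" using assms by (intro ge_one_powr_ge_zero) auto
  have "?r \<le> real n powr 1" using assms by (intro powr_mono) auto
  then have rn: "?r \<le> real n" using assms by simp
  show 1: "1 \<le> l" unfolding l_def using r1 by linarith
  show "l \<le> n" unfolding l_def using rn by (simp add: ceiling_le_iff)
  show rl: "?r \<le> real l" unfolding l_def by linarith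
  \<comment> \<open>As n^(1/3) >= 1, rounding up at most doubles it, and cubing the 2 gives the 8 in
    l^3 <= 8 n.\<close>
  have "real l \<le> ?r + 1" unfolding l_def using r1 by linarith
  then show l2: "real l \<le> 2 * ?r" using r1 by linarith
  have "real l ^ 3 \<le> (2 * ?r) ^ 3" using l2 by (intro power_mono) auto
  also have "\<dots> = 8 * real n"
  proof -
    have "?r ^ 3 = ?r powr 3" using r1 by (simp add: powr_numeral)
    also have "\<dots> = real n" using assms by (simp add: powr_powr)
    finally show ?thesis by (simp add: power_mult_distrib)
  qed
  finally show "real l ^ 3 \<le> 8 * real n" .
qed

theorem corollary2p3:
  fixes M :: "'a measure"
    and X :: "nat \<Rightarrow> 'a \<Rightarrow> real"
    and h :: "real \<Rightarrow> real \<Rightarrow> real"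
    and \<delta> \<delta>' K :: real
  defines "F \<equiv> distr M borel (X 1)"
  assumes "prob_space M"
    and "\<And>i. i \<ge> 1 \<Longrightarrow> X i \<in> borel_measurable M"
    and "strictly_stationary M X"
    and "absolutely_regular M X"
    and "case_prod h \<in> borel_measurable (borel \<Otimes>\<^sub>M borel)"
    and "\<And>x y. h x y = h y x"
    and "\<delta> > 0" and "K > 0"
    and "(\<integral>\<^sup>+x2. \<integral>\<^sup>+x1. ennreal (\<bar>h x1 x2\<bar> powr (6 + \<delta>)) \<partial>F \<partial>F) \<le> ennreal K"
    and "\<And>k :: nat.
      (\<integral>\<^sup>+(x, y). ennreal (\<bar>h x y\<bar> powr (4 + 2 / 3 * \<delta>))
         \<partial>(distr M (borel \<Otimes>\<^sub>M borel) (\<lambda>\<omega>. (X 1 \<omega>, X (1 + k) \<omega>)))) \<le> ennreal K"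
    and "0 < \<delta>'" and "\<delta>' < \<delta>"
    and "beta_mix M X \<in> O(\<lambda>n. real n powr (- (3 * (6 + \<delta>') / \<delta>')))"
  shows "\<exists>l :: nat \<Rightarrow> nat.
           (\<forall>n\<ge>1. 1 \<le> l n \<and> l n \<le> n) \<and>
           (\<lambda>n. inverse (real (l n)) + (real (l n))\<^sup>2 * inverse (real n)) \<longlonglongrightarrow> 0 \<and>
           (\<forall>\<^sub>F n in sequentially. cbb_MSE M X h n (l n) < \<infinity>) \<and>
           (\<lambda>n. enn2real (cbb_MSE M X h n (l n))) \<in> O(\<lambda>n. real n powr (- (2 / 3)))"
proof -
  interpret P: prob_space M by fact
  \<comment> \<open>The exponent that truncation requires. The assumed one is 3 + 18/\<delta>',
    which is larger because \<delta>' < \<delta>.\<close>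
  let ?e = "3 + 18 / \<delta>"
  have ex: "?e \<le> 3 * (6 + \<delta>') / \<delta>'"
  proof -
    have "18 / \<delta> \<le> 18 / \<delta>'" using assms(12,13) by (intro divide_left_mono) auto
    moreover have "3 * (6 + \<delta>') / \<delta>' = 18 / \<delta>' + 3" using assms(12) by (simp add: field_simps)
    ultimately show ?thesis by simp
  qed
  have sub: "two_subalgebras M (sigma_gen M X I) (sigma_gen M X J)" if "I \<subseteq> {1..}" "J \<subseteq> {1..}" for I J
  proof -
    have "subalgebra M (sigma_gen M X I)" if "I \<subseteq> {1..}" for I
      unfolding subalgebra_def sigma_gen_def
      by (intro conjI sets_image_in_sets measurable_restrict assms(3)) (use that in auto)
    then show ?thesis using that by (simp add: two_subalgebras_def two_subalgebras_axioms_def P.prob_space_axioms)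
  qed
  have beta1: "beta_mix M X m \<le> 1" for m
    unfolding beta_mix_def by (rule cSUP_least) (auto intro!: two_subalgebras.beta_dep_unit(2)[OF sub])
  obtain c where c: "c > 0" "\<forall>\<^sub>F n in sequentially. norm (beta_mix M X n) \<le> c * norm (real n powr (- (3 * (6 + \<delta>') / \<delta>')))"
    using landau_o.bigE[OF assms(14)] by blast
  then obtain n0 where n0: "\<And>n. n \<ge> n0 \<Longrightarrow> \<bar>beta_mix M X n\<bar> \<le> c * real n powr (- (3 * (6 + \<delta>') / \<delta>'))"
    by (auto simp: eventually_sequentially)
  \<comment> \<open>The Landau bound holds from \<open>n0\<close> on only. Below it the coefficients
    are at most 1, and the second summand makes the right-hand side at least 1 there.\<close>
  define B where "B = c + real (Suc n0) powr ?e"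
  have B: "B > 0" using c(1) by (simp add: B_def add_pos_nonneg)
  have rate: "beta_mix M X m \<le> B * real m powr (- ?e)" if m: "m \<ge> 1" for m
  proof (cases "n0 \<le> m")
    case True
    have "beta_mix M X m \<le> c * real m powr (- (3 * (6 + \<delta>') / \<delta>'))" using n0[OF True] by linarith
    also have "\<dots> \<le> c * real m powr (- ?e)" using c(1) m ex by (intro mult_left_mono powr_mono) auto
    also have "\<dots> \<le> B * real m powr (- ?e)" by (intro mult_right_mono) (auto simp: B_def)
    finally show ?thesis .
  next
    case False
    have "1 = real m powr ?e * real m powr (- ?e)" using m by (simp add: powr_add[symmetric])
    also have "\<dots> \<le> B * real m powr (- ?e)"
    proof (intro mult_right_mono)
      have "real m powr ?e \<le> real (Suc n0) powr ?e" using False assms(8) by (intro powr_mono2) auto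
      then show "real m powr ?e \<le> B" using c(1) by (simp add: B_def)
    qed simp
    finally show ?thesis using beta1[of m] by linarith
  qed
  interpret mp: mixing_process M X \<delta> B
    by unfold_locales (use assms B rate in auto)
  interpret kp: kernel_process M X \<delta> B h K
    by unfold_locales (use assms in \<open>auto simp: mp.F1_def F_def\<close>)
  obtain L where L: "L \<ge> 1" "mp.bounded_moments L kp.h2" "mp.bounded_moments L (\<lambda>x _. kp.h1 x)"
    using kp.components_bounded by blast
  interpret dp: decomposed_process M X \<delta> B h kp.\<theta> kp.h1 kp.h2 L
    by unfold_locales (use L kp.hoeffding kp.h2_sym kp.degenerate_h1 kp.degenerate_h2 in auto)
  define C where "C = 48 * 1048576 * 64 * dp.c4 + 48 * 4096 * 64 * dp.c4 + 48 * 4096 * 4096 * dp.c5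
      + 64 * dp.c4 + 128 * (72 * dp.cD) + 128 * (64 * dp.c4) + 4 * dp.cV\<^sup>2"
  have C: "0 \<le> C"
    unfolding C_def using dp.c4 dp.cD(1) L(1) by (intro add_nonneg_nonneg mult_nonneg_nonneg) (auto simp: dp.c5_def)
  define l where "l n = nat \<lceil>real n powr (1 / 3)\<rceil>" for n :: nat
  note lp = cube_root_block_length[folded l_def]
  have bound: "cbb_MSE M X h n (l n) \<le> ennreal (C * real n powr (- (2 / 3)))" if n: "n \<ge> 2" for n
  proof -
    have n1: "n \<ge> 1" using n by simp
    have "cbb_MSE M X h n (l n) \<le> ennreal (C / (real (l n))\<^sup>2)"
      unfolding C_def by (rule dp.cbb_MSE_le[OF n lp(1,2,5)[OF n1]])
    also have "\<dots> \<le> ennreal (C * real n powr (- (2 / 3)))"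
    proof (rule ennreal_leI)
      have "C / (real (l n))\<^sup>2 \<le> C / (real n powr (1 / 3))\<^sup>2"
        using C lp(1,3)[OF n1] n by (intro divide_left_mono power_mono) auto
      also have "\<dots> = C * real n powr (- (2 / 3))"
      proof -
        have "(real n powr (1 / 3))\<^sup>2 = real n powr (2 / 3)"
          by (simp add: power2_eq_square powr_add[symmetric])
        then show ?thesis by (simp only: powr_minus divide_inverse)
      qed
      finally show "C / (real (l n))\<^sup>2 \<le> C * real n powr (- (2 / 3))" .
    qed
    finally show ?thesis .
  qed
  show ?thesis
  proof (intro exI[of _ l] conjI)
    show "\<forall>n\<ge>1. 1 \<le> l n \<and> l n \<le> n" using lp by blast
    have lim: "(\<lambda>n. real n powr (- (1 / 3))) \<longlonglongrightarrow> 0"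
      by (rule tendsto_neg_powr[OF _ filterlim_real_sequentially]) simp
    \<comment> \<open>Majorant obtained from n^(1/3) <= l <= 2 n^(1/3): the 4 is 2^2 and 2/3 - 1 =
      -1/3.\<close>
    have "(\<lambda>n. real n powr (- (1 / 3)) + 4 * real n powr (- (1 / 3))) \<longlonglongrightarrow> 0 + 4 * 0"
      by (intro tendsto_intros lim)
    then have lim5: "(\<lambda>n. real n powr (- (1 / 3)) + 4 * real n powr (- (1 / 3))) \<longlonglongrightarrow> 0" by simp
    show "(\<lambda>n. inverse (real (l n)) + (real (l n))\<^sup>2 * inverse (real n)) \<longlonglongrightarrow> 0"
    proof (rule tendsto_sandwich[OF _ _ tendsto_const lim5])
      show "\<forall>\<^sub>F n in sequentially. 0 \<le> inverse (real (l n)) + (real (l n))\<^sup>2 * inverse (real n)"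
        by (intro always_eventually allI) auto
      show "\<forall>\<^sub>F n in sequentially. inverse (real (l n)) + (real (l n))\<^sup>2 * inverse (real n)
          \<le> real n powr (- (1 / 3)) + 4 * real n powr (- (1 / 3))"
        using eventually_ge_at_top[of 1]
      proof eventually_elim
        case (elim n)
        let ?r = "real n powr (1 / 3)"
        have r: "0 < ?r" using elim by simp
        have 1: "inverse (real (l n)) \<le> real n powr (- (1 / 3))"
          unfolding powr_minus using lp(3)[OF elim] r by (intro le_imp_inverse_le) auto
        have "(real (l n))\<^sup>2 \<le> (2 * ?r)\<^sup>2" using lp(4)[OF elim] by (intro power_mono) auto
        also have "\<dots> = 4 * real n powr (2 / 3)"
          by (simp add: power2_eq_square powr_add[symmetric])
        finally have "(real (l n))\<^sup>2 * inverse (real n) \<le> 4 * real n powr (2 / 3) * inverse (real n)"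
          by (intro mult_right_mono) auto
        also have "\<dots> = 4 * (real n powr (2 / 3) * real n powr (- 1))"
          using elim by (simp add: powr_minus)
        also have "\<dots> = 4 * real n powr (- (1 / 3))" by (subst powr_add[symmetric]) simp
        finally show ?case using 1 by linarith
      qed
    qed
    show "\<forall>\<^sub>F n in sequentially. cbb_MSE M X h n (l n) < \<infinity>"
      using eventually_ge_at_top[of 2] by eventually_elim (auto intro: le_less_trans[OF bound])
    show "(\<lambda>n. enn2real (cbb_MSE M X h n (l n))) \<in> O(\<lambda>n. real n powr (- (2 / 3)))"
    proof (rule bigoI[of _ C])
      show "\<forall>\<^sub>F n in sequentially. norm (enn2real (cbb_MSE M X h n (l n))) \<le> C * norm (real n powr (- (2 / 3)))"
        using eventually_ge_at_top[of 2]
      proof eventually_elim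
        case (elim n)
        have "enn2real (cbb_MSE M X h n (l n)) \<le> enn2real (ennreal (C * real n powr (- (2 / 3))))"
          by (intro enn2real_mono bound elim) simp
        also have "\<dots> = C * real n powr (- (2 / 3))" using C by simp
        finally show ?case by simp
      qed
    qed
  qed
qed

end
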